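(* Let $(R,\mathfrak m)$ be a $d$-dimensional Noetherian local ring with $d\geq1$, and let $\boldsymbol{\mathcal I}=(\mathcal I^{(1)},\ldots,\mathcal I^{(s)})$, $\mathcal I^{(i)}=\{I^{(i)}_n\}_{n\ge0}$, be a multigraded admissible collection of graded $\mathfrak m$-primary families. Let $\mathbf d=(d_1,\ldots,d_s)\in\mathbb N^s$ satisfy $d_1+\cdots+d_s=d$. Suppose that $\{x_{ij}\mid 1\leq i\leq s,\ 1\leq j\leq d_i\}$ is a strong homogeneous joint reduction of type $\mathbf d$ of $\boldsymbol{\mathcal I}$, where $x_{ij}\in I_{a_{ij}}^{(i)}$ and $a_{ij}\geq1$. Set $Q=(x_{ij}\mid 1\leq i\leq s,\ 1\leq j\leq d_i)$. Then $Q$ is $\mathfrak m$-primary and $$e(Q;R)=\left(\prod_{i=1}^{s}\prod_{j=1}^{d_i}a_{ij}\right)e\left(\mathcal I^{(1)[d_1]},\ldots,\mathcal I^{(s)[d_s]}\right).$$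
   Context: $\mathbb N$ includes $0$; $\mathbf e_i$ is the $i$-th unit vector; "$\mathbf n\gg\mathbf 0$" means: for all $\mathbf n\geq\mathbf n_0$ componentwise, for some $\mathbf n_0\in\mathbb N^s$. $e(I;R)$ is the Hilbert--Samuel multiplicity. A graded $\mathfrak m$-primary family is a family $\mathcal I=\{I_n\}_{n\ge0}$ of ideals with $I_0=R$, $I_n$ $\mathfrak m$-primary for $n>0$, and $I_mI_n\subseteq I_{m+n}$. Mixed multiplicities (Cutkosky): $P(n_1,\ldots,n_s)=\lim_{m\to\infty} e(I^{(1)}_{mn_1}\cdots I^{(s)}_{mn_s};R)/m^d$ exists for all $(n_1,\dots,n_s)\in\mathbb N^s$ and is a homogeneous real polynomial of degree $d$; one defines $e(\mathcal I^{(1)[d_1]},\ldots,\mathcal I^{(s)[d_s]})$ by $$P(n_1,\ldots,n_s)=\sum_{d_1+\cdots+d_s=d}\frac{d!}{d_1!\cdots d_s!}\,e\left(\mathcal I^{(1)[d_1]},\ldots,\mathcal I^{(s)[d_s]}\right)n_1^{d_1}\cdots n_s^{d_s}.$$ Multigraded admissibility: put $\mathcal F(\mathbf n)=I^{(1)}_{n_1}\cdots I^{(s)}_{n_s}$ for $\mathbf n\in\mathbb N^s$ and extend to $\mathbf n\in\mathbb Z^s$ by $\mathcal F(\mathbf n)=\mathcal F(\mathbf n^+)$, $\mathbf n^+=(\max\{n_1,0\},\ldots,\max\{n_s,0\})$. The collection is multigraded admissible with respect to a tuple $\mathbf J=(J_1,\ldots,J_s)$ of $\mathfrak m$-primary ideals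 if for all $\mathbf m,\mathbf n\in\mathbb Z^s$: (1) $\mathbf J^{\mathbf n}:=J_1^{n_1}\cdots J_s^{n_s}\subseteq\mathcal F(\mathbf n)$ (with $J_i^{n_i}=R$ if $n_i\le0$); (2) $\mathcal F(\mathbf n)\mathcal F(\mathbf m)\subseteq\mathcal F(\mathbf n+\mathbf m)$; (3) $\mathbf m\ge\mathbf n$ implies $\mathcal F(\mathbf m)\subseteq\mathcal F(\mathbf n)$; (4) the extended Rees algebra $\bigoplus_{\mathbf n\in\mathbb Z^s}\mathcal F(\mathbf n)\mathbf t^{\mathbf n}$ is a finite module over $R[J_1t_1,\ldots,J_st_s,t_1^{-1},\ldots,t_s^{-1}]$. It is multigraded admissible if this holds for some such $\mathbf J$. Strong homogeneous joint reduction of type $\mathbf r=(r_1,\ldots,r_s)\in\mathbb N^s$: positive integers $a_{ij}$ and elements $x_{ij}\in I^{(i)}_{a_{ij}}$ ($1\le i\le s$, $1\le j\le r_i$) such that for all $\mathbf n\gg\mathbf0$, $$I_{n_1}^{(1)}\cdots I_{n_s}^{(s)}=\sum_{i=1}^{s}\sum_{j=1}^{r_i}x_{ij}\,I_{n_1}^{(1)}\cdots I_{n_i-a_{ij}}^{(i)}\cdots I_{n_s}^{(s)}.$$ *)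

theory Defs
  imports Complex_Main "HOL-Library.Extended_Nat" "HOL-Algebra.Algebra"
begin

section \<open>Local rings, primary ideals, Krull dimension\<close>

definition local_ring :: "('a, 'b) ring_scheme \<Rightarrow> 'a set \<Rightarrow> bool" where
  "local_ring R \<mm> \<longleftrightarrow>
     cring R \<and> maximalideal \<mm> R \<and> (\<forall>M. maximalideal M R \<longrightarrow> M = \<mm>)"

definition radical :: "('a, 'b) ring_scheme \<Rightarrow> 'a set \<Rightarrow> 'a set" where
  "radical R I = {x \<in> carrier R. \<exists>n::nat. x [^]\<^bsub>R\<^esub> n \<in> I}"

definition primary_ideal :: "('a, 'b) ring_scheme \<Rightarrow> 'a set \<Rightarrow> bool" where
  "primary_ideal R I \<longleftrightarrow>
     ideal I R \<and> I \<noteq> carrier R \<and>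
     (\<forall>x\<in>carrier R. \<forall>y\<in>carrier R. x \<otimes>\<^bsub>R\<^esub> y \<in> I \<longrightarrow> x \<in> I \<or> y \<in> radical R I)"

definition primary_to :: "('a, 'b) ring_scheme \<Rightarrow> 'a set \<Rightarrow> 'a set \<Rightarrow> bool" where
  "primary_to R \<pp> I \<longleftrightarrow> primary_ideal R I \<and> radical R I = \<pp>"

definition krull_dim :: "('a, 'b) ring_scheme \<Rightarrow> enat" where
  "krull_dim R =
     Sup {enat n | n. \<exists>P::nat \<Rightarrow> 'a set.
            (\<forall>i\<le>n. primeideal (P i) R) \<and> (\<forall>i<n. P i \<subset> P (Suc i))}"


section \<open>Length and Hilbert--Samuel multiplicity\<close>

definition module_length ::
    "('a, 'b) ring_scheme \<Rightarrow> ('a, 'c, 'd) module_scheme \<Rightarrow> enat" where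
  "module_length R M =
     Sup {enat n | n. \<exists>N::nat \<Rightarrow> 'c set.
            (\<forall>i\<le>n. submodule (N i) R M) \<and> (\<forall>i<n. N i \<subset> N (Suc i))}"

definition quot_module :: "('a, 'b) ring_scheme \<Rightarrow> 'a set \<Rightarrow> ('a, 'a set) module" where
  "quot_module R I =
     ring.extend (R Quot I) (module.fields
       (\<lambda>a c. (I +>\<^bsub>R\<^esub> a) \<otimes>\<^bsub>R Quot I\<^esub> c))"

text \<open>Powers and products of ideals are taken in the semiring \<open>ideals_set R\<close>; in particular
  \<open>I\<close> to the power \<open>0\<close> is \<open>carrier R\<close>. The multiplicity is also evaluated at
  the unit ideal, where it is \<open>0\<close>.\<close>

definition hs_multiplicity :: "('a, 'b) ring_scheme \<Rightarrow> 'a set \<Rightarrow> real" where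
  "hs_multiplicity R I =
     (let d = the_enat (krull_dim R) in
      lim (\<lambda>n::nat. fact d * real (the_enat (module_length R (quot_module R (I [^]\<^bsub>ideals_set R\<^esub> n))))
                    / real n ^ d))"


section \<open>Graded families and mixed multiplicities\<close>

text \<open>A collection of \<open>s\<close> families is indexed by a finite type \<open>'s\<close>; vectors in
  $\mathbb{N}^s$ and $\mathbb{Z}^s$ are functions on \<open>'s\<close>.\<close>

definition graded_primary_family ::
    "('a, 'b) ring_scheme \<Rightarrow> 'a set \<Rightarrow> (nat \<Rightarrow> 'a set) \<Rightarrow> bool" where
  "graded_primary_family R \<mm> I \<longleftrightarrow>
     I 0 = carrier R \<and>
     (\<forall>n>0. primary_to R \<mm> (I n)) \<and>
     (\<forall>m n. I m \<cdot>\<^bsub>R\<^esub> I n \<subseteq> I (m + n))"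

definition family_prod ::
    "('a, 'b) ring_scheme \<Rightarrow> ('s::finite \<Rightarrow> nat \<Rightarrow> 'a set) \<Rightarrow> ('s \<Rightarrow> nat) \<Rightarrow> 'a set" where
  "family_prod R I n = finprod (ideals_set R) (\<lambda>i. I i (n i)) UNIV"

definition is_mixed_multiplicities ::
    "('a, 'b) ring_scheme \<Rightarrow> ('s::finite \<Rightarrow> nat \<Rightarrow> 'a set) \<Rightarrow> (('s \<Rightarrow> nat) \<Rightarrow> real) \<Rightarrow> bool" where
  "is_mixed_multiplicities R I c \<longleftrightarrow>
     (let d = the_enat (krull_dim R) in
      (\<forall>k. (\<Sum>i\<in>UNIV. k i) \<noteq> d \<longrightarrow> c k = 0) \<and>
      (\<forall>n::'s \<Rightarrow> nat.
         (\<lambda>m::nat. hs_multiplicity R (family_prod R I (\<lambda>i. m * n i)) / real m ^ d)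
           \<longlonglongrightarrow> (\<Sum>k | (\<Sum>i\<in>UNIV. k i) = d.
                  fact d / (\<Prod>i\<in>UNIV. fact (k i)) * c k * (\<Prod>i\<in>UNIV. real (n i) ^ k i))))"

text \<open>The condition \<open>c k = 0\<close> outside total degree \<open>d\<close> only normalises the irrelevant
  values of \<open>c\<close>, so that \<open>c\<close> is unique. The existence of such a \<open>c\<close> (the limit exists and is a
  homogeneous polynomial of degree \<open>d\<close>) is Cutkosky's theorem.\<close>

definition mixed_multiplicity ::
    "('a, 'b) ring_scheme \<Rightarrow> ('s::finite \<Rightarrow> nat \<Rightarrow> 'a set) \<Rightarrow> ('s \<Rightarrow> nat) \<Rightarrow> real" where
  "mixed_multiplicity R I = (THE c. is_mixed_multiplicities R I c)"


section \<open>Laurent polynomials and multigraded admissibility\<close>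

definition laurent_ring ::
    "('a, 'b) ring_scheme \<Rightarrow> 's::finite itself \<Rightarrow> (('s \<Rightarrow> int) \<Rightarrow> 'a) ring" where
  "laurent_ring R _ =
     \<lparr>carrier = {f. (\<forall>n. f n \<in> carrier R) \<and> finite {n. f n \<noteq> \<zero>\<^bsub>R\<^esub>}},
      monoid.mult = (\<lambda>f g n. \<Oplus>\<^bsub>R\<^esub>k\<in>{k. f k \<noteq> \<zero>\<^bsub>R\<^esub>}. f k \<otimes>\<^bsub>R\<^esub> g (\<lambda>i. n i - k i)),
      one = (\<lambda>n. if n = (\<lambda>_. 0) then \<one>\<^bsub>R\<^esub> else \<zero>\<^bsub>R\<^esub>),
      ring.zero = (\<lambda>_. \<zero>\<^bsub>R\<^esub>),
      ring.add = (\<lambda>f g n. f n \<oplus>\<^bsub>R\<^esub> g n)\<rparr>"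

definition laurent_monom ::
    "('a, 'b) ring_scheme \<Rightarrow> 'a \<Rightarrow> ('s::finite \<Rightarrow> int) \<Rightarrow> (('s \<Rightarrow> int) \<Rightarrow> 'a)" where
  "laurent_monom R r e = (\<lambda>n. if n = e then r else \<zero>\<^bsub>R\<^esub>)"

definition unit_vec :: "'s::finite \<Rightarrow> 's \<Rightarrow> int" where
  "unit_vec i = (\<lambda>k. if k = i then 1 else 0)"

text \<open>\<open>nat\<close> truncates at \<open>0\<close>, so the next two definitions implement
  $\mathcal{F}(\mathbf{n}) = \mathcal{F}(\mathbf{n}^+)$ and $J_i^{n_i} = R$ for $n_i \le 0$.\<close>

definition family_prod_int ::
    "('a, 'b) ring_scheme \<Rightarrow> ('s::finite \<Rightarrow> nat \<Rightarrow> 'a set) \<Rightarrow> ('s \<Rightarrow> int) \<Rightarrow> 'a set" where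
  "family_prod_int R I n = family_prod R I (\<lambda>i. nat (n i))"

definition ideal_tuple_power ::
    "('a, 'b) ring_scheme \<Rightarrow> ('s::finite \<Rightarrow> 'a set) \<Rightarrow> ('s \<Rightarrow> int) \<Rightarrow> 'a set" where
  "ideal_tuple_power R J n =
     finprod (ideals_set R) (\<lambda>i. J i [^]\<^bsub>ideals_set R\<^esub> nat (n i)) UNIV"

definition extended_rees ::
    "('a, 'b) ring_scheme \<Rightarrow> ('s::finite \<Rightarrow> nat \<Rightarrow> 'a set) \<Rightarrow> (('s \<Rightarrow> int) \<Rightarrow> 'a) set" where
  "extended_rees R I =
     {f \<in> carrier (laurent_ring R TYPE('s)). \<forall>n. f n \<in> family_prod_int R I n}"

text \<open>The subring $R[J_1t_1,\ldots,J_st_s,t_1^{-1},\ldots,t_s^{-1}]$.\<close>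

definition extended_rees_base ::
    "('a, 'b) ring_scheme \<Rightarrow> ('s::finite \<Rightarrow> 'a set) \<Rightarrow> (('s \<Rightarrow> int) \<Rightarrow> 'a) set" where
  "extended_rees_base R J =
     generate_ring (laurent_ring R TYPE('s))
       ({laurent_monom R r (\<lambda>_. 0) | r. r \<in> carrier R} \<union>
        {laurent_monom R r (unit_vec i) | r i. r \<in> J i} \<union>
        {laurent_monom R \<one>\<^bsub>R\<^esub> (\<lambda>k. - unit_vec i k) | i. True})"

definition finite_module_over ::
    "('a, 'b) ring_scheme \<Rightarrow> 'a set \<Rightarrow> 'a set \<Rightarrow> bool" where
  "finite_module_over L A E \<longleftrightarrow>
     (\<exists>G. finite G \<and> G \<subseteq> E \<and> E = {\<Oplus>\<^bsub>L\<^esub>g\<in>G. a g \<otimes>\<^bsub>L\<^esub> g | a. a \<in> G \<rightarrow> A})"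

definition admissible_wrt ::
    "('a, 'b) ring_scheme \<Rightarrow> ('s::finite \<Rightarrow> nat \<Rightarrow> 'a set) \<Rightarrow> ('s \<Rightarrow> 'a set) \<Rightarrow> bool" where
  "admissible_wrt R I J \<longleftrightarrow>
     (\<forall>n. ideal_tuple_power R J n \<subseteq> family_prod_int R I n) \<and>
     (\<forall>n m. family_prod_int R I n \<cdot>\<^bsub>R\<^esub> family_prod_int R I m
              \<subseteq> family_prod_int R I (\<lambda>i. n i + m i)) \<and>
     (\<forall>n m. (\<forall>i. n i \<le> m i) \<longrightarrow> family_prod_int R I m \<subseteq> family_prod_int R I n) \<and>
     finite_module_over (laurent_ring R TYPE('s)) (extended_rees_base R J) (extended_rees R I)"

definition multigraded_admissible ::
    "('a, 'b) ring_scheme \<Rightarrow> 'a set \<Rightarrow> ('s::finite \<Rightarrow> nat \<Rightarrow> 'a set) \<Rightarrow> bool" where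
  "multigraded_admissible R \<mm> I \<longleftrightarrow>
     (\<exists>J. (\<forall>i. primary_to R \<mm> (J i)) \<and> admissible_wrt R I J)"


section \<open>Strong homogeneous joint reductions\<close>

text \<open>The degrees $n_i - a_{ij}$ are nonnegative for all large $\mathbf{n}$, so truncated subtraction
  is harmless. \<open>x <# I\<close> is the ideal $xI$, and the sum is a sum of ideals.\<close>

definition strong_joint_reduction ::
    "('a, 'b) ring_scheme \<Rightarrow> ('s::finite \<Rightarrow> nat \<Rightarrow> 'a set) \<Rightarrow> ('s \<Rightarrow> nat) \<Rightarrow>
     ('s \<Rightarrow> nat \<Rightarrow> nat) \<Rightarrow> ('s \<Rightarrow> nat \<Rightarrow> 'a) \<Rightarrow> bool" where
  "strong_joint_reduction R I r a x \<longleftrightarrow>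
     (\<forall>i. \<forall>j\<in>{1..r i}. 0 < a i j \<and> x i j \<in> I i (a i j)) \<and>
     (\<exists>n\<^sub>0. \<forall>n. (\<forall>i. n\<^sub>0 i \<le> n i) \<longrightarrow>
        family_prod R I n =
          (\<Oplus>\<^bsub>ideals_set R\<^esub>i\<in>UNIV. \<Oplus>\<^bsub>ideals_set R\<^esub>j\<in>{1..r i}.
             x i j <#\<^bsub>R\<^esub> family_prod R I (n(i := n i - a i j))))"

end

theory Submission
  imports Defs "HOL-Library.Function_Algebras" "HOL-Computational_Algebra.Polynomial"
begin

text \<open>For a sequence \<open>x\<close> of homogeneous elements and a graded module \<open>B/A\<close> given by two families of
  ideals, the alternating sum \<open>\<chi>(x; B/A)\<close> of lengths of iterated kernels and cokernels (Northcott's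
  symbol) is additive, equals the iterated difference of the Hilbert function when the lengths are
  finite, and vanishes in large degrees for a finitely generated module killed by some power of the
  joint reduction. Hence, if \<open>x\<close> is a joint reduction of a Noetherian filtration \<open>F\<close>, the iterated
  difference of \<open>n \<mapsto> length(R/F(n))\<close> in the degrees of \<open>x\<close> is eventually the constant \<open>\<chi>(x; R)\<close>, which
  does not depend on \<open>F\<close>. The filtration by powers of \<open>Q\<close> identifies \<open>\<chi>(x; R)\<close> with \<open>e(Q; R)\<close>. For the
  given filtration, finiteness of the extended Rees algebra sandwiches \<open>F(n)\<close> between \<open>J\<^sup>n\<close> and
  \<open>J\<^sup>n\<^sup>-\<^sup>c\<close>, so the lengths have the polynomial growth of those of \<open>R/J\<^sup>n\<close>, and the iterated
  difference extracts from the leading form the coefficient \<open>e(I\<^sup>[\<^sup>d\<^sup>]) / d!\<close> times the product of the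
  degrees \<open>a\<^sub>i\<^sub>j\<close>.\<close>

section \<open>Lengths of intervals of ideals\<close>

text \<open>Graded modules never occur as objects: a module is an interval \<open>B/A\<close>
  between two families of ideals of \<open>R\<close>, and kernels and cokernels of multiplications
  are again such intervals. Lengths alone would not do, because the constant family \<open>R\<close>
  has infinite length in every degree when the dimension is positive; the symbol only takes lengths
  after all elements of the list have acted. A second gap lies in the definition of mixed
  multiplicities: it uses powers of \<open>F(v)\<close>, whereas the iterated differences see
  \<open>R/F(n)\<close>. Both \<open>F(kv)\<close> and the \<open>k\<close>-th power of
  \<open>F(v)\<close> lie between \<open>J^(kv)\<close> and \<open>J^(kv-c)\<close>, and a bounded
  shift of the exponent changes the length only by \<open>O(k^(d-1))\<close>, so both have the same
  leading form. The exponent \<open>d\<close> in these estimates comes from the number of generators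
  of \<open>Q\<close>: the length of \<open>R/Q^N\<close> is at most \<open>N^d\<close> times that
  of \<open>R/Q\<close>, and a fixed power of \<open>Q\<close> lies in the product of the
  \<open>J i\<close>. Polynomiality is proved for the \<open>J\<close>-adic lengths only; of
  \<open>F\<close> just the limits along rays and one iterated difference are used.\<close>

definition ideal_length :: "('a, 'b) ring_scheme \<Rightarrow> 'a set \<Rightarrow> 'a set \<Rightarrow> enat" where
  "ideal_length R A B = Sup {enat n | n. \<exists>N::nat \<Rightarrow> 'a set.
     (\<forall>i\<le>n. ideal (N i) R \<and> A \<subseteq> N i \<and> N i \<subseteq> B) \<and> (\<forall>i<n. N i \<subset> N (Suc i))}"

text \<open>Since \<open>P\<close> is downward closed, a supremum that reaches \<open>n\<close> is
  witnessed at some index at least \<open>n\<close>, and an infinite supremum is covered as well.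
  Inequalities \<open>enat n \<le> len A B\<close> thus become the existence of a chain with
  \<open>n\<close> steps, which is how \<open>len_add\<close> and \<open>len_iso\<close> are
  proved.\<close>

lemma enat_le_Sup_iff:
  assumes "P 0" and "\<And>m n. P n \<Longrightarrow> m \<le> n \<Longrightarrow> P m"
  shows "enat n \<le> Sup {enat m | m. P m} \<longleftrightarrow> P n"
proof
  assume le: "enat n \<le> Sup {enat m | m. P m}"
  show "P n"
  proof (rule ccontr)
    assume np: "\<not> P n"
    hence lt: "m < n" if "P m" for m
      using assms(2)[OF that] by (meson not_le)
    have "Sup {enat m | m. P m} \<le> enat (n - 1)"
      by (rule Sup_least) (use lt in force)
    with le have "n \<le> n - 1"
      using order_trans enat_ord_simps(1) by blast
    moreover have "n > 0" using lt assms(1) by blast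
    ultimately show False by simp
  qed
qed (auto intro: Sup_upper)

lemma enat_eqI:
  fixes a b :: enat
  assumes "\<And>n. enat n \<le> a \<longleftrightarrow> enat n \<le> b"
  shows "a = b"
proof -
  have "x \<le> y" if "\<And>n. enat n \<le> x \<Longrightarrow> enat n \<le> y" for x y :: enat
  proof (cases x)
    case infinity
    show ?thesis
    proof (cases y)
      case (enat k)
      with that[of "Suc k"] infinity show ?thesis by simp
    qed simp
  qed (use that in blast)
  thus ?thesis using assms by (meson antisym)
qed

lemma enat_le_add_split:
  fixes a b :: enat
  assumes "enat n \<le> a + b"
  obtains i j where "n = i + j" "enat i \<le> a" "enat j \<le> b"
proof (cases a)
  case (enat k)
  show ?thesis
  proof (cases "n \<le> k")
    case True
    thus ?thesis using that[of n 0] enat by (simp add: zero_enat_def[symmetric])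
  next
    case False
    show ?thesis
    proof (rule that[of k "n - k"])
      show "enat (n - k) \<le> b" using assms enat False by (cases b) auto
    qed (use False enat in auto)
  qed
next
  case infinity
  thus ?thesis using that[of n 0] by (simp add: zero_enat_def[symmetric])
qed

context cring
begin

abbreviation len :: "'a set \<Rightarrow> 'a set \<Rightarrow> enat" where "len \<equiv> ideal_length R"

text \<open>The ideal \<open>A + xB\<close>, with \<open>col\<close> the colon ideal
  \<open>A : x\<close> cut down to \<open>B\<close>. For \<open>x = \<one>\<close> these are the sum
  and the intersection of two ideals, so one isomorphism lemma serves both multiplication maps and
  the second isomorphism theorem.\<close>

definition lin :: "'a \<Rightarrow> 'a set \<Rightarrow> 'a set \<Rightarrow> 'a set" where
  "lin x A B = {a \<oplus> x \<otimes> b | a b. a \<in> A \<and> b \<in> B}"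

definition col :: "'a \<Rightarrow> 'a set \<Rightarrow> 'a set \<Rightarrow> 'a set" where
  "col x A B = {b \<in> B. x \<otimes> b \<in> A}"

lemma ideal_subset_carrier: "ideal A R \<Longrightarrow> A \<subseteq> carrier R"
  by (auto dest: ideal.Icarr)

lemma ideal_add: "ideal A R \<Longrightarrow> a \<in> A \<Longrightarrow> b \<in> A \<Longrightarrow> a \<oplus> b \<in> A"
  by (meson additive_subgroup.a_closed ideal.axioms(1))

lemma ideal_zero: "ideal A R \<Longrightarrow> \<zero> \<in> A"
  by (meson additive_subgroup.zero_closed ideal.axioms(1))

lemma ideal_mult: "ideal A R \<Longrightarrow> a \<in> A \<Longrightarrow> r \<in> carrier R \<Longrightarrow> r \<otimes> a \<in> A"
  by (meson ideal.I_l_closed)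

lemma ideal_diff: "ideal A R \<Longrightarrow> a \<in> A \<Longrightarrow> b \<in> A \<Longrightarrow> a \<ominus> b \<in> A"
proof -
  assume a: "ideal A R" "a \<in> A" "b \<in> A"
  hence "(\<ominus> \<one>) \<otimes> b \<in> A" by (intro ideal_mult) auto
  hence "\<ominus> b \<in> A" using a ideal.Icarr by (simp add: l_minus ideal.Icarr)
  thus "a \<ominus> b \<in> A" unfolding a_minus_def using a ideal_add by blast
qed

lemma idealI':
  assumes "I \<subseteq> carrier R" "\<zero> \<in> I" "\<And>a b. a \<in> I \<Longrightarrow> b \<in> I \<Longrightarrow> a \<oplus> b \<in> I"
    and m: "\<And>a r. a \<in> I \<Longrightarrow> r \<in> carrier R \<Longrightarrow> r \<otimes> a \<in> I"
  shows "ideal I R"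
proof (rule idealI)
  show "subgroup I (add_monoid R)"
  proof (rule add.subgroupI)
    fix a assume "a \<in> I"
    hence "(\<ominus> \<one>) \<otimes> a \<in> I" and "a \<in> carrier R" using assms(1) m by auto
    thus "\<ominus> a \<in> I" by (simp add: l_minus)
  qed (use assms in auto)
  fix a r assume "a \<in> I" "r \<in> carrier R"
  thus "r \<otimes> a \<in> I" "a \<otimes> r \<in> I" using m assms(1) by (auto simp: m_comm subsetD)
qed (rule ring_axioms)

lemma lin_ideal:
  assumes "ideal A R" "ideal B R" "x \<in> carrier R"
  shows "ideal (lin x A B) R"
proof (rule idealI')
  note c = ideal.Icarr[OF assms(1)] ideal.Icarr[OF assms(2)]
  show "lin x A B \<subseteq> carrier R" using c assms(3) by (auto simp: lin_def)
  show "\<zero> \<in> lin x A B" unfolding lin_def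
    using ideal_zero[OF assms(1)] ideal_zero[OF assms(2)] assms(3) by force
  fix u assume u: "u \<in> lin x A B"
  then obtain a b where ab: "a \<in> A" "b \<in> B" "u = a \<oplus> x \<otimes> b" by (auto simp: lin_def)
  { fix v assume "v \<in> lin x A B"
    then obtain a' b' where ab': "a' \<in> A" "b' \<in> B" "v = a' \<oplus> x \<otimes> b'" by (auto simp: lin_def)
    have "u \<oplus> v = (a \<oplus> a') \<oplus> x \<otimes> (b \<oplus> b')"
      using ab ab' c assms(3) by (simp add: r_distr a_ac)
    thus "u \<oplus> v \<in> lin x A B" unfolding lin_def
      using ab ab' ideal_add assms(1,2) by blast }
  fix r assume r: "r \<in> carrier R"
  have "r \<otimes> u = r \<otimes> a \<oplus> x \<otimes> (r \<otimes> b)" using ab c assms(3) r by (simp add: r_distr m_ac)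
  thus "r \<otimes> u \<in> lin x A B" unfolding lin_def
    using ab r ideal_mult assms(1,2) by blast
qed

lemma col_ideal:
  assumes "ideal A R" "ideal B R" "x \<in> carrier R"
  shows "ideal (col x A B) R"
proof (rule idealI')
  note c = ideal.Icarr[OF assms(1)] ideal.Icarr[OF assms(2)]
  show "col x A B \<subseteq> carrier R" using c by (auto simp: col_def)
  show "\<zero> \<in> col x A B" unfolding col_def
    using ideal_zero[OF assms(1)] ideal_zero[OF assms(2)] assms(3) by auto
  fix u assume u: "u \<in> col x A B"
  { fix v assume "v \<in> col x A B"
    thus "u \<oplus> v \<in> col x A B" using u c assms
      by (auto simp: col_def r_distr ideal_add) }
  fix r assume r: "r \<in> carrier R"
  have "x \<otimes> (r \<otimes> u) = r \<otimes> (x \<otimes> u)" using u r c assms(3) by (simp add: col_def m_ac)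
  thus "r \<otimes> u \<in> col x A B" using u r assms by (simp add: col_def ideal_mult)
qed

lemma lin_upper1:
  assumes "ideal A R" "ideal B R" "x \<in> carrier R"
  shows "A \<subseteq> lin x A B"
proof
  fix a assume "a \<in> A"
  moreover have "a = a \<oplus> x \<otimes> \<zero>" using ideal.Icarr[OF assms(1) \<open>a \<in> A\<close>] assms(3) by simp
  ultimately show "a \<in> lin x A B" unfolding lin_def using ideal_zero[OF assms(2)] by blast
qed

lemma lin_upper2:
  assumes "ideal A R" "ideal B R" "x \<in> carrier R" "b \<in> B"
  shows "x \<otimes> b \<in> lin x A B"
proof -
  have "x \<otimes> b = \<zero> \<oplus> x \<otimes> b" using ideal.Icarr[OF assms(2,4)] assms(3) by simp
  thus ?thesis unfolding lin_def using ideal_zero[OF assms(1)] assms(4) by blast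
qed

lemma lin_least:
  assumes "ideal C R" "A \<subseteq> C" "\<And>b. b \<in> B \<Longrightarrow> x \<otimes> b \<in> C"
  shows "lin x A B \<subseteq> C"
  using assms ideal_add by (force simp: lin_def)

lemma len_ge_iff:
  assumes "ideal A R" "ideal B R" "A \<subseteq> B"
  shows "enat n \<le> len A B \<longleftrightarrow> (\<exists>N::nat \<Rightarrow> 'a set.
     (\<forall>i\<le>n. ideal (N i) R \<and> A \<subseteq> N i \<and> N i \<subseteq> B) \<and> (\<forall>i<n. N i \<subset> N (Suc i)))"
  unfolding ideal_length_def
proof (rule enat_le_Sup_iff)
  show "\<exists>N. (\<forall>i\<le>0. ideal (N i) R \<and> A \<subseteq> N i \<and> N i \<subseteq> B) \<and> (\<forall>i<0. N i \<subset> N (Suc i))"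
    using assms by (intro exI[of _ "\<lambda>_. A"]) auto
next
  fix m n :: nat
  assume "\<exists>N. (\<forall>i\<le>n. ideal (N i) R \<and> A \<subseteq> N i \<and> N i \<subseteq> B) \<and> (\<forall>i<n. N i \<subset> N (Suc i))" and "m \<le> n"
  thus "\<exists>N. (\<forall>i\<le>m. ideal (N i) R \<and> A \<subseteq> N i \<and> N i \<subseteq> B) \<and> (\<forall>i<m. N i \<subset> N (Suc i))"
    by (metis le_trans less_le_trans)
qed

text \<open>Deleting repetitions from a weakly increasing chain leaves a strict chain with as many
  steps as there were strict inclusions.\<close>

lemma weak_chain_le_len:
  assumes "\<forall>i\<le>n. ideal (N i) R \<and> A \<subseteq> N i \<and> N i \<subseteq> B" "\<forall>i<n. N i \<subseteq> N (Suc i)"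
  shows "enat (card {i. i < n \<and> N i \<noteq> N (Suc i)}) \<le> len A B"
proof -
  have "\<exists>M. (\<forall>i\<le>card {i. i < n \<and> N i \<noteq> N (Suc i)}. ideal (M i) R \<and> A \<subseteq> M i \<and> M i \<subseteq> B)
      \<and> (\<forall>i<card {i. i < n \<and> N i \<noteq> N (Suc i)}. M i \<subset> M (Suc i))
      \<and> M (card {i. i < n \<and> N i \<noteq> N (Suc i)}) = N n"
    using assms
  proof (induction n)
    case 0
    thus ?case by (intro exI[of _ N]) auto
  next
    case (Suc n)
    let ?m = "card {i. i < n \<and> N i \<noteq> N (Suc i)}"
    from Suc obtain M where M: "\<forall>i\<le>?m. ideal (M i) R \<and> A \<subseteq> M i \<and> M i \<subseteq> B"
      "\<forall>i<?m. M i \<subset> M (Suc i)" "M ?m = N n" by auto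
    show ?case
    proof (cases "N n = N (Suc n)")
      case True
      hence "{i. i < Suc n \<and> N i \<noteq> N (Suc i)} = {i. i < n \<and> N i \<noteq> N (Suc i)}"
        using less_Suc_eq by auto
      thus ?thesis using M True by auto
    next
      case False
      hence e: "{i. i < Suc n \<and> N i \<noteq> N (Suc i)} = insert n {i. i < n \<and> N i \<noteq> N (Suc i)}"
        using less_Suc_eq by auto
      have c: "card {i. i < Suc n \<and> N i \<noteq> N (Suc i)} = Suc ?m"
        unfolding e by (subst card_insert_disjoint) auto
      have "N n \<subset> N (Suc n)" using False Suc.prems(2) by auto
      thus ?thesis unfolding c
        using M Suc.prems(1) by (intro exI[of _ "M(Suc ?m := N (Suc n))"]) (auto simp: le_Suc_eq less_Suc_eq)
    qed
  qed
  then obtain M where M: "(\<forall>i\<le>card {i. i < n \<and> N i \<noteq> N (Suc i)}. ideal (M i) R \<and> A \<subseteq> M i \<and> M i \<subseteq> B)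
      \<and> (\<forall>i<card {i. i < n \<and> N i \<noteq> N (Suc i)}. M i \<subset> M (Suc i))" by blast
  show ?thesis unfolding ideal_length_def by (rule Sup_upper) (use M in blast)
qed

lemma len_self:
  assumes "ideal A R"
  shows "len A A = 0"
proof (rule ccontr)
  assume "len A A \<noteq> 0"
  hence "enat 1 \<le> len A A" by (metis ileI1 one_eSuc one_enat_def not_gr_zero)
  then obtain N where N: "\<forall>i\<le>1. ideal (N i) R \<and> A \<subseteq> N i \<and> N i \<subseteq> A" "\<forall>i<1. N i \<subset> N (Suc i)"
    using len_ge_iff[OF assms assms subset_refl, of 1] by auto
  have "N 0 = A" "N (Suc 0) = A" using N(1)[rule_format, of 0] N(1)[rule_format, of 1] by auto
  moreover have "N 0 \<subset> N (Suc 0)" using N(2) by simp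
  ultimately show False by simp
qed

lemma lin_one_mono: "B \<subseteq> C \<Longrightarrow> lin x A B \<subseteq> lin x A C"
  by (auto simp: lin_def)

text \<open>A chain from \<open>A\<close> to \<open>B\<close> is cut into its intersections with
  \<open>C\<close> and its sums with \<open>C\<close>, and every strict step stays strict in at
  least one of the two; conversely two chains are concatenated at \<open>C\<close>. Infinite lengths
  are included.\<close>

lemma len_add:
  assumes A: "ideal A R" and C: "ideal C R" and B: "ideal B R" and AC: "A \<subseteq> C" and CB: "C \<subseteq> B"
  shows "len A B = len A C + len C B"
proof (rule enat_eqI)
  fix n
  have AB: "A \<subseteq> B" using AC CB by auto
  show "enat n \<le> len A B \<longleftrightarrow> enat n \<le> len A C + len C B"
  proof
    assume "enat n \<le> len A B"
    then obtain N where N: "\<forall>i\<le>n. ideal (N i) R \<and> A \<subseteq> N i \<and> N i \<subseteq> B" "\<forall>i<n. N i \<subset> N (Suc i)"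
      using len_ge_iff[OF A B AB] by auto
    define S where "S = {i. i < n \<and> N i \<inter> C \<noteq> N (Suc i) \<inter> C}"
    define T where "T = {i. i < n \<and> lin \<one> C (N i) \<noteq> lin \<one> C (N (Suc i))}"
    have s: "enat (card S) \<le> len A C" unfolding S_def
    proof (rule weak_chain_le_len)
      show "\<forall>i\<le>n. ideal (N i \<inter> C) R \<and> A \<subseteq> N i \<inter> C \<and> N i \<inter> C \<subseteq> C"
        using N(1) AC C i_intersect by auto
      show "\<forall>i<n. N i \<inter> C \<subseteq> N (Suc i) \<inter> C" using N(2) by auto
    qed
    have t: "enat (card T) \<le> len C B" unfolding T_def
    proof (rule weak_chain_le_len)
      show "\<forall>i\<le>n. ideal (lin \<one> C (N i)) R \<and> C \<subseteq> lin \<one> C (N i) \<and> lin \<one> C (N i) \<subseteq> B"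
      proof (intro allI impI conjI)
        fix i assume i: "i \<le> n"
        show "ideal (lin \<one> C (N i)) R" "C \<subseteq> lin \<one> C (N i)"
          using N(1) i C by (auto intro: lin_ideal dest: lin_upper1)
        show "lin \<one> C (N i) \<subseteq> B"
          using N(1) i CB ideal.Icarr[OF B] by (intro lin_least[OF B]) (auto, metis l_one subsetD)
      qed
      show "\<forall>i<n. lin \<one> C (N i) \<subseteq> lin \<one> C (N (Suc i))"
        using N(2) by (meson lin_one_mono psubset_imp_subset)
    qed
    \<comment> \<open>Modular law: if neither the intersection with \<open>C\<close> nor the sum
      with \<open>C\<close> grew at step \<open>i\<close>, then
      \<open>N i = N (Suc i)\<close>.\<close>
    have "{..<n} \<subseteq> S \<union> T"
    proof (rule ccontr)
      assume "\<not> {..<n} \<subseteq> S \<union> T"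
      then obtain i where i: "i < n" "N i \<inter> C = N (Suc i) \<inter> C" "lin \<one> C (N i) = lin \<one> C (N (Suc i))"
        by (auto simp: S_def T_def)
      have id: "ideal (N i) R" "ideal (N (Suc i)) R" using N(1) i(1) by auto
      have "N (Suc i) \<subseteq> N i"
      proof
        fix v assume v: "v \<in> N (Suc i)"
        hence vc: "v \<in> carrier R" using id ideal.Icarr by metis
        have "\<one> \<otimes> v \<in> lin \<one> C (N (Suc i))" using v id C lin_upper2 by blast
        hence "v \<in> lin \<one> C (N i)" using vc i(3) by simp
        then obtain c b where cb: "c \<in> C" "b \<in> N i" "v = c \<oplus> \<one> \<otimes> b"
          by (auto simp: lin_def)
        have cc: "c \<in> carrier R" "b \<in> carrier R" using cb C id ideal.Icarr by metis+
        have "c = v \<ominus> b" using cb cc vc by (simp add: a_minus_def a_assoc r_neg)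
        hence "c \<in> N (Suc i)" using v cb(2) N(2) i(1) id by (auto intro: ideal_diff)
        hence "c \<in> N i" using i(2) cb(1) by auto
        thus "v \<in> N i" using cb cc id by (auto intro: ideal_add)
      qed
      thus False using N(2) i(1) by auto
    qed
    moreover have "finite S" "finite T" by (auto simp: S_def T_def)
    ultimately have "n \<le> card S + card T"
      by (metis card_Un_le card_lessThan card_mono finite_UnI le_trans)
    hence "enat n \<le> enat (card S) + enat (card T)" by simp
    also have "\<dots> \<le> len A C + len C B" by (intro add_mono s t)
    finally show "enat n \<le> len A C + len C B" .
  next
    assume "enat n \<le> len A C + len C B"
    then obtain i j where ij: "n = i + j" "enat i \<le> len A C" "enat j \<le> len C B"
      by (rule enat_le_add_split)
    obtain N where N: "\<forall>k\<le>i. ideal (N k) R \<and> A \<subseteq> N k \<and> N k \<subseteq> C" "\<forall>k<i. N k \<subset> N (Suc k)"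
      using ij(2) len_ge_iff[OF A C AC] by auto
    obtain M where M: "\<forall>k\<le>j. ideal (M k) R \<and> C \<subseteq> M k \<and> M k \<subseteq> B" "\<forall>k<j. M k \<subset> M (Suc k)"
      using ij(3) len_ge_iff[OF C B CB] by auto
    \<comment> \<open>The end \<open>N i\<close> of the lower chain and the start \<open>M 0\<close>
      of the upper chain compete for index \<open>i\<close>. As
      \<open>N i \<subseteq> C \<subseteq> M 0\<close>, the term \<open>M 0\<close> can take it,
      except when the upper chain has no step.\<close>
    define K where "K = (\<lambda>k. if k < i then N k else if k = i then (if j = 0 then N i else M 0) else M (k - i))"
    show "enat n \<le> len A B"
      unfolding len_ge_iff[OF A B AB]
    proof (intro exI[of _ K] conjI allI impI)
      fix k assume k: "k \<le> n"
      have 1: "ideal (N k) R \<and> A \<subseteq> N k \<and> N k \<subseteq> B" if "k \<le> i"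
        using N(1)[rule_format, OF that] CB by blast
      have 2: "ideal (M (k - i)) R \<and> A \<subseteq> M (k - i) \<and> M (k - i) \<subseteq> B" if "i \<le> k"
        
      proof -
        have "k - i \<le> j" using k ij(1) by simp
        thus ?thesis using M(1)[rule_format, of "k - i"] AC by (simp add: order_trans[of A C])
      qed
      show "ideal (K k) R" "A \<subseteq> K k" "K k \<subseteq> B"
        using 1 2 unfolding K_def by (cases "k < i"; cases "k = i"; simp)+
    next
      fix k assume k: "k < n"
      consider "Suc k < i" | "Suc k = i" "j = 0" | "Suc k = i" "j > 0" | "k = i" | "k > i" by linarith
      thus "K k \<subset> K (Suc k)"
      proof cases
        case 3
        have "N k \<subset> N i" "N i \<subseteq> C" "C \<subseteq> M 0"
          using 3 N(1)[rule_format, of i] N(2)[rule_format, of k] M(1)[rule_format, of 0] by simp_all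
        thus ?thesis using 3 by (auto simp: K_def)
      next
        case 4
        thus ?thesis using M(2)[rule_format, of 0] k ij(1) by (simp add: K_def)
      next
        case 5
        thus ?thesis using M(2)[rule_format, of "k - i"] k ij(1) by (simp add: K_def Suc_diff_le)
      qed (use N(2)[rule_format, of k] in \<open>simp_all add: K_def\<close>)
    qed
  qed
qed

text \<open>Multiplication by \<open>y\<close> induces an isomorphism from \<open>B/A\<close> to
  \<open>B'/A'\<close>: the equation for \<open>A\<close> makes it injective, the one for
  \<open>B'\<close> surjective. On intermediate ideals it is \<open>N \<mapsto> A' + yN\<close>,
  with inverse the colon ideal, so chains correspond.\<close>

lemma len_iso:
  assumes A: "ideal A R" and B: "ideal B R" and A': "ideal A' R" and y: "y \<in> carrier R"
    and AB: "A = col y A' B" and B': "B' = lin y A' B"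
  shows "len A B = len A' B'"
proof (rule enat_eqI)
  fix n
  have iB': "ideal B' R" unfolding B' using A' B y by (rule lin_ideal)
  have s: "A \<subseteq> B" "A' \<subseteq> B'" using A' B y lin_upper1 unfolding AB B' by (auto simp: col_def)
  have 1: "col y (lin y A' N) B = N" if N: "ideal N R" "A \<subseteq> N" "N \<subseteq> B" for N
  proof
    show "N \<subseteq> col y (lin y A' N) B" using N A' y lin_upper2 by (auto simp: col_def)
    show "col y (lin y A' N) B \<subseteq> N"
    proof
      fix b assume "b \<in> col y (lin y A' N) B"
      then obtain a v where v: "b \<in> B" "a \<in> A'" "v \<in> N" "y \<otimes> b = a \<oplus> y \<otimes> v"
        by (auto simp: col_def lin_def)
      have c: "b \<in> carrier R" "a \<in> carrier R" "v \<in> carrier R"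
        using v A' B N ideal.Icarr by metis+
      have "y \<otimes> (b \<ominus> v) = (y \<otimes> b) \<ominus> y \<otimes> v" using c y by algebra
      also have "\<dots> = a" unfolding v(4) using c y by algebra
      finally have "b \<ominus> v \<in> A" unfolding AB col_def using v N B ideal_diff by auto
      hence "(b \<ominus> v) \<oplus> v \<in> N" using N v by (auto intro: ideal_add)
      moreover have "(b \<ominus> v) \<oplus> v = b" using c by algebra
      ultimately show "b \<in> N" by simp
    qed
  qed
  have 2: "lin y A' (col y N B) = N" if N: "ideal N R" "A' \<subseteq> N" "N \<subseteq> B'" for N
  proof
    show "lin y A' (col y N B) \<subseteq> N" by (rule lin_least[OF N(1,2)]) (auto simp: col_def)
    show "N \<subseteq> lin y A' (col y N B)"
    proof
      fix v assume v: "v \<in> N"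
      then obtain a b where ab: "a \<in> A'" "b \<in> B" "v = a \<oplus> y \<otimes> b" using N(3) by (auto simp: B' lin_def)
      have c: "a \<in> carrier R" "b \<in> carrier R" using ab A' B ideal.Icarr by metis+
      have "y \<otimes> b = v \<ominus> a" unfolding ab using c y by algebra
      moreover have "v \<ominus> a \<in> N" using v N ab(1) ideal_diff by auto
      ultimately have "y \<otimes> b \<in> N" by simp
      thus "v \<in> lin y A' (col y N B)" using ab by (auto simp: col_def lin_def)
    qed
  qed
  show "enat n \<le> len A B \<longleftrightarrow> enat n \<le> len A' B'"
    unfolding len_ge_iff[OF A B s(1)] len_ge_iff[OF A' iB' s(2)]
  proof
    assume "\<exists>N. (\<forall>i\<le>n. ideal (N i) R \<and> A \<subseteq> N i \<and> N i \<subseteq> B) \<and> (\<forall>i<n. N i \<subset> N (Suc i))"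
    then obtain N where N: "\<forall>i\<le>n. ideal (N i) R \<and> A \<subseteq> N i \<and> N i \<subseteq> B" "\<forall>i<n. N i \<subset> N (Suc i)"
      by blast
    have "lin y A' (N i) \<subset> lin y A' (N (Suc i))" if "i < n" for i
      using 1[of "N i"] 1[of "N (Suc i)"] N that lin_one_mono[of "N i" "N (Suc i)" y A']
      by (metis Suc_leI order_less_imp_le psubset_eq)
    moreover have "lin y A' (N i) \<subseteq> B'" "A' \<subseteq> lin y A' (N i)" "ideal (lin y A' (N i)) R" if "i \<le> n" for i
      using N(1) that A' y lin_one_mono lin_upper1 lin_ideal unfolding B' by auto
    ultimately show "\<exists>N. (\<forall>i\<le>n. ideal (N i) R \<and> A' \<subseteq> N i \<and> N i \<subseteq> B') \<and> (\<forall>i<n. N i \<subset> N (Suc i))"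
      by (intro exI[of _ "\<lambda>i. lin y A' (N i)"]) auto
  next
    assume "\<exists>N. (\<forall>i\<le>n. ideal (N i) R \<and> A' \<subseteq> N i \<and> N i \<subseteq> B') \<and> (\<forall>i<n. N i \<subset> N (Suc i))"
    then obtain N where N: "\<forall>i\<le>n. ideal (N i) R \<and> A' \<subseteq> N i \<and> N i \<subseteq> B'" "\<forall>i<n. N i \<subset> N (Suc i)"
      by blast
    have "col y (N i) B \<subset> col y (N (Suc i)) B" if "i < n" for i
    proof -
      have "col y (N i) B \<subseteq> col y (N (Suc i)) B" using N(2) that by (auto simp: col_def)
      thus ?thesis using 2[of "N i"] 2[of "N (Suc i)"] N that
        by (metis Suc_leI order_less_imp_le psubset_eq)
    qed
    moreover have "col y (N i) B \<subseteq> B" "A \<subseteq> col y (N i) B" "ideal (col y (N i) B) R" if "i \<le> n" for i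
      using N(1) that B y col_ideal unfolding AB by (auto simp: col_def)
    ultimately show "\<exists>N. (\<forall>i\<le>n. ideal (N i) R \<and> A \<subseteq> N i \<and> N i \<subseteq> B) \<and> (\<forall>i<n. N i \<subset> N (Suc i))"
      by (intro exI[of _ "\<lambda>i. col y (N i) B"]) auto
  qed
qed

end

section \<open>The multiplicity symbol\<close>

locale noetherian_cring = cring R + noetherian_ring R for R (structure)

context noetherian_cring
begin

lemma ideal_ascending_stable:
  fixes N :: "nat \<Rightarrow> 'a set"
  assumes "\<And>i. ideal (N i) R" "\<And>i. N i \<subseteq> N (Suc i)"
  obtains j where "\<And>i. i \<ge> j \<Longrightarrow> N i = N j"
proof -
  have mono: "N i \<subseteq> N j" if "i \<le> j" for i j
    using that assms(2) by (meson lift_Suc_mono_le)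
  have "subset.chain {I. ideal I R} (range N)"
    unfolding subset_chain_def
  proof (intro conjI ballI)
    show "range N \<subseteq> {I. ideal I R}" using assms(1) by auto
    fix U V assume "U \<in> range N" "V \<in> range N"
    then obtain i j where "U = N i" "V = N j" by blast
    thus "U \<subseteq> V \<or> V \<subseteq> U" using mono[of i j] mono[of j i] by (cases i j rule: linorder_le_cases) auto
  qed
  hence "\<Union>(range N) \<in> range N" by (intro ideal_chain_is_trivial) auto
  then obtain j where "\<Union>(range N) = N j" by blast
  hence "N i = N j" if "i \<ge> j" for i using mono[OF that] by auto
  thus ?thesis using that by blast
qed

lemma noetherian_induct [consumes 1, case_names step]:
  assumes "ideal K R"
    and step: "\<And>K. ideal K R \<Longrightarrow> (\<And>K'. ideal K' R \<Longrightarrow> K \<subset> K' \<Longrightarrow> P K') \<Longrightarrow> P K"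
  shows "P K"
proof -
  have "wf {(K', K). ideal K R \<and> ideal K' R \<and> K \<subset> K'}"
    unfolding wf_iff_no_infinite_down_chain
  proof
    assume "\<exists>f. \<forall>i. (f (Suc i), f i) \<in> {(K', K). ideal K R \<and> ideal K' R \<and> K \<subset> K'}"
    then obtain f where "\<forall>i. (f (Suc i), f i) \<in> {(K', K). ideal K R \<and> ideal K' R \<and> K \<subset> K'}" by blast
    hence f: "ideal (f i) R" "f i \<subset> f (Suc i)" for i by simp_all
    obtain j where "\<And>i. i \<ge> j \<Longrightarrow> f i = f j"
      using ideal_ascending_stable[of f] f by blast
    from this[of "Suc j"] f(2)[of j] show False by simp
  qed
  thus ?thesis using assms(1)
    by (induction K rule: wf_induct_rule) (use step in blast)
qed

lemma len_carrier_antimono: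
  assumes "ideal D R" "ideal K R" "D \<subseteq> K"
  shows "len K (carrier R) \<le> len D (carrier R)"
  using len_add[OF assms(1,2) oneideal assms(3)] ideal_subset_carrier[OF assms(2)] by simp

text \<open>The cyclic module \<open>(C + bR)/C\<close> is isomorphic to \<open>R/(C : b)\<close>.
  Lengths of intervals are thereby reduced to colengths of larger ideals, where Noetherian induction
  applies.\<close>

lemma len_principal_step:
  assumes "ideal C R" "b \<in> carrier R"
  shows "len C (lin b C (carrier R)) = len (col b C (carrier R)) (carrier R)"
  by (rule len_iso[symmetric]) (use assms oneideal col_ideal in auto)

text \<open>Noetherian induction on \<open>K\<close>. If \<open>\<mm> \<subseteq> K\<close>,
  maximality leaves room for at most one step. Otherwise some \<open>z\<close> outside
  \<open>K\<close> makes both \<open>K + zR\<close> and \<open>K : z\<close> strictly larger than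
  \<open>K\<close>, and the colength of \<open>K\<close> is the sum of theirs.\<close>

lemma finite_len_of_nilpotent:
  assumes M: "maximalideal \<mm> R"
    and K: "ideal K R" "\<And>y. y \<in> \<mm> \<Longrightarrow> \<exists>k::nat. y [^] k \<in> K"
  shows "len K (carrier R) \<noteq> \<infinity>"
proof -
  have mi: "ideal \<mm> R" using M by (simp add: maximalideal_def)
  have "(\<forall>y\<in>\<mm>. \<exists>k::nat. y [^] k \<in> K) \<longrightarrow> len K (carrier R) \<noteq> \<infinity>"
    using K(1)
  proof (induction K rule: noetherian_induct)
    case (step K)
    show ?case
    proof
      assume nil: "\<forall>y\<in>\<mm>. \<exists>k::nat. y [^] k \<in> K"
      have IH: "len K' (carrier R) \<noteq> \<infinity>" if "ideal K' R" "K \<subset> K'" for K'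
        using step.IH[OF that] nil that by blast
      show "len K (carrier R) \<noteq> \<infinity>"
      proof (cases "\<mm> \<subseteq> K")
        case True
        have "len K (carrier R) \<le> enat 1"
        proof (rule ccontr)
          assume "\<not> len K (carrier R) \<le> enat 1"
          hence "enat 2 \<le> len K (carrier R)"
            by (cases "len K (carrier R)") auto
          then obtain N where N: "\<forall>i\<le>2. ideal (N i) R \<and> K \<subseteq> N i \<and> N i \<subseteq> carrier R"
            "\<forall>i<2. N i \<subset> N (Suc i)"
            using len_ge_iff[OF \<open>ideal K R\<close> oneideal ideal_subset_carrier[OF \<open>ideal K R\<close>], of 2] by auto
          have n: "N 0 \<subset> N 1" "N 1 \<subset> N 2" using N(2)[rule_format, of 0] N(2)[rule_format, of 1]
            by (simp_all add: numeral_2_eq_2)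
          have i: "ideal (N 1) R" "\<mm> \<subseteq> N 0" "N 2 \<subseteq> carrier R" using N(1) True by auto
          have "N 1 = \<mm> \<or> N 1 = carrier R"
            using maximalideal.I_maximal[OF M i(1)] i n ideal_subset_carrier[OF i(1)] by auto
          thus False using n i by auto
        qed
        thus ?thesis by (cases "len K (carrier R)") auto
      next
        case False
        then obtain y where y: "y \<in> \<mm>" "y \<notin> K" by blast
        have yc: "y \<in> carrier R" using y mi ideal.Icarr by metis
        \<comment> \<open>With \<open>k\<close> minimal, \<open>z = y^(k-1)\<close> is the last
          power of \<open>y\<close> outside \<open>K\<close>; then \<open>y\<close> itself witnesses
          that \<open>K : z\<close> is larger than \<open>K\<close>.\<close>
        define k where "k = (LEAST k::nat. y [^] k \<in> K)"
        have k: "y [^] k \<in> K" unfolding k_def using nil y by (metis LeastI)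
        have "k \<noteq> 0"
        proof
          assume "k = 0"
          hence "\<one> \<in> K" using k by simp
          hence "K = carrier R" using ideal.one_imp_carrier \<open>ideal K R\<close> by blast
          thus False using y yc by simp
        qed
        then obtain j where j: "k = Suc j" by (cases k) auto
        have z: "y [^] j \<notin> K" using not_less_Least[of j "\<lambda>k. y [^] k \<in> K"] j k_def by simp
        define z where "z = y [^] j"
        have zc: "z \<in> carrier R" using yc by (simp add: z_def)
        have i1: "ideal (lin z K (carrier R)) R" "ideal (col z K (carrier R)) R"
          using \<open>ideal K R\<close> zc oneideal by (auto intro: lin_ideal col_ideal)
        have s1: "K \<subset> lin z K (carrier R)"
          using lin_upper1[OF \<open>ideal K R\<close> oneideal zc] lin_upper2[OF \<open>ideal K R\<close> oneideal zc, of \<one>] z zc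
          by (auto simp: z_def)
        have "K \<subseteq> col z K (carrier R)"
          using \<open>ideal K R\<close> zc by (auto simp: col_def ideal.Icarr ideal_mult)
        moreover have "y \<in> col z K (carrier R)" using k j yc by (simp add: col_def z_def)
        ultimately have s2: "K \<subset> col z K (carrier R)" using y by auto
        have "len K (carrier R) = len K (lin z K (carrier R)) + len (lin z K (carrier R)) (carrier R)"
          using len_add[OF \<open>ideal K R\<close> i1(1) oneideal] s1 ideal_subset_carrier[OF i1(1)] by auto
        moreover have "len K (lin z K (carrier R)) \<noteq> \<infinity>"
          using len_principal_step[OF \<open>ideal K R\<close> zc] IH[OF i1(2) s2] by simp
        ultimately show ?thesis using IH[OF i1(1) s1] by (simp add: plus_eq_infty_iff_enat del: not_infinity_eq)
      qed
    qed
  qed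
  thus ?thesis using K by blast
qed

text \<open>Adjoin the finitely many generators of \<open>B\<close> to \<open>A\<close> one at a
  time. Each factor is cyclic and killed by \<open>D\<close>, hence a quotient of
  \<open>R/D\<close>.\<close>

lemma finite_len_of_killed:
  assumes A: "ideal A R" and B: "ideal B R" and AB: "A \<subseteq> B"
    and D: "ideal D R" "len D (carrier R) \<noteq> \<infinity>" "\<And>d b. d \<in> D \<Longrightarrow> b \<in> B \<Longrightarrow> d \<otimes> b \<in> A"
  shows "len A B \<noteq> \<infinity>"
proof -
  obtain F where F: "F \<subseteq> carrier R" "finite F" "B = Idl F" using finetely_gen[OF B] by blast
  have FB: "F \<subseteq> B" using F genideal_self by blast
  have fin: "finite G \<Longrightarrow> G \<subseteq> F \<Longrightarrow> \<exists>C. ideal C R \<and> A \<subseteq> C \<and> C \<subseteq> B \<and> G \<subseteq> C \<and> len A C \<noteq> \<infinity>" for G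
  proof (induction G rule: finite_induct)
    case empty
    have "len A A \<noteq> \<infinity>" using len_self[OF A] by simp
    thus ?case using A AB by blast
  next
    case (insert b G)
    then obtain C where C: "ideal C R" "A \<subseteq> C" "C \<subseteq> B" "G \<subseteq> C" "len A C \<noteq> \<infinity>" by auto
    have b: "b \<in> B" "b \<in> carrier R" using insert FB F by auto
    define C' where "C' = lin b C (carrier R)"
    have C': "ideal C' R" "C \<subseteq> C'" unfolding C'_def using C b oneideal lin_ideal lin_upper1 by auto
    have "C' \<subseteq> B" unfolding C'_def
      using C b by (intro lin_least[OF B]) (auto simp: m_comm[of b] ideal_mult[OF B])
    have bC: "b \<in> C'" using lin_upper2[OF C(1) oneideal b(2), of \<one>] b by (simp add: C'_def)
    have "D \<subseteq> col b C (carrier R)"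
      using D b C ideal.Icarr[OF D(1)] by (auto simp: col_def m_comm[of b])
    hence "len C C' \<le> len D (carrier R)" unfolding C'_def
      using len_principal_step[OF C(1) b(2)] len_carrier_antimono[OF D(1)] col_ideal[OF C(1) oneideal b(2)] by auto
    hence "len C C' \<noteq> \<infinity>" using D(2) by (metis enat_ord_simps(5))
    hence "len A C' \<noteq> \<infinity>" using len_add[OF A C(1) C'(1) C(2) C'(2)] C(5)
      by (simp add: plus_eq_infty_iff_enat del: not_infinity_eq)
    thus ?case using C C' \<open>C' \<subseteq> B\<close> bC by blast
  qed
  then obtain C where C: "ideal C R" "A \<subseteq> C" "C \<subseteq> B" "F \<subseteq> C" "len A C \<noteq> \<infinity>"
    using fin[OF F(2) subset_refl] by blast
  have "B \<subseteq> C" unfolding F(3) by (rule genideal_minimal[OF C(1,4)])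
  thus ?thesis using C by auto
qed

end

text \<open>Integer valued so that alternating sums make sense. \<open>the_enat\<close> is
  unspecified at infinity, so additivity of \<open>length_int\<close> requires finite
  length.\<close>

definition (in cring) length_int :: "'a set \<Rightarrow> 'a set \<Rightarrow> int" where
  "length_int A B = int (the_enat (len A B))"

section \<open>Kernels, cokernels and additivity of the alternating sum\<close>

context noetherian_cring
begin

text \<open>Northcott's multiplicity symbol of the graded module \<open>B/A\<close>: multiplication by \<open>x\<close> has cokernel
  \<open>B/(A + x B)\<close> and kernel \<open>(A : x)/A\<close>, so both stay within intervals of families of ideals.\<close>

primrec chi :: "('a \<times> 'g::ordered_ab_group_add) list \<Rightarrow> ('g \<Rightarrow> 'a set) \<Rightarrow> ('g \<Rightarrow> 'a set) \<Rightarrow> 'g \<Rightarrow> int" where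
  "chi [] A B n = length_int (A n) (B n)"
| "chi (p # xs) A B n = chi xs (\<lambda>m. lin (fst p) (A m) (B (m - snd p))) B n
     - chi xs A (\<lambda>m. col (fst p) (A (m + snd p)) (B m)) (n - snd p)"

definition gens :: "('a \<times> 'g::ordered_ab_group_add) list \<Rightarrow> bool" where
  "gens xs \<longleftrightarrow> (\<forall>(x, a)\<in>set xs. x \<in> carrier R \<and> 0 \<le> a)"

text \<open>Graded families stable under multiplication by each \<open>x\<close> in its degree.
  Being decreasing in \<open>n\<close> means stability under the inverse variables of an extended
  Rees algebra; since degrees are nonnegative, \<open>x B(n) \<subseteq> A(n + a)\<close> then gives
  \<open>x B(n) \<subseteq> A(n)\<close>, so killing with a shift implies killing degree by
  degree.\<close>

definition fam :: "('a \<times> 'g::ordered_ab_group_add) list \<Rightarrow> ('g \<Rightarrow> 'a set) \<Rightarrow> bool" where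
  "fam xs A \<longleftrightarrow> (\<forall>n. ideal (A n) R) \<and> (\<forall>m n. m \<le> n \<longrightarrow> A n \<subseteq> A m) \<and>
     (\<forall>(x, a)\<in>set xs. \<forall>n. \<forall>b\<in>A n. x \<otimes> b \<in> A (n + a))"

lemma famD:
  assumes "fam xs A"
  shows "ideal (A n) R" "m \<le> n \<Longrightarrow> A n \<subseteq> A m"
    "(x, a) \<in> set xs \<Longrightarrow> b \<in> A n \<Longrightarrow> x \<otimes> b \<in> A (n + a)"
    "b \<in> A n \<Longrightarrow> b \<in> carrier R"
  using assms by (auto simp: fam_def dest: ideal.Icarr)

lemma fam_Cons: "fam (p # xs) A \<Longrightarrow> fam xs A"
  by (auto simp: fam_def)

lemma fam_lin:
  assumes A: "fam xs A" and B: "fam xs B" and x: "x \<in> carrier R" and g: "gens xs"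
  shows "fam xs (\<lambda>n. lin x (A n) (B (n - a)))"
  unfolding fam_def
proof (intro conjI allI impI ballI, goal_cases)
  case (1 n)
  thus ?case using famD[OF A] famD[OF B] x by (intro lin_ideal)
next
  case (2 m n)
  thus ?case using famD(2)[OF A 2] famD(2)[OF B, of "m - a" "n - a"] by (auto simp: lin_def)
next
  case (3 p)
  obtain y c where p: "p = (y, c)" by (cases p)
  have y: "y \<in> carrier R" using g 3 p by (auto simp: gens_def)
  { fix n b assume "b \<in> lin x (A n) (B (n - a))"
    then obtain u v where uv: "u \<in> A n" "v \<in> B (n - a)" "b = u \<oplus> x \<otimes> v" by (auto simp: lin_def)
    have c: "u \<in> carrier R" "v \<in> carrier R" using uv famD A B by metis+
    have "y \<otimes> b = y \<otimes> u \<oplus> x \<otimes> (y \<otimes> v)" using uv c x y by (simp add: r_distr m_ac)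
    moreover have "y \<otimes> u \<in> A (n + c)" "y \<otimes> v \<in> B (n + c - a)"
      using famD(3)[OF A, of y c u n] famD(3)[OF B, of y c v "n - a"] uv 3 p
      by (simp_all add: algebra_simps)
    ultimately have "y \<otimes> b \<in> lin x (A (n + c)) (B (n + c - a))" by (auto simp: lin_def) }
  thus ?case using p by auto
qed

lemma fam_col:
  assumes A: "fam xs A" and B: "fam xs B" and x: "x \<in> carrier R" and g: "gens xs"
  shows "fam xs (\<lambda>n. col x (A (n + a)) (B n))"
  unfolding fam_def
proof (intro conjI allI impI ballI, goal_cases)
  case (1 n)
  thus ?case using famD[OF A] famD[OF B] x by (intro col_ideal)
next
  case (2 m n)
  thus ?case using famD(2)[OF B 2] famD(2)[OF A, of "m + a" "n + a"] by (auto simp: col_def)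
next
  case (3 p)
  obtain y c where p: "p = (y, c)" by (cases p)
  have y: "y \<in> carrier R" using g 3 p by (auto simp: gens_def)
  { fix n b assume b: "b \<in> B n" "x \<otimes> b \<in> A (n + a)"
    have bc: "b \<in> carrier R" using b famD B by metis
    have "x \<otimes> (y \<otimes> b) = y \<otimes> (x \<otimes> b)" using bc x y by (simp add: m_ac)
    moreover have "y \<otimes> (x \<otimes> b) \<in> A (n + c + a)" "y \<otimes> b \<in> B (n + c)"
      using famD(3)[OF A, of y c _ "n + a"] famD(3)[OF B, of y c b n] b 3 p
      by (simp_all add: algebra_simps)
    ultimately have "y \<otimes> b \<in> col x (A (n + c + a)) (B (n + c))" by (auto simp: col_def) }
  thus ?case using p by (auto simp: col_def)
qed

lemma fam_lin0: 
  assumes "fam xs A" "fam xs B" "x \<in> carrier R" "gens xs"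
  shows "fam xs (\<lambda>n. lin x (A n) (B n))"
  using fam_lin[OF assms, of 0] by simp

text \<open>The last two assumptions say that multiplication by \<open>y\<close> is an isomorphism
  of degree \<open>s\<close> from \<open>B/A\<close> to \<open>B'/A'\<close>. It commutes with
  multiplication by each \<open>x\<close> of the list, hence induces isomorphisms of cokernels and
  of kernels, and the induction passes to these.\<close>

lemma chi_iso:
  assumes "gens xs" "fam xs A" "fam xs B" "fam xs A'" "fam xs B'" and y: "y \<in> carrier R"
    and "\<And>n. B' (n + s) = lin y (A' (n + s)) (B n)"
    and "\<And>n. A n = col y (A' (n + s)) (B n)"
  shows "chi xs A B n = chi xs A' B' (n + s)"
  using assms(1-5,7,8)
proof (induction xs arbitrary: A B A' B' n)
  case Nil
  have "len (A n) (B n) = len (A' (n + s)) (B' (n + s))"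
    by (rule len_iso) (use Nil y famD(1) in auto)
  thus ?case by (simp add: length_int_def)
next
  case (Cons p xs)
  obtain x a where p: "p = (x, a)" by (cases p)
  have x: "x \<in> carrier R" and xs: "gens xs" using Cons.prems(1) p by (auto simp: gens_def)
  note f = Cons.prems(2-5)
  note g = f[THEN fam_Cons]
  have st: "b \<in> A n \<Longrightarrow> x \<otimes> b \<in> A (n + a)" "b \<in> B n \<Longrightarrow> x \<otimes> b \<in> B (n + a)"
     "b \<in> A' n \<Longrightarrow> x \<otimes> b \<in> A' (n + a)" "b \<in> B' n \<Longrightarrow> x \<otimes> b \<in> B' (n + a)" for b n
    using f[THEN famD(3), of x a b n] p by auto
  note B' = Cons.prems(6) and A = Cons.prems(7)
  have AB: "A n \<subseteq> B n" for n using A by (auto simp: col_def)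
  have AB': "A' (n + s) \<subseteq> B' (n + s)" for n using B' lin_upper1 famD(1) f y by metis
  have yA: "y \<otimes> b \<in> A' (n + s)" if "b \<in> A n" for b n using that A by (auto simp: col_def)
  have yB: "y \<otimes> b \<in> B' (n + s)" if "b \<in> B n" for b n using that B' lin_upper2 famD(1) f y by metis
  note car = f[THEN famD(4)]
  have 1: "chi xs (\<lambda>m. lin x (A m) (B (m - a))) B n
      = chi xs (\<lambda>m. lin x (A' m) (B' (m - a))) B' (n + s)"
  proof (rule Cons.IH[OF xs fam_lin[OF g(1,2) x xs] g(2) fam_lin[OF g(3,4) x xs] g(4)])
    fix n
    have e: "n + s - a = (n - a) + s" by simp
    show "B' (n + s) = lin y (lin x (A' (n + s)) (B' (n + s - a))) (B n)"
    proof
      show "B' (n + s) \<subseteq> lin y (lin x (A' (n + s)) (B' (n + s - a))) (B n)"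
        unfolding B'[of n] using lin_upper1[OF famD(1)[OF f(3)] famD(1)[OF f(4)] x, of "n + s" "n + s - a"]
        unfolding lin_def by blast
      show "lin y (lin x (A' (n + s)) (B' (n + s - a))) (B n) \<subseteq> B' (n + s)"
        using AB'[of n] yB[of _ n] st(4)[of _ "n + s - a"] famD(1)[OF f(4)]
        by (intro lin_least) auto
    qed
    show "lin x (A n) (B (n - a)) = col y (lin x (A' (n + s)) (B' (n + s - a))) (B n)"
    proof
      show "lin x (A n) (B (n - a)) \<subseteq> col y (lin x (A' (n + s)) (B' (n + s - a))) (B n)"
      proof
        fix w assume "w \<in> lin x (A n) (B (n - a))"
        then obtain u v where uv: "u \<in> A n" "v \<in> B (n - a)" "w = u \<oplus> x \<otimes> v" by (auto simp: lin_def)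
        have c: "u \<in> carrier R" "v \<in> carrier R" using uv car by metis+
        have "y \<otimes> w = y \<otimes> u \<oplus> x \<otimes> (y \<otimes> v)" using uv c x y by (simp add: r_distr m_ac)
        moreover have "y \<otimes> u \<in> A' (n + s)" "y \<otimes> v \<in> B' (n + s - a)"
          using yA[OF uv(1)] yB[OF uv(2)] unfolding e by auto
        moreover have "w \<in> B n" using uv AB[of n] st(2)[of v "n - a"] famD(1)[OF f(2)] ideal_add by auto
        ultimately show "w \<in> col y (lin x (A' (n + s)) (B' (n + s - a))) (B n)"
          by (auto simp: col_def lin_def)
      qed
      show "col y (lin x (A' (n + s)) (B' (n + s - a))) (B n) \<subseteq> lin x (A n) (B (n - a))"
      proof
        fix b assume b: "b \<in> col y (lin x (A' (n + s)) (B' (n + s - a))) (B n)"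
        then obtain u v where uv: "u \<in> A' (n + s)" "v \<in> B' (n - a + s)" "y \<otimes> b = u \<oplus> x \<otimes> v" "b \<in> B n"
          unfolding e by (auto simp: col_def lin_def)
        \<comment> \<open>Surjectivity of \<open>y\<close> in degree \<open>n - a\<close> lifts
          \<open>v\<close> to \<open>t\<close> up to an error \<open>r\<close> in \<open>A'\<close>;
          then \<open>y\<close> sends \<open>b \<ominus> x \<otimes> t\<close> into
          \<open>A'\<close>, so this difference lies in \<open>A n\<close>.\<close>
        obtain r t where rt: "r \<in> A' (n - a + s)" "t \<in> B (n - a)" "v = r \<oplus> y \<otimes> t"
          using uv(2) B' by (auto simp: lin_def)
        have c: "u \<in> carrier R" "r \<in> carrier R" "t \<in> carrier R" "b \<in> carrier R" using uv rt car by metis+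
        have "y \<otimes> (b \<ominus> x \<otimes> t) = (y \<otimes> b) \<ominus> y \<otimes> (x \<otimes> t)" using c x y by algebra
        also have "\<dots> = u \<oplus> x \<otimes> r" unfolding uv(3) rt(3) using c x y by algebra
        also have "\<dots> \<in> A' (n + s)"
          using uv st(3)[OF rt(1)] famD(1)[OF f(3)] ideal_add by (auto simp: algebra_simps)
        finally have "b \<ominus> x \<otimes> t \<in> A n"
          unfolding A[of n] col_def using uv st(2)[OF rt(2)] ideal_diff famD(1)[OF f(2)] by auto
        moreover have "b = (b \<ominus> x \<otimes> t) \<oplus> x \<otimes> t" using c x by algebra
        ultimately show "b \<in> lin x (A n) (B (n - a))" using rt unfolding lin_def by blast
      qed
    qed
  qed
  have 2: "chi xs A (\<lambda>m. col x (A (m + a)) (B m)) (n - a)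
      = chi xs A' (\<lambda>m. col x (A' (m + a)) (B' m)) (n - a + s)"
  proof (rule Cons.IH[OF xs g(1) fam_col[OF g(1,2) x xs] g(3) fam_col[OF g(3,4) x xs]])
    fix n
    have e: "n + s + a = n + a + s" by (simp add: algebra_simps)
    show "col x (A' (n + s + a)) (B' (n + s)) = lin y (A' (n + s)) (col x (A (n + a)) (B n))"
    proof
      show "lin y (A' (n + s)) (col x (A (n + a)) (B n)) \<subseteq> col x (A' (n + s + a)) (B' (n + s))"
      proof (rule lin_least)
        show "ideal (col x (A' (n + s + a)) (B' (n + s))) R" using famD(1) f x col_ideal by metis
        show "A' (n + s) \<subseteq> col x (A' (n + s + a)) (B' (n + s))" using AB'[of n] st(3) by (auto simp: col_def)
        fix b assume b: "b \<in> col x (A (n + a)) (B n)"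
        hence "y \<otimes> (x \<otimes> b) \<in> A' (n + a + s)" using yA by (auto simp: col_def)
        moreover have "b \<in> carrier R" using b car by (auto simp: col_def)
        moreover have "y \<otimes> (x \<otimes> b) = x \<otimes> (y \<otimes> b)" using \<open>b \<in> carrier R\<close> x y by (simp add: m_ac)
        moreover have "y \<otimes> b \<in> B' (n + s)" using b yB by (auto simp: col_def)
        ultimately show "y \<otimes> b \<in> col x (A' (n + s + a)) (B' (n + s))"
          unfolding e by (simp add: col_def)
      qed
      show "col x (A' (n + s + a)) (B' (n + s)) \<subseteq> lin y (A' (n + s)) (col x (A (n + a)) (B n))"
      proof
        fix w assume w: "w \<in> col x (A' (n + s + a)) (B' (n + s))"
        hence "w \<in> lin y (A' (n + s)) (B n)" unfolding B'[of n, symmetric] by (simp add: col_def)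
        then obtain u b where ub: "u \<in> A' (n + s)" "b \<in> B n" "w = u \<oplus> y \<otimes> b"
          by (auto simp: lin_def)
        have c: "u \<in> carrier R" "b \<in> carrier R" using ub car by metis+
        have "y \<otimes> (x \<otimes> b) = x \<otimes> w \<ominus> x \<otimes> u" unfolding ub(3) using c x y by algebra
        moreover have "\<dots> \<in> A' (n + s + a)" using w st(3)[OF ub(1)] famD(1)[OF f(3)] ideal_diff
          by (auto simp: col_def)
        ultimately have "x \<otimes> b \<in> A (n + a)"
          unfolding A[of "n + a"] e[symmetric] col_def using st(2)[OF ub(2)] by simp
        thus "w \<in> lin y (A' (n + s)) (col x (A (n + a)) (B n))"
          using ub by (auto simp: lin_def col_def)
      qed
    qed
    show "A n = col y (A' (n + s)) (col x (A (n + a)) (B n))"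
      using A[of n] st(1) by (auto simp: col_def)
  qed
  show ?case using 1 2 by (simp add: p algebra_simps)
qed

end

context noetherian_cring
begin

lemma length_int_add:
  assumes "ideal A R" "ideal C R" "ideal B R" "A \<subseteq> C" "C \<subseteq> B" "len A B \<noteq> \<infinity>"
  shows "length_int A B = length_int A C + length_int C B"
proof -
  have e: "len A B = len A C + len C B" by (rule len_add[OF assms(1-5)])
  hence "len A C \<noteq> \<infinity>" "len C B \<noteq> \<infinity>" using assms(6)
    by (simp_all add: plus_eq_infty_iff_enat del: not_infinity_eq)
  thus ?thesis using e by (auto simp: length_int_def)
qed

lemma lens_finite:
  assumes "ideal A R" "ideal C R" "ideal B R" "A \<subseteq> C" "C \<subseteq> B" "len A B \<noteq> \<infinity>"
  shows "len A C \<noteq> \<infinity>" "len C B \<noteq> \<infinity>"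
  using len_add[OF assms(1-5)] assms(6) by (simp_all add: plus_eq_infty_iff_enat del: not_infinity_eq)

definition fin_colength :: "'a set \<Rightarrow> bool" where
  "fin_colength S \<longleftrightarrow> S \<subseteq> carrier R \<and> len (Idl S) (carrier R) \<noteq> \<infinity>"

lemma finite_len_of_killed_gens:
  assumes A: "ideal A R" and B: "ideal B R" and AB: "A \<subseteq> B"
    and S: "fin_colength S" "\<And>y b. y \<in> S \<Longrightarrow> b \<in> B \<Longrightarrow> y \<otimes> b \<in> A"
  shows "len A B \<noteq> \<infinity>"
proof (rule finite_len_of_killed[OF A B AB])
  have S': "S \<subseteq> carrier R" "len (Idl S) (carrier R) \<noteq> \<infinity>" using S(1) by (auto simp: fin_colength_def)
  show "ideal (Idl S) R" using genideal_ideal S' by blast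
  show "len (Idl S) (carrier R) \<noteq> \<infinity>" using S' by blast
  fix d b assume d: "d \<in> Idl S" and b: "b \<in> B"
  have bc: "b \<in> carrier R" using b B ideal.Icarr by metis
  have "ideal (col b A (carrier R)) R" using A bc oneideal col_ideal by blast
  moreover have "S \<subseteq> col b A (carrier R)" using S' S(2) b bc by (auto simp: col_def m_comm[OF bc])
  ultimately have "Idl S \<subseteq> col b A (carrier R)" by (rule genideal_minimal)
  hence "b \<otimes> d \<in> A" "d \<in> carrier R" using d by (auto simp: col_def)
  thus "d \<otimes> b \<in> A" using bc by (simp add: m_comm)
qed

text \<open>Guarantees that all lengths reached in the recursion of \<open>chi\<close> are finite,
  though those of \<open>B/A\<close> need not be. The set \<open>S\<close> already kills
  \<open>B/A\<close>, and together with the elements still to be processed it generates an ideal of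
  finite colength. Passing to the kernel or cokernel of \<open>x\<close> moves \<open>x\<close> from
  the list into \<open>S\<close>.\<close>

definition adm :: "('a \<times> 'g::ordered_ab_group_add) list \<Rightarrow> ('g \<Rightarrow> 'a set) \<Rightarrow> ('g \<Rightarrow> 'a set) \<Rightarrow> bool" where
  "adm xs A B \<longleftrightarrow> fam xs A \<and> fam xs B \<and> (\<forall>n. A n \<subseteq> B n) \<and>
     (\<exists>S. fin_colength (S \<union> fst ` set xs) \<and> (\<forall>y\<in>S. \<forall>n. \<forall>b\<in>B n. y \<otimes> b \<in> A n))"

lemma adm_Cons:
  assumes "adm (p # xs) A B" "fam xs C" "fam xs D" "\<And>n. A n \<subseteq> C n" "\<And>n. C n \<subseteq> D n" "\<And>n. D n \<subseteq> B n"
    and "\<And>n b. b \<in> D n \<Longrightarrow> fst p \<otimes> b \<in> C n"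
  shows "adm xs C D"
proof -
  obtain S where S: "fin_colength (S \<union> fst ` set (p # xs))" "\<forall>y\<in>S. \<forall>n. \<forall>b\<in>B n. y \<otimes> b \<in> A n"
    using assms(1) by (auto simp: adm_def)
  have "insert (fst p) S \<union> fst ` set xs = S \<union> fst ` set (p # xs)" by auto
  hence "fin_colength (insert (fst p) S \<union> fst ` set xs)" using S(1) by metis
  moreover have "\<forall>y\<in>insert (fst p) S. \<forall>n. \<forall>b\<in>D n. y \<otimes> b \<in> C n" using S(2) assms(4,6,7) by blast
  ultimately show ?thesis using assms(2,3,5) unfolding adm_def by blast
qed

lemma adm_Nil_finite:
  assumes "adm [] A B"
  shows "len (A n) (B n) \<noteq> \<infinity>"
proof -
  obtain S where "fin_colength S" "\<forall>y\<in>S. \<forall>n. \<forall>b\<in>B n. y \<otimes> b \<in> A n"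
    using assms by (auto simp: adm_def)
  thus ?thesis using assms famD(1) unfolding adm_def by (intro finite_len_of_killed_gens[of _ _ S]) blast+
qed

lemma gens_Cons: "gens ((x, a) # xs) \<longleftrightarrow> x \<in> carrier R \<and> 0 \<le> a \<and> gens xs"
  by (auto simp: gens_def)

text \<open>Snake lemma for multiplication by \<open>x\<close> on \<open>0 \<rightarrow> C/A
  \<rightarrow> B/A \<rightarrow> B/C \<rightarrow> 0\<close>. The six term sequence of kernels and
  cokernels is cut into short exact sequences, to which the induction hypothesis applies, and the
  pieces shared by neighbours are identified by \<open>chi_iso\<close>.\<close>

lemma chi_add:
  assumes "gens xs" "adm xs A B" "fam xs C" "\<And>n. A n \<subseteq> C n" "\<And>n. C n \<subseteq> B n"
  shows "chi xs A B n = chi xs A C n + chi xs C B n"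
  using assms
proof (induction xs arbitrary: A B C n)
  case Nil
  have "len (A n) (B n) \<noteq> \<infinity>" using Nil adm_Nil_finite by blast
  moreover have "ideal (A n) R" "ideal (B n) R" "ideal (C n) R"
    using Nil.prems(2,3) famD(1) unfolding adm_def by blast+
  ultimately show ?case using Nil.prems(4,5) length_int_add unfolding chi.simps by blast
next
  case (Cons p xs)
  obtain x a where p: "p = (x, a)" by (cases p)
  have x: "x \<in> carrier R" and a: "0 \<le> a" and xs: "gens xs" using Cons.prems(1) by (auto simp: p gens_Cons)
  note C = Cons.prems(3) and AC = Cons.prems(4) and CB = Cons.prems(5)
  have A: "fam (p # xs) A" and B: "fam (p # xs) B" using Cons.prems(2) by (auto simp: adm_def)
  note A' = fam_Cons[OF A] and B' = fam_Cons[OF B] and C' = fam_Cons[OF C]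
  have AB: "A n \<subseteq> B n" for n using AC CB by blast
  note ids = famD(1)[OF A] famD(1)[OF B] famD(1)[OF C]
  note car = famD(4)[OF A] famD(4)[OF B] famD(4)[OF C]
  have st: "b \<in> A n \<Longrightarrow> x \<otimes> b \<in> A (n + a)" "b \<in> B n \<Longrightarrow> x \<otimes> b \<in> B (n + a)"
     "b \<in> C n \<Longrightarrow> x \<otimes> b \<in> C (n + a)" for b n
    using A B C famD(3)[of "p # xs" _ x a b n] p by auto
  have na: "n - a + a = n" "n \<le> n + a" for n using a by auto
  define cA_B where "cA_B = (\<lambda>m. col x (A (m + a)) (B m))"
  define cA_C where "cA_C = (\<lambda>m. col x (A (m + a)) (C m))"
  define cC_B where "cC_B = (\<lambda>m. col x (C (m + a)) (B m))"
  define AB' where "AB' = (\<lambda>m. lin x (A m) (B (m - a)))"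
  define CB' where "CB' = (\<lambda>m. lin x (C m) (B (m - a)))"
  define AC' where "AC' = (\<lambda>m. lin x (A m) (C (m - a)))"
  \<comment> \<open>\<open>M1\<close> equals \<open>C \<inter> AB'\<close>, so \<open>M1/AC'\<close>
    is both the kernel of the map of cokernels and the image of the connecting map. Likewise
    \<open>M2/C\<close> is the image of the kernel on \<open>B/A\<close> inside the kernel on
    \<open>B/C\<close>, that is, the kernel of the connecting map.\<close>
  define M1 where "M1 = (\<lambda>m. lin x (AC' m) (cC_B (m - a)))"
  define M2 where "M2 = (\<lambda>m. lin \<one> (C m) (cA_B m))"
  note defs = cA_B_def cA_C_def cC_B_def AB'_def CB'_def AC'_def M1_def M2_def
  have F: "fam xs cA_B" "fam xs cA_C" "fam xs cC_B" "fam xs AB'" "fam xs CB'" "fam xs AC'"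
    unfolding defs using A' B' C' x xs by (auto intro: fam_lin fam_col)
  have F2: "fam xs M1" "fam xs M2" unfolding M1_def M2_def
    using F C' x xs by (auto intro: fam_lin fam_lin0)
  note idF = F[THEN famD(1)] F2[THEN famD(1)]
  have lu1: "A m \<subseteq> AB' m" "C m \<subseteq> CB' m" "A m \<subseteq> AC' m" "AC' m \<subseteq> M1 m" "C m \<subseteq> M2 m" for m
    using lin_upper1[OF ids(1) ids(2) x] lin_upper1[OF ids(3) ids(2) x] lin_upper1[OF ids(1) ids(3) x]
      lin_upper1[OF idF(6,3) x] lin_upper1[OF ids(3) idF(1) one_closed]
    by (simp_all add: AB'_def CB'_def AC'_def M1_def M2_def)
  have lu2: "b \<in> B m \<Longrightarrow> x \<otimes> b \<in> AB' (m + a)" "b \<in> B m \<Longrightarrow> x \<otimes> b \<in> CB' (m + a)"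
    "b \<in> C m \<Longrightarrow> x \<otimes> b \<in> AC' (m + a)" for b m
    unfolding AB'_def CB'_def AC'_def 
    using lin_upper2[OF ids(1) ids(2) x] lin_upper2[OF ids(3) ids(2) x] lin_upper2[OF ids(1) ids(3) x] by simp_all
  have mono: "AB' (m + a) \<subseteq> AB' m" "CB' (m + a) \<subseteq> CB' m" "AC' (m + a) \<subseteq> AC' m" "A (m + a) \<subseteq> A m" "C (m + a) \<subseteq> C m" for m
    using famD(2)[OF F(4) na(2)] famD(2)[OF F(5) na(2)] famD(2)[OF F(6) na(2)] famD(2)[OF A' na(2)] famD(2)[OF C' na(2)]
    by simp_all
  have AB'B: "AB' m \<subseteq> B m" for m
    unfolding AB'_def using AB st(2)[of _ "m - a"] ids by (intro lin_least) auto
  have CB'B: "CB' m \<subseteq> B m" for m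
    unfolding CB'_def using CB st(2)[of _ "m - a"] ids by (intro lin_least) auto
  have AC'C: "AC' m \<subseteq> C m" for m
    unfolding AC'_def using AC st(3)[of _ "m - a"] ids by (intro lin_least) auto
  have AB'CB': "AB' m \<subseteq> CB' m" for m unfolding AB'_def CB'_def lin_def using AC by blast
  have AC'AB': "AC' m \<subseteq> AB' m" for m unfolding AB'_def AC'_def lin_def using CB by blast
  have M1C: "M1 m \<subseteq> C m" for m
    unfolding M1_def using AC'C ids by (intro lin_least) (auto simp: cC_B_def col_def)
  have cc: "cA_C m \<subseteq> cA_B m" "cA_B m \<subseteq> cC_B m" "cA_B m \<subseteq> B m" "cC_B m \<subseteq> B m" "cA_C m \<subseteq> C m"
     "A m \<subseteq> cA_B m" "A m \<subseteq> cA_C m" "C m \<subseteq> cC_B m" for m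
    unfolding defs col_def using AC CB st AB by auto
  have M2c: "M2 m \<subseteq> cC_B m" for m
    unfolding M2_def using cc idF by (intro lin_least) (auto simp: famD(4)[OF F(1)])
  have adm1: "adm xs AB' B" 
  proof (rule adm_Cons[OF Cons.prems(2) F(4) B' lu1(1) AB'B])
    fix n b assume "b \<in> B n"
    thus "fst p \<otimes> b \<in> AB' n" using lu2(1)[of b n] mono(1) p by auto
  qed auto
  have adm2: "adm xs AC' C"
  proof (rule adm_Cons[OF Cons.prems(2) F(6) C' lu1(3) AC'C CB])
    fix n b assume "b \<in> C n"
    thus "fst p \<otimes> b \<in> AC' n" using lu2(3)[of b n] mono(3) p by auto
  qed
  have adm3: "adm xs A cA_B"
  proof (rule adm_Cons[OF Cons.prems(2) A' F(1) _ cc(6) cc(3)])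
    fix n b assume "b \<in> cA_B n"
    thus "fst p \<otimes> b \<in> A n" using mono(4) p by (auto simp: cA_B_def col_def)
  qed auto
  have adm4: "adm xs C cC_B"
  proof (rule adm_Cons[OF Cons.prems(2) C' F(3) AC cc(8) cc(4)])
    fix n b assume "b \<in> cC_B n"
    thus "fst p \<otimes> b \<in> C n" using mono(5) p by (auto simp: cC_B_def col_def)
  qed
  note IH = Cons.IH[OF xs]
  have 1: "chi xs AB' B n = chi xs AB' CB' n + chi xs CB' B n"
    by (rule IH[OF adm1 F(5) AB'CB' CB'B])
  have 2: "chi xs AC' C n = chi xs AC' M1 n + chi xs M1 C n"
    by (rule IH[OF adm2 F2(1) lu1(4) M1C])
  have 3: "chi xs A cA_B (n - a) = chi xs A cA_C (n - a) + chi xs cA_C cA_B (n - a)"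
    by (rule IH[OF adm3 F(2) cc(7) cc(1)])
  have 4: "chi xs C cC_B (n - a) = chi xs C M2 (n - a) + chi xs M2 cC_B (n - a)"
    by (rule IH[OF adm4 F2(2) lu1(5) M2c])
  have 5: "chi xs M1 C n = chi xs AB' CB' (n + 0)"
  proof (rule chi_iso[OF xs F2(1) C' F(4,5) one_closed], goal_cases)
    case (1 m)
    show ?case
    proof
      show "CB' (m + 0) \<subseteq> lin \<one> (AB' (m + 0)) (C m)"
      proof
        fix w assume "w \<in> CB' (m + 0)"
        then obtain c b where cb: "c \<in> C m" "b \<in> B (m - a)" "w = c \<oplus> x \<otimes> b"
          by (auto simp: CB'_def lin_def)
        have "w = x \<otimes> b \<oplus> \<one> \<otimes> c" using cb car x by (simp add: a_comm)
        thus "w \<in> lin \<one> (AB' (m + 0)) (C m)" unfolding lin_def using cb lu2(1)[OF cb(2)] by auto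
      qed
      show "lin \<one> (AB' (m + 0)) (C m) \<subseteq> CB' (m + 0)"
        using AB'CB' lu1(2) idF car by (intro lin_least) auto
    qed
  next
    case (2 m)
    show ?case
    proof
      have "x \<otimes> b \<in> AB' m" if "b \<in> cC_B (m - a)" for b
        using lu2(1)[OF subsetD[OF cc(4) that]] by simp
      hence "M1 m \<subseteq> AB' m" unfolding M1_def using AC'AB' idF by (intro lin_least)
      thus "M1 m \<subseteq> col \<one> (AB' (m + 0)) (C m)" using M1C car by (auto simp: col_def) (metis car(3) l_one subsetD)
      show "col \<one> (AB' (m + 0)) (C m) \<subseteq> M1 m"
      proof
        fix c assume c: "c \<in> col \<one> (AB' (m + 0)) (C m)"
        hence cC: "c \<in> C m" by (auto simp: col_def)
        hence "c \<in> AB' m" using c car by (auto simp: col_def)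
        then obtain u b where ub: "u \<in> A m" "b \<in> B (m - a)" "c = u \<oplus> x \<otimes> b" by (auto simp: AB'_def lin_def)
        have cr: "u \<in> carrier R" "b \<in> carrier R" using ub car by metis+
        have "x \<otimes> b = c \<ominus> u" unfolding ub(3) using cr x by algebra
        moreover have "c \<ominus> u \<in> C m" using cC ub AC ids ideal_diff by blast
        ultimately have "b \<in> cC_B (m - a)" using ub by (simp add: cC_B_def col_def)
        thus "c \<in> M1 m" unfolding M1_def lin_def using ub lu1(3) by blast
      qed
    qed
  qed
  have 6: "chi xs cA_C cA_B (n - a) = chi xs C M2 (n - a + 0)"
  proof (rule chi_iso[OF xs F(2,1) C' F2(2) one_closed], goal_cases)
    case (1 m)
    show ?case by (simp add: M2_def)
  next
    case (2 m)
    show ?case using CB car by (auto simp: cA_C_def cA_B_def col_def)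
  qed
  \<comment> \<open>The connecting map: multiplication by \<open>x\<close> takes
    \<open>cC_B/M2\<close> isomorphically onto \<open>M1/AC'\<close>. Its degree \<open>a\<close>
    cancels the shift by \<open>- a\<close> in the recursion, so the two terms drop out of the
    alternating sum.\<close>
  have 7: "chi xs M2 cC_B (n - a) = chi xs AC' M1 (n - a + a)"
  proof (rule chi_iso[OF xs F2(2) F(3) F(6) F2(1) x], goal_cases)
    case (1 m)
    show ?case by (simp add: M1_def)
  next
    case (2 m)
    show ?case
    proof
      show "M2 m \<subseteq> col x (AC' (m + a)) (cC_B m)"
        unfolding M2_def
      proof (rule lin_least)
        show "ideal (col x (AC' (m + a)) (cC_B m)) R" using idF x col_ideal by blast
        show "C m \<subseteq> col x (AC' (m + a)) (cC_B m)" using cc(8) lu2(3) by (auto simp: col_def)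
        fix b assume b: "b \<in> cA_B m"
        hence "x \<otimes> b \<in> AC' (m + a)" using lu1(3) by (auto simp: cA_B_def col_def)
        thus "\<one> \<otimes> b \<in> col x (AC' (m + a)) (cC_B m)" using b cc(2) famD(4)[OF F(1) b] by (auto simp: col_def)
      qed
      show "col x (AC' (m + a)) (cC_B m) \<subseteq> M2 m"
      proof
        fix b assume b: "b \<in> col x (AC' (m + a)) (cC_B m)"
        hence bB: "b \<in> B m" using cc(4) by (auto simp: col_def)
        obtain u c where uc: "u \<in> A (m + a)" "c \<in> C m" "x \<otimes> b = u \<oplus> x \<otimes> c"
          using b by (auto simp: col_def AC'_def lin_def)
        have cr: "u \<in> carrier R" "c \<in> carrier R" "b \<in> carrier R" using uc bB car by metis+
        have "x \<otimes> (b \<ominus> c) = x \<otimes> b \<ominus> x \<otimes> c" using cr x by algebra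
        also have "\<dots> = u" unfolding uc(3) using cr x by algebra
        finally have "b \<ominus> c \<in> cA_B m" unfolding cA_B_def col_def
          using uc(1) ideal_diff[OF ids(2) bB subsetD[OF CB uc(2)]] by simp
        moreover have "b = c \<oplus> \<one> \<otimes> (b \<ominus> c)" using cr by algebra
        ultimately show "b \<in> M2 m" unfolding M2_def lin_def using uc by blast
      qed
    qed
  qed
  have e1: "chi (p # xs) A B n = chi xs AB' B n - chi xs A cA_B (n - a)"
    by (simp add: p AB'_def cA_B_def)
  have e2: "chi (p # xs) A C n = chi xs AC' C n - chi xs A cA_C (n - a)"
    by (simp add: p AC'_def cA_C_def)
  have e3: "chi (p # xs) C B n = chi xs CB' B n - chi xs C cC_B (n - a)"
    by (simp add: p CB'_def cC_B_def)
  show ?case unfolding e1 e2 e3 using 1 2 3 4 5 6 7 by simp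
qed

text \<open>For families that do not vary with the degree, the shifts in the recursion of
  \<open>chi\<close> have no effect. Even the group of degrees may differ on the two sides, so the
  symbol of \<open>R\<close> can be computed with respect to any filtration containing the same
  elements.\<close>

lemma chi_const:
  assumes "map fst xs = map fst ys"
  shows "chi xs (\<lambda>_. A) (\<lambda>_. B) n = chi ys (\<lambda>_. A) (\<lambda>_. B) m"
  using assms
proof (induction xs arbitrary: ys A B n m)
  case (Cons p xs)
  then obtain q zs where q: "ys = q # zs" "fst q = fst p" "map fst xs = map fst zs" by auto
  show ?case using Cons.IH[OF q(3)] unfolding q(1) chi.simps q(2) by (metis (no_types))
qed auto

end

section \<open>Iterated differences of Hilbert functions\<close>

primrec iter_diff :: "'g::ab_group_add list \<Rightarrow> ('g \<Rightarrow> 'v::ab_group_add) \<Rightarrow> 'g \<Rightarrow> 'v" where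
  "iter_diff [] f n = f n"
| "iter_diff (a # as) f n = iter_diff as f n - iter_diff as f (n - a)"

text \<open>Difference operators commute; with \<open>g = f\<close> this moves the outermost
  difference innermost.\<close>

lemma iter_diff_diff:
  "iter_diff as (\<lambda>n. f n - g (n - a)) n = iter_diff as f n - iter_diff as g (n - a)"
proof (induction as arbitrary: n)
  case (Cons b as)
  have eq: "n - b - a = n - a - b" by (simp add: algebra_simps)
  show ?case unfolding iter_diff.simps Cons.IH eq by simp
qed simp

context noetherian_cring
begin

text \<open>With finite lengths, the exact sequence of multiplication by \<open>x\<close> from
  degree \<open>n - a\<close> to degree \<open>n\<close> shows that cokernel minus kernel equals the
  difference of the two values of the Hilbert function. Each element of the list thus contributes
  one difference in its degree.\<close>

lemma chi_eq_iter_diff: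
  assumes "gens xs" "fam xs A" "fam xs B" "\<And>n. A n \<subseteq> B n" "\<And>n. len (A n) (B n) \<noteq> \<infinity>"
  shows "chi xs A B n = iter_diff (map snd xs) (\<lambda>n. length_int (A n) (B n)) n"
  using assms
proof (induction xs arbitrary: A B n)
  case (Cons p xs)
  obtain x a where p: "p = (x, a)" by (cases p)
  have x: "x \<in> carrier R" and a: "0 \<le> a" and xs: "gens xs" using Cons.prems(1) by (auto simp: p gens_Cons)
  note A = Cons.prems(2) and B = Cons.prems(3) and AB = Cons.prems(4)
  note A' = fam_Cons[OF A] and B' = fam_Cons[OF B]
  note ids = famD(1)[OF A] famD(1)[OF B]
  define U where "U = (\<lambda>m. lin x (A m) (B (m - a)))"
  define V where "V = (\<lambda>m. col x (A (m + a)) (B m))"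
  have st: "b \<in> A n \<Longrightarrow> x \<otimes> b \<in> A (n + a)" "b \<in> B n \<Longrightarrow> x \<otimes> b \<in> B (n + a)" for b n
    using A B famD(3)[of "p # xs" _ x a b n] p by auto
  have F: "fam xs U" "fam xs V" unfolding U_def V_def using A' B' x xs by (auto intro: fam_lin fam_col)
  have s: "A m \<subseteq> U m" "U m \<subseteq> B m" "A m \<subseteq> V m" "V m \<subseteq> B m" for m
  proof -
    show "A m \<subseteq> U m" unfolding U_def using lin_upper1 ids x by blast
    show "U m \<subseteq> B m" unfolding U_def using AB st(2)[of _ "m - a"] ids by (intro lin_least) auto
    show "A m \<subseteq> V m" "V m \<subseteq> B m" using st subsetD[OF AB] by (auto simp: V_def col_def)
  qed
  note iF = F[THEN famD(1)]
  note fin = Cons.prems(5)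
  have finU: "len (A m) (U m) \<noteq> \<infinity>" "len (U m) (B m) \<noteq> \<infinity>" "len (A m) (V m) \<noteq> \<infinity>" for m
    using lens_finite[OF ids(1) iF(1) ids(2) s(1,2) fin] lens_finite[OF ids(1) iF(2) ids(2) s(3,4) fin] by blast+
  have "length_int (U m) (B m) - length_int (A (m - a)) (V (m - a))
       = length_int (A m) (B m) - length_int (A (m - a)) (B (m - a))" for m
  proof -
    have "len (V (m - a)) (B (m - a)) = len (A m) (U m)"
      by (rule len_iso[OF iF(2) ids(2) ids(1) x]) (simp_all add: V_def U_def)
    hence "length_int (V (m - a)) (B (m - a)) = length_int (A m) (U m)" by (simp add: length_int_def)
    thus ?thesis
      using length_int_add[OF ids(1) iF(1) ids(2) s(1,2) fin, of m]
        length_int_add[OF ids(1) iF(2) ids(2) s(3,4) fin, of "m - a"] by simp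
  qed
  note key = this
  have "chi (p # xs) A B n = chi xs U B n - chi xs A V (n - a)" by (simp add: p U_def V_def)
  also have "\<dots> = iter_diff (map snd xs) (\<lambda>m. length_int (U m) (B m)) n
       - iter_diff (map snd xs) (\<lambda>m. length_int (A m) (V m)) (n - a)"
    using Cons.IH[OF xs F(1) B' s(2) finU(2)] Cons.IH[OF xs A' F(2) s(3) finU(3)] by simp
  also have "\<dots> = iter_diff (map snd xs) (\<lambda>m. length_int (U m) (B m) - length_int (A (m - a)) (V (m - a))) n"
    by (rule iter_diff_diff[symmetric])
  also have "\<dots> = iter_diff (map snd xs) (\<lambda>m. length_int (A m) (B m)) n
       - iter_diff (map snd xs) (\<lambda>m. length_int (A m) (B m)) (n - a)"
    unfolding key by (rule iter_diff_diff)
  finally show ?case by (simp add: p)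
qed simp

end

section \<open>Graded Hilbert basis theorem\<close>

definition nmul :: "nat \<Rightarrow> 'g::ab_group_add \<Rightarrow> 'g" where
  "nmul i a = ((+) a ^^ i) 0"

lemma nmul_simps [simp]: "nmul 0 a = 0" "nmul (Suc i) a = a + nmul i a"
  by (simp_all add: nmul_def)

context noetherian_cring
begin

definition stable :: "('a \<times> 'g::ab_group_add) set \<Rightarrow> ('g \<Rightarrow> 'a set) \<Rightarrow> bool" where
  "stable W A \<longleftrightarrow> (\<forall>(y, a)\<in>W. \<forall>n. \<forall>b\<in>A n. y \<otimes> b \<in> A (n + a))"

lemma stableD: "stable W A \<Longrightarrow> (y, a) \<in> W \<Longrightarrow> b \<in> A n \<Longrightarrow> y \<otimes> b \<in> A (n + a)"
  by (auto simp: stable_def)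

text \<open>Ascending chain condition on graded submodules of \<open>B\<close> over the algebra
  generated over \<open>R\<close> by the homogeneous elements in \<open>W\<close>. Multiplication by
  \<open>y\<close> with a shift by \<open>a\<close> plays the part of the variable, so no polynomial
  ring is constructed.\<close>

definition noeth_fam :: "('a \<times> 'g::ab_group_add) set \<Rightarrow> ('g \<Rightarrow> 'a set) \<Rightarrow> bool" where
  "noeth_fam W B \<longleftrightarrow> (\<forall>A::nat \<Rightarrow> 'g \<Rightarrow> 'a set.
     (\<forall>j n. ideal (A j n) R \<and> A j n \<subseteq> A (Suc j) n \<and> A j n \<subseteq> B n) \<and> (\<forall>j. stable W (A j))
     \<longrightarrow> (\<exists>j0. \<forall>j\<ge>j0. A j = A j0))"

lemma noeth_famD:
  assumes "noeth_fam W B" "\<And>j n. ideal (A j n) R" "\<And>j n. A j n \<subseteq> A (Suc j) n" "\<And>j n. A j n \<subseteq> B n"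
    "\<And>j. stable W (A j)"
  shows "\<exists>j0. \<forall>j\<ge>j0. A j = A j0"
  using assms(1)[unfolded noeth_fam_def, rule_format, of A] assms(2-5) by simp

text \<open>The sums of terms \<open>y^k b\<close> with \<open>k < i\<close> and \<open>b\<close> in
  \<open>B (n - nmul k a)\<close>, the analogue of polynomials in \<open>y\<close> of degree below
  \<open>i\<close>. Their union \<open>adjoin\<close> is the module generated by \<open>B\<close>
  once \<open>y\<close> is allowed to act.\<close>

primrec adj :: "'a \<Rightarrow> 'g::ab_group_add \<Rightarrow> ('g \<Rightarrow> 'a set) \<Rightarrow> nat \<Rightarrow> 'g \<Rightarrow> 'a set" where
  "adj y a B 0 n = {\<zero>}"
| "adj y a B (Suc i) n = lin (y [^] i) (adj y a B i n) (B (n - nmul i a))"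

definition adjoin :: "'a \<Rightarrow> 'g::ab_group_add \<Rightarrow> ('g \<Rightarrow> 'a set) \<Rightarrow> 'g \<Rightarrow> 'a set" where
  "adjoin y a B n = (\<Union>i. adj y a B i n)"

context
  fixes y :: 'a and a :: "'g::ab_group_add" and B :: "'g \<Rightarrow> 'a set" and W :: "('a \<times> 'g) set"
  assumes y: "y \<in> carrier R" and B: "\<And>n. ideal (B n) R" and W: "fst ` W \<subseteq> carrier R"
    and stB: "stable W B"
begin

lemma adj_ideal: "ideal (adj y a B i n) R"
  by (induction i) (use y B zeroideal in \<open>auto intro: lin_ideal\<close>)

lemma adj_mono: "i \<le> j \<Longrightarrow> adj y a B i n \<subseteq> adj y a B j n"
proof (rule lift_Suc_mono_le[of "\<lambda>i. adj y a B i n"])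
  fix i show "adj y a B i n \<subseteq> adj y a B (Suc i) n"
    using lin_upper1[OF adj_ideal B] y by simp
qed

lemma adj_car: "b \<in> adj y a B i n \<Longrightarrow> b \<in> carrier R"
  using adj_ideal ideal.Icarr by metis

lemma B_car: "b \<in> B n \<Longrightarrow> b \<in> carrier R"
  using B ideal.Icarr by metis

lemma adj_mult_y: "b \<in> adj y a B i n \<Longrightarrow> y \<otimes> b \<in> adj y a B (Suc i) (n + a)"
proof (induction i arbitrary: b)
  case 0
  hence "y \<otimes> b = \<zero>" using y by simp
  thus ?case using adj_ideal[of "Suc 0"] ideal_zero by metis
next
  case (Suc i)
  then obtain u v where uv: "u \<in> adj y a B i n" "v \<in> B (n - nmul i a)" "b = u \<oplus> y [^] i \<otimes> v"
    by (auto simp: lin_def)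
  have c: "u \<in> carrier R" "v \<in> carrier R" using uv adj_car B_car by metis+
  have "y \<otimes> b = y \<otimes> u \<oplus> y \<otimes> (y [^] i \<otimes> v)" using uv c y by (simp add: r_distr)
  also have "y \<otimes> (y [^] i \<otimes> v) = y [^] Suc i \<otimes> v" using c y by (simp add: m_ac)
  finally have "y \<otimes> b = y \<otimes> u \<oplus> y [^] Suc i \<otimes> v" .
  moreover have "v \<in> B (n + a - nmul (Suc i) a)" using uv(2) by (simp add: algebra_simps)
  ultimately show ?case using Suc.IH[OF uv(1)] unfolding adj.simps(2)[of y a B "Suc i"] lin_def by blast
qed

lemma adj_stable: "(w, c) \<in> W \<Longrightarrow> b \<in> adj y a B i n \<Longrightarrow> w \<otimes> b \<in> adj y a B i (n + c)"
proof (induction i arbitrary: b)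
  case 0
  thus ?case using W by force
next
  case (Suc i)
  then obtain u v where uv: "u \<in> adj y a B i n" "v \<in> B (n - nmul i a)" "b = u \<oplus> y [^] i \<otimes> v"
    by (auto simp: lin_def)
  have c: "u \<in> carrier R" "v \<in> carrier R" "w \<in> carrier R" using uv adj_car B_car W Suc.prems by force+
  have "w \<otimes> b = w \<otimes> u \<oplus> y [^] i \<otimes> (w \<otimes> v)" using uv c y by (simp add: r_distr m_ac)
  moreover have "w \<otimes> v \<in> B (n + c - nmul i a)"
    using stableD[OF stB Suc.prems(1) uv(2)] by (simp add: algebra_simps)
  ultimately show ?case using Suc.IH[OF Suc.prems(1) uv(1)] unfolding adj.simps(2) lin_def by blast
qed

lemma adjoin_ideal: "ideal (adjoin y a B n) R"
proof (rule idealI')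
  show "adjoin y a B n \<subseteq> carrier R" using adj_car by (auto simp: adjoin_def)
  show "\<zero> \<in> adjoin y a B n" unfolding adjoin_def using ideal_zero[OF adj_ideal] by blast
  { fix u v assume "u \<in> adjoin y a B n" "v \<in> adjoin y a B n"
    then obtain i j where "u \<in> adj y a B i n" "v \<in> adj y a B j n" by (auto simp: adjoin_def)
    hence "u \<in> adj y a B (max i j) n" "v \<in> adj y a B (max i j) n"
      using adj_mono[of i "max i j" n] adj_mono[of j "max i j" n] by auto
    thus "u \<oplus> v \<in> adjoin y a B n" unfolding adjoin_def using ideal_add[OF adj_ideal] by blast }
  fix u r assume "u \<in> adjoin y a B n" "r \<in> carrier R"
  thus "r \<otimes> u \<in> adjoin y a B n" unfolding adjoin_def using ideal_mult[OF adj_ideal] by blast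
qed

lemma adjoin_stable: "stable (insert (y, a) W) (adjoin y a B)"
  unfolding stable_def
proof (intro ballI, goal_cases)
  case (1 p)
  obtain w c where p: "p = (w, c)" by (cases p)
  have "w \<otimes> b \<in> adjoin y a B (n + c)" if b: "b \<in> adj y a B i n" for b n i
  proof (cases "p = (y, a)")
    case True
    thus ?thesis using adj_mult_y[OF b] p unfolding adjoin_def by blast
  next
    case False
    thus ?thesis using adj_stable[OF _ b] p 1 unfolding adjoin_def by blast
  qed
  thus ?case unfolding p adjoin_def by blast
qed

lemma subset_adjoin: "B n \<subseteq> adjoin y a B n"
proof
  fix b assume b: "b \<in> B n"
  have "b = \<zero> \<oplus> \<one> \<otimes> b" using B_car[OF b] by simp
  hence "b \<in> adj y a B (Suc 0) n" using b by (auto simp: lin_def)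
  thus "b \<in> adjoin y a B n" unfolding adjoin_def by blast
qed

text \<open>Counterpart of the leading coefficients of degree \<open>i\<close> in Hilbert's theorem.
  As \<open>y\<close> is an element of \<open>R\<close> and not an indeterminate, expansions in
  powers of \<open>y\<close> are not unique; being a leading coefficient is therefore a congruence
  modulo the part \<open>adj\<close> of lower order.\<close>

definition lead :: "nat \<Rightarrow> ('g \<Rightarrow> 'a set) \<Rightarrow> 'g \<Rightarrow> 'a set" where
  "lead i A n = col (y [^] i) (lin \<one> (A (n + nmul i a)) (adj y a B i (n + nmul i a))) (B n)"

lemma lead_ideal: "(\<And>n. ideal (A n) R) \<Longrightarrow> ideal (lead i A n) R"
  unfolding lead_def using y B adj_ideal by (intro col_ideal lin_ideal) auto

lemma leadI:
  assumes "b \<in> B n" "u \<in> A (n + nmul i a)" "v \<in> adj y a B i (n + nmul i a)" "y [^] i \<otimes> b = u \<oplus> \<one> \<otimes> v"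
  shows "b \<in> lead i A n"
proof -
  have "y [^] i \<otimes> b \<in> lin \<one> (A (n + nmul i a)) (adj y a B i (n + nmul i a))"
    unfolding assms(4) lin_def using assms(2,3) by blast
  thus ?thesis using assms(1) by (simp add: lead_def col_def)
qed

lemma leadE:
  assumes "b \<in> lead i A n"
  obtains u v where "u \<in> A (n + nmul i a)" "v \<in> adj y a B i (n + nmul i a)" "b \<in> B n"
     "y [^] i \<otimes> b = u \<oplus> \<one> \<otimes> v"
proof -
  have "b \<in> B n" "y [^] i \<otimes> b \<in> lin \<one> (A (n + nmul i a)) (adj y a B i (n + nmul i a))"
    using assms by (simp_all add: lead_def col_def)
  thus ?thesis using that unfolding lin_def by blast
qed

lemma lead_mono:
  assumes "\<And>n. A n \<subseteq> A' n"
  shows "lead i A n \<subseteq> lead i A' n"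
proof
  fix b assume "b \<in> lead i A n"
  then obtain u v where uv: "u \<in> A (n + nmul i a)" "v \<in> adj y a B i (n + nmul i a)" "b \<in> B n"
     "y [^] i \<otimes> b = u \<oplus> \<one> \<otimes> v" by (rule leadE)
  show "b \<in> lead i A' n" by (rule leadI[where A = A', OF uv(3) subsetD[OF assms uv(1)] uv(2,4)])
qed

lemma lead_stable:
  assumes "\<And>n. ideal (A n) R" "stable W A"
  shows "stable W (lead i A)"
  unfolding stable_def
proof safe
  fix w c n b assume wc: "(w, c) \<in> W" and b: "b \<in> lead i A n"
  from b obtain u v where uv: "u \<in> A (n + nmul i a)" "v \<in> adj y a B i (n + nmul i a)" "b \<in> B n"
     "y [^] i \<otimes> b = u \<oplus> \<one> \<otimes> v"
    by (rule leadE)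
  have "w \<in> carrier R" using wc W by force
  moreover have "u \<in> carrier R" using uv(1) assms(1) ideal.Icarr by metis
  ultimately have k: "w \<in> carrier R" "u \<in> carrier R" "v \<in> carrier R" "b \<in> carrier R"
    using adj_car[OF uv(2)] B_car[OF uv(3)] by simp_all
  have "y [^] i \<otimes> (w \<otimes> b) = w \<otimes> (y [^] i \<otimes> b)" using k y by (intro m_lcomm) auto
  also have "\<dots> = w \<otimes> u \<oplus> \<one> \<otimes> (w \<otimes> v)" unfolding uv(4) using k by (simp add: r_distr)
  finally have e: "y [^] i \<otimes> (w \<otimes> b) = w \<otimes> u \<oplus> \<one> \<otimes> (w \<otimes> v)" .
  have "n + nmul i a + c = n + c + nmul i a" by (simp add: algebra_simps)
  hence "w \<otimes> u \<in> A (n + c + nmul i a)" "w \<otimes> v \<in> adj y a B i (n + c + nmul i a)"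
    using stableD[OF assms(2) wc uv(1)] adj_stable[OF wc uv(2)] by metis+
  thus "w \<otimes> b \<in> lead i A (n + c)" by (rule leadI[where A = A, OF stableD[OF stB wc uv(3)] _ _ e])
qed

lemma lead_Suc:
  assumes A: "\<And>n. ideal (A n) R" "stable {(y, a)} A"
  shows "lead i A n \<subseteq> lead (Suc i) A n"
proof
  fix b assume "b \<in> lead i A n"
  then obtain u v where uv: "u \<in> A (n + nmul i a)" "v \<in> adj y a B i (n + nmul i a)" "b \<in> B n"
     "y [^] i \<otimes> b = u \<oplus> \<one> \<otimes> v"
    by (rule leadE)
  have k: "u \<in> carrier R" "v \<in> carrier R" "b \<in> carrier R"
    using uv adj_car B_car assms(1) ideal.Icarr by metis+
  have "y [^] Suc i \<otimes> b = y \<otimes> (y [^] i \<otimes> b)" using k y by (simp add: m_ac)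
  also have "\<dots> = y \<otimes> u \<oplus> \<one> \<otimes> (y \<otimes> v)" unfolding uv(4) using k y by (simp add: r_distr)
  finally have e: "y [^] Suc i \<otimes> b = y \<otimes> u \<oplus> \<one> \<otimes> (y \<otimes> v)" .
  have eq: "n + nmul i a + a = n + nmul (Suc i) a" by (simp add: algebra_simps)
  have "y \<otimes> u \<in> A (n + nmul (Suc i) a)" "y \<otimes> v \<in> adj y a B (Suc i) (n + nmul (Suc i) a)"
    using stableD[OF A(2) singletonI uv(1)] adj_mult_y[OF uv(2)] unfolding eq by simp_all
  thus "b \<in> lead (Suc i) A n" by (rule leadI[where A = A, OF uv(3) _ _ e])
qed

text \<open>Hilbert's basis theorem: a chain is determined by its families of leading coefficients,
  and these stabilise along the diagonal.\<close>

lemma noeth_fam_adjoin: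
  assumes N: "noeth_fam W B"
  shows "noeth_fam (insert (y, a) W) (adjoin y a B)"
  unfolding noeth_fam_def
proof (intro allI impI)
  fix A :: "nat \<Rightarrow> 'g \<Rightarrow> 'a set"
  assume H: "(\<forall>j n. ideal (A j n) R \<and> A j n \<subseteq> A (Suc j) n \<and> A j n \<subseteq> adjoin y a B n) \<and>
    (\<forall>j. stable (insert (y, a) W) (A j))"
  hence A: "\<And>j n. ideal (A j n) R" "\<And>j n. A j n \<subseteq> A (Suc j) n" "\<And>j n. A j n \<subseteq> adjoin y a B n"
     "\<And>j. stable W (A j)" "\<And>j. stable {(y, a)} (A j)" by (auto simp: stable_def)
  have Am: "A j n \<subseteq> A k n" if "j \<le> k" for j k n
    using lift_Suc_mono_le[of "\<lambda>j. A j n"] A(2) that by blast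
  have Lm: "lead i (A j) n \<subseteq> lead k (A l) n" if "i \<le> k" "j \<le> l" for i j k l n
  proof -
    have "lead i (A j) n \<subseteq> lead k (A j) n"
      using lift_Suc_mono_le[of "\<lambda>i. lead i (A j) n"] lead_Suc[OF A(1,5)] that by blast
    also have "\<dots> \<subseteq> lead k (A l) n" using Am that by (intro lead_mono)
    finally show ?thesis .
  qed
  have LB: "lead i (A j) n \<subseteq> B n" for i j n by (auto simp: lead_def col_def)
  \<comment> \<open>The families \<open>lead i (A j)\<close> grow in both indices, so the diagonal
    is an ascending chain of \<open>W\<close>-stable families inside \<open>B\<close>.\<close>
  have "\<exists>j0. \<forall>j\<ge>j0. lead j (A j) = lead j0 (A j0)"
    by (rule noeth_famD[OF N, of "\<lambda>j. lead j (A j)", OF lead_ideal[OF A(1)] Lm LB lead_stable[OF A(1,4)]])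
      simp_all
  then obtain j0 where j0: "\<And>j. j \<ge> j0 \<Longrightarrow> lead j (A j) = lead j0 (A j0)" by blast
  have "\<exists>k. \<forall>j\<ge>k. lead i (A j) = lead i (A k)" for i
    by (rule noeth_famD[OF N, of "\<lambda>j. lead i (A j)", OF lead_ideal[OF A(1)] Lm LB lead_stable[OF A(1,4)]])
      simp_all
  then obtain k where k: "\<And>i j. j \<ge> k i \<Longrightarrow> lead i (A j) = lead i (A (k i))" by metis
  define J where "J = Max (insert j0 (k ` {..<j0}))"
  have J: "j0 \<le> J" "i < j0 \<Longrightarrow> k i \<le> J" for i unfolding J_def by auto
  have L: "lead i (A j) = lead i (A J)" if "j \<ge> J" for i j
  proof (cases "i < j0")
    case True
    thus ?thesis using k[of i j] k[of i J] J(2)[OF True] that by simp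
  next
    case False
    \<comment> \<open>For \<open>i \<ge> j0\<close> the family is squeezed between two diagonal
      terms with index at least \<open>j0\<close>, which agree. Only the finitely many
      \<open>i < j0\<close> need bounds of their own, and these enter the maximum
      \<open>J\<close>.\<close>
    have e: "lead i (A l) = lead j0 (A j0)" if "l \<ge> J" for l
    proof (rule ext, rule antisym)
      fix n
      show "lead i (A l) n \<subseteq> lead j0 (A j0) n"
        using Lm[of i "max i l" l "max i l" n] j0[of "max i l"] False by simp
      show "lead j0 (A j0) n \<subseteq> lead i (A l) n" using Lm[of j0 i j0 l n] False J that by simp
    qed
    thus ?thesis using that by simp
  qed
  \<comment> \<open>Cancellation of leading terms: \<open>z\<close> has leading coefficient
    \<open>v\<close>, which is also one for \<open>A J\<close>; subtracting the corresponding
    \<open>s\<close> in \<open>A J\<close> leaves an element of lower order in \<open>y\<close>,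
    still in \<open>A j\<close>.\<close>
  have step: "A j n \<inter> adj y a B i n \<subseteq> A J n" if j: "j \<ge> J" for i j n
  proof (induction i)
    case 0
    thus ?case using ideal_zero[OF A(1)] by auto
  next
    case (Suc i)
    show ?case
    proof
      fix z assume z: "z \<in> A j n \<inter> adj y a B (Suc i) n"
      then obtain u v where uv: "u \<in> adj y a B i n" "v \<in> B (n - nmul i a)" "z = u \<oplus> y [^] i \<otimes> v"
        by (auto simp: lin_def)
      have c: "u \<in> carrier R" "v \<in> carrier R" "z \<in> carrier R" using uv z adj_car B_car A(1) ideal.Icarr by (metis, metis, blast)
      have iu: "\<ominus> u \<in> adj y a B i n" using ideal_diff[OF adj_ideal ideal_zero[OF adj_ideal] uv(1)] c
        by (simp add: a_minus_def)
      have "y [^] i \<otimes> v = z \<oplus> \<one> \<otimes> (\<ominus> u)" unfolding uv(3) using c y nat_pow_closed[OF y, of i] by algebra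
      hence "v \<in> lead i (A j) (n - nmul i a)"
        by (intro leadI[where A = "A j" and u = z, OF uv(2)]) (use z iu in auto)
      hence "v \<in> lead i (A J) (n - nmul i a)" using L[OF j] by simp
      then obtain s t where st: "s \<in> A J n" "t \<in> adj y a B i n" "y [^] i \<otimes> v = s \<oplus> \<one> \<otimes> t"
        by (rule leadE[where A = "A J"]) auto
      have c2: "s \<in> carrier R" "t \<in> carrier R" using st adj_car A(1) ideal.Icarr by metis+
      have "z \<ominus> s = u \<oplus> t" unfolding uv(3) st(3) using c c2 by algebra
      moreover have "u \<oplus> t \<in> adj y a B i n" using uv st adj_ideal ideal_add by blast
      moreover have "s \<in> A j n" using st Am[OF j] by blast
      moreover have "z \<ominus> s \<in> A j n" using z \<open>s \<in> A j n\<close> ideal_diff[OF A(1)] by blast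
      ultimately have "z \<ominus> s \<in> A J n" using Suc.IH by auto
      hence "(z \<ominus> s) \<oplus> s \<in> A J n" using st A(1) ideal_add by blast
      moreover have "(z \<ominus> s) \<oplus> s = z" using c c2 by algebra
      ultimately show "z \<in> A J n" by simp
    qed
  qed
  have "A j = A J" if "j \<ge> J" for j
  proof (rule ext, rule antisym)
    fix n
    show "A J n \<subseteq> A j n" using Am[OF that] .
    show "A j n \<subseteq> A J n"
    proof
      fix z assume z: "z \<in> A j n"
      then obtain i where "z \<in> adj y a B i n" using A(3)[of j n] unfolding adjoin_def by blast
      thus "z \<in> A J n" using z step[OF that] by blast
    qed
  qed
  thus "\<exists>j0. \<forall>j\<ge>j0. A j = A j0" by blast
qed

end

lemma noeth_fam_finite_support:
  fixes K :: "'g::ab_group_add set"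
  assumes "finite K"
  shows "noeth_fam {} (\<lambda>n. if n \<in> K then carrier R else {\<zero>})"
  unfolding noeth_fam_def
proof (intro allI impI)
  fix A :: "nat \<Rightarrow> 'g \<Rightarrow> 'a set"
  assume H: "(\<forall>j n. ideal (A j n) R \<and> A j n \<subseteq> A (Suc j) n \<and> A j n \<subseteq> (if n \<in> K then carrier R else {\<zero>})) \<and>
    (\<forall>j. stable {} (A j))"
  have "\<forall>n. \<exists>k. \<forall>j\<ge>k. A j n = A k n"
  proof
    fix n
    obtain k where "\<And>j. j \<ge> k \<Longrightarrow> A j n = A k n"
      using ideal_ascending_stable[of "\<lambda>j. A j n"] H by blast
    thus "\<exists>k. \<forall>j\<ge>k. A j n = A k n" by blast
  qed
  then obtain k where k: "\<And>n j. j \<ge> k n \<Longrightarrow> A j n = A (k n) n" by metis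
  define J where "J = Max (insert 0 (k ` K))"
  have J: "k n \<le> J" if "n \<in> K" for n unfolding J_def using assms that by auto
  have "A j = A J" if "j \<ge> J" for j
  proof
    fix n
    show "A j n = A J n"
    proof (cases "n \<in> K")
      case True
      thus ?thesis using k[of n j] k[of n J] J[OF True] that by simp
    next
      case False
      have "A l n = {\<zero>}" for l
      proof -
        have "A l n \<subseteq> {\<zero>}" using H False by metis
        moreover have "\<zero> \<in> A l n" using H ideal_zero by blast
        ultimately show ?thesis by blast
      qed
      thus ?thesis by simp
    qed
  qed
  thus "\<exists>j0. \<forall>j\<ge>j0. A j = A j0" by blast
qed

text \<open>Start with \<open>R\<close> in the degrees of \<open>K\<close> and zero elsewhere, and
  let the elements of \<open>W\<close> act one after the other. Adjoining only enlarges the family,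
  so the value \<open>R\<close> on \<open>K\<close> survives.\<close>

lemma exists_noeth_fam:
  fixes W :: "('a \<times> 'g::ab_group_add) set" and K :: "'g set"
  assumes "finite W" "finite K" "fst ` W \<subseteq> carrier R"
  shows "\<exists>B. noeth_fam W B \<and> (\<forall>n. ideal (B n) R) \<and> stable W B \<and> (\<forall>n\<in>K. B n = carrier R)"
  using assms(1,3)
proof (induction W rule: finite_induct)
  case empty
  thus ?case using noeth_fam_finite_support[OF assms(2)] zeroideal oneideal
    by (intro exI[of _ "\<lambda>n. if n \<in> K then carrier R else {\<zero>}"]) (auto simp: stable_def)
next
  case (insert p W)
  obtain y a where p: "p = (y, a)" by (cases p)
  obtain B where B: "noeth_fam W B" "\<And>n. ideal (B n) R" "stable W B" "\<And>n. n \<in> K \<Longrightarrow> B n = carrier R"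
    using insert by auto
  have y: "y \<in> carrier R" and W: "fst ` W \<subseteq> carrier R" using insert p by auto
  note h = y B(2) W B(3)
  have "adjoin y a B n = carrier R" if "n \<in> K" for n
    using subset_adjoin[OF h, of n a] ideal_subset_carrier[OF adjoin_ideal[OF h, of a n]] B(4)[OF that] by blast
  thus ?case unfolding p
    using noeth_fam_adjoin[OF h B(1)] adjoin_ideal[OF h] adjoin_stable[OF h]
    by (intro exI[of _ "adjoin y a B"]) simp
qed

end

section \<open>The symbol of a Noetherian filtration\<close>

declare plus_fun_apply [simp del] minus_apply [simp del]

lemma ab_group_shift:
  fixes n :: "'g::ab_group_add"
  shows "n - a + m = n + m - a" "n + a + m = n + m + a" "n + (m - a) + a = n + m"
  by (simp_all add: algebra_simps)

lemma ex_nat_const_ge: "\<exists>j0::nat. \<forall>j\<ge>j0. (k :: 's::finite \<Rightarrow> int) \<le> (\<lambda>_. int j)"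
proof -
  have "k i \<le> Max (range k)" for i by (rule Max_ge) auto
  hence "k i \<le> int (nat (Max (range k)))" for i
    using int_nat_eq[of "Max (range k)"] by (smt (verit))
  hence "k i \<le> int j" if "nat (Max (range k)) \<le> j" for i j
    using that by (meson of_nat_mono order_trans)
  thus ?thesis unfolding le_fun_def by blast
qed

context noetherian_cring
begin

definition filtration :: "(('s::finite \<Rightarrow> int) \<Rightarrow> 'a set) \<Rightarrow> bool" where
  "filtration F \<longleftrightarrow> (\<forall>n. ideal (F n) R) \<and> (\<forall>m n. m \<le> n \<longrightarrow> F n \<subseteq> F m) \<and> F 0 = carrier R \<and>
     (\<forall>m n. \<forall>f\<in>F m. \<forall>b\<in>F n. f \<otimes> b \<in> F (n + m))"

lemma filtrationD:
  assumes "filtration F"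
  shows "ideal (F n) R" "m \<le> n \<Longrightarrow> F n \<subseteq> F m" "n \<le> 0 \<Longrightarrow> F n = carrier R"
    "f \<in> F m \<Longrightarrow> b \<in> F n \<Longrightarrow> f \<otimes> b \<in> F (n + m)" "f \<in> F m \<Longrightarrow> f \<in> carrier R"
proof -
  show "ideal (F n) R" "m \<le> n \<Longrightarrow> F n \<subseteq> F m" "f \<in> F m \<Longrightarrow> b \<in> F n \<Longrightarrow> f \<otimes> b \<in> F (n + m)"
    using assms by (auto simp: filtration_def)
  show "f \<in> F m \<Longrightarrow> f \<in> carrier R" using assms by (auto simp: filtration_def dest: ideal.Icarr)
  show "F n = carrier R" if "n \<le> 0"
  proof -
    have "F 0 \<subseteq> F n" "F 0 = carrier R" "ideal (F n) R" using assms that unfolding filtration_def by blast+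
    thus ?thesis using ideal_subset_carrier by blast
  qed
qed

text \<open>\<open>F\<close> is contained, in nonnegative degrees, in a Noetherian module over a
  subalgebra of its own Rees algebra. Families stable under \<open>F\<close> are stable under
  \<open>W\<close>, so ascending chains of them inside \<open>F\<close>, cut to zero outside the
  degrees \<open>n \<ge> 0\<close>, become stationary.\<close>

definition noeth_filtration :: "(('s::finite \<Rightarrow> int) \<Rightarrow> 'a set) \<Rightarrow> bool" where
  "noeth_filtration F \<longleftrightarrow> filtration F \<and> (\<exists>W B. noeth_fam W B \<and> (\<forall>n. ideal (B n) R) \<and>
     (\<forall>(y, a)\<in>W. y \<in> F a \<and> 0 \<le> a) \<and> (\<forall>n\<ge>0. F n \<subseteq> B n))"

definition mult_stable :: "(('s::finite \<Rightarrow> int) \<Rightarrow> 'a set) \<Rightarrow> (('s \<Rightarrow> int) \<Rightarrow> 'a set) \<Rightarrow> bool" where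
  "mult_stable F A \<longleftrightarrow> (\<forall>m n. \<forall>f\<in>F m. \<forall>b\<in>A n. f \<otimes> b \<in> A (n + m))"

lemma mult_stableD: "mult_stable F A \<Longrightarrow> f \<in> F m \<Longrightarrow> b \<in> A n \<Longrightarrow> f \<otimes> b \<in> A (n + m)"
  by (auto simp: mult_stable_def)

text \<open>Every element of \<open>B/A\<close> is annihilated by all multipliers that lift it to a
  high enough degree, with a bound depending on the degree of the element. The ascending chain
  condition makes the bound uniform, and the multiplier \<open>\<one>\<close> of degree
  \<open>0\<close> then shows that the element itself is zero in \<open>B/A\<close>.\<close>

lemma eventually_subset:
  assumes F: "noeth_filtration F"
    and iA: "\<And>n. ideal (A n) R" and iB: "\<And>n. ideal (B n) R" and AB: "\<And>n. A n \<subseteq> B n" and BF: "\<And>n. B n \<subseteq> F n"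
    and sA: "mult_stable F A" and sB: "mult_stable F B"
    and n1: "\<And>m n f b. n1 \<le> m \<Longrightarrow> f \<in> F m \<Longrightarrow> b \<in> B n \<Longrightarrow> f \<otimes> b \<in> A (n + m)"
  shows "\<exists>n2. \<forall>n\<ge>n2. B n \<subseteq> A n"
proof -
  have fF: "filtration F" using F by (simp add: noeth_filtration_def)
  obtain W E where W: "noeth_fam W E" "\<And>n. ideal (E n) R" "\<And>y a. (y, a) \<in> W \<Longrightarrow> y \<in> F a \<and> 0 \<le> a"
    "\<And>n. 0 \<le> n \<Longrightarrow> F n \<subseteq> E n" using F unfolding noeth_filtration_def by blast
  \<comment> \<open>Elements of \<open>B n\<close> that are pushed into \<open>A\<close> whenever
    the resulting degree is at least \<open>(j, ..., j)\<close>. Outside \<open>0 \<le> n\<close>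
    the family is cut to zero, because the ambient Noetherian family contains \<open>F\<close> only
    for \<open>0 \<le> n\<close>.\<close>
  define C where "C = (\<lambda>(j::nat) n. if 0 \<le> n then
      {b \<in> B n. \<forall>m. (\<lambda>_. int j) \<le> n + m \<longrightarrow> (\<forall>f\<in>F m. f \<otimes> b \<in> A (n + m))} else {\<zero>})"
  note cF = filtrationD(5)[OF fF]
  have cB: "b \<in> B n \<Longrightarrow> b \<in> carrier R" for b n using iB ideal.Icarr by metis
  have iC: "ideal (C j n) R" for j n
  proof (cases "0 \<le> n")
    case True
    have e: "C j n = {b \<in> B n. \<forall>m. (\<lambda>_. int j) \<le> n + m \<longrightarrow> (\<forall>f\<in>F m. f \<otimes> b \<in> A (n + m))}"
      using True by (simp add: C_def)
    show ?thesis unfolding e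
    proof (rule idealI')
      show "{b \<in> B n. \<forall>m. (\<lambda>_. int j) \<le> n + m \<longrightarrow> (\<forall>f\<in>F m. f \<otimes> b \<in> A (n + m))} \<subseteq> carrier R" using cB by auto
      show "\<zero> \<in> {b \<in> B n. \<forall>m. (\<lambda>_. int j) \<le> n + m \<longrightarrow> (\<forall>f\<in>F m. f \<otimes> b \<in> A (n + m))}"
        using ideal_zero[OF iA] ideal_zero[OF iB] cF by simp
      fix u assume u: "u \<in> {b \<in> B n. \<forall>m. (\<lambda>_. int j) \<le> n + m \<longrightarrow> (\<forall>f\<in>F m. f \<otimes> b \<in> A (n + m))}"
      { fix v assume v: "v \<in> {b \<in> B n. \<forall>m. (\<lambda>_. int j) \<le> n + m \<longrightarrow> (\<forall>f\<in>F m. f \<otimes> b \<in> A (n + m))}"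
        have "f \<otimes> (u \<oplus> v) = f \<otimes> u \<oplus> f \<otimes> v" if "f \<in> F m" for f m
          using u v cF[OF that] cB by (intro r_distr) auto
        thus "u \<oplus> v \<in> {b \<in> B n. \<forall>m. (\<lambda>_. int j) \<le> n + m \<longrightarrow> (\<forall>f\<in>F m. f \<otimes> b \<in> A (n + m))}"
          using u v ideal_add[OF iB] ideal_add[OF iA] by simp }
      fix r assume r: "r \<in> carrier R"
      have "f \<otimes> (r \<otimes> u) = r \<otimes> (f \<otimes> u)" if "f \<in> F m" for f m
        using r u cF[OF that] cB by (intro m_lcomm) auto
      thus "r \<otimes> u \<in> {b \<in> B n. \<forall>m. (\<lambda>_. int j) \<le> n + m \<longrightarrow> (\<forall>f\<in>F m. f \<otimes> b \<in> A (n + m))}"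
        using u r ideal_mult[OF iB] ideal_mult[OF iA] by simp
    qed
  qed (simp add: C_def zeroideal)
  have mC: "C j n \<subseteq> C (Suc j) n" for j n
  proof -
    have "(\<lambda>_. int (Suc j)) \<le> k \<Longrightarrow> (\<lambda>_. int j) \<le> k" for k :: "'c \<Rightarrow> int"
      by (rule order_trans[of _ "\<lambda>_. int (Suc j)"]) (auto simp: le_fun_def)
    thus ?thesis by (auto simp: C_def)
  qed
  have CE: "C j n \<subseteq> E n" for j n
  proof (cases "0 \<le> n")
    case True
    thus ?thesis using BF W(4)[OF True] by (auto simp: C_def)
  next
    case False
    thus ?thesis using ideal_zero[OF W(2)] by (simp add: C_def)
  qed
  have sC: "stable W (C j)" for j
    unfolding stable_def
  proof (intro ballI, goal_cases)
    case (1 p)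
    obtain y a where p: "p = (y, a)" by (cases p)
    have y: "y \<in> F a" "0 \<le> a" using W(3) 1 p by auto
    have "y \<otimes> b \<in> C j (n + a)" if b: "b \<in> C j n" for b n
    proof (cases "0 \<le> n")
      case True
      hence na: "0 \<le> n + a" using y by simp
      have bB: "b \<in> B n" using b True by (simp add: C_def)
      have "y \<otimes> b \<in> B (n + a)" using mult_stableD[OF sB y(1) bB] .
      moreover have "f \<otimes> (y \<otimes> b) \<in> A (n + a + m)" if m: "(\<lambda>_. int j) \<le> n + a + m" and f: "f \<in> F m" for m f
      proof -
        have "f \<otimes> y \<in> F (a + m)" by (rule filtrationD(4)[OF fF f y(1)])
        moreover have "(\<lambda>_. int j) \<le> n + (a + m)" using m by (simp add: add.assoc)
        ultimately have "(f \<otimes> y) \<otimes> b \<in> A (n + (a + m))" using b True by (simp add: C_def)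
        thus ?thesis using cF[OF f] cF[OF y(1)] cB[OF bB] by (simp add: m_assoc add.assoc)
      qed
      ultimately show ?thesis using na by (simp add: C_def)
    next
      case False
      hence "y \<otimes> b = \<zero>" using b cF[OF y(1)] by (simp add: C_def)
      thus ?thesis using ideal_zero[OF iC] by simp
    qed
    thus ?case by (simp add: p)
  qed
  obtain j0 where j0: "\<And>j. j \<ge> j0 \<Longrightarrow> C j = C j0"
    using noeth_famD[where A = C, OF W(1) iC mC CE sC] by blast
  have "B n \<subseteq> A n" if n: "(\<lambda>_. int j0) \<le> n" for n
  proof
    fix b assume b: "b \<in> B n"
    have n0: "0 \<le> n" by (rule order_trans[OF _ n]) (simp add: le_fun_def)
    obtain j1 where j1: "\<forall>j\<ge>j1. n + n1 \<le> (\<lambda>_. int j)" using ex_nat_const_ge by blast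
    \<comment> \<open>By the choice of \<open>j1\<close>, a resulting degree above
      \<open>(j, ..., j)\<close> forces \<open>n1 \<le> m\<close>. This \<open>j\<close> depends on
      \<open>n\<close>; stationarity of \<open>C\<close> replaces it by \<open>j0\<close>.\<close>
    define j where "j = max j0 j1"
    have "n1 \<le> m" if "(\<lambda>_. int j) \<le> n + m" for m
    proof -
      have "n + n1 \<le> n + m" using order_trans[OF j1[rule_format, of j] that] by (simp add: j_def)
      thus ?thesis by simp
    qed
    hence "b \<in> C j n" using b n1 n0 by (simp add: C_def)
    hence "b \<in> C j0 n" using j0[of j] by (simp add: j_def)
    moreover have "\<one> \<in> F 0" using fF by (simp add: filtration_def)
    ultimately have "\<one> \<otimes> b \<in> A (n + 0)" using n0 n unfolding C_def by (metis (no_types, lifting) add.right_neutral mem_Collect_eq)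
    thus "b \<in> A n" using cB[OF b] by simp
  qed
  thus ?thesis by blast
qed

definition reduced_by :: "('a \<times> ('s::finite \<Rightarrow> int)) list \<Rightarrow> (('s \<Rightarrow> int) \<Rightarrow> 'a set) \<Rightarrow> bool" where
  "reduced_by xs F \<longleftrightarrow> (\<exists>n1. \<forall>m\<ge>n1. F m \<subseteq> Idl (\<Union>(x, a)\<in>set xs. {x \<otimes> f | f. f \<in> F (m - a)}))"

lemma mult_stable_lin:
  assumes fF: "filtration F" and sA: "mult_stable F A" and sB: "mult_stable F B"
    and iA: "\<And>n. ideal (A n) R" and iB: "\<And>n. ideal (B n) R" and x: "x \<in> carrier R"
  shows "mult_stable F (\<lambda>n. lin x (A n) (B (n - a)))"
  unfolding mult_stable_def
proof (intro allI ballI)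
  fix m n f b assume f: "f \<in> F m" and b: "b \<in> lin x (A n) (B (n - a))"
  obtain u v where uv: "u \<in> A n" "v \<in> B (n - a)" "b = u \<oplus> x \<otimes> v" using b by (auto simp: lin_def)
  have c: "f \<in> carrier R" "u \<in> carrier R" "v \<in> carrier R"
    using filtrationD(5)[OF fF f] uv ideal.Icarr[OF iA] ideal.Icarr[OF iB] by blast+
  have "f \<otimes> b = f \<otimes> u \<oplus> x \<otimes> (f \<otimes> v)" using uv c x by (simp add: r_distr m_ac)
  moreover have "f \<otimes> u \<in> A (n + m)" using mult_stableD[OF sA f uv(1)] .
  moreover have "f \<otimes> v \<in> B (n + m - a)" using mult_stableD[OF sB f uv(2)] unfolding ab_group_shift(1) .
  ultimately show "f \<otimes> b \<in> lin x (A (n + m)) (B (n + m - a))" by (auto simp: lin_def)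
qed

lemma mult_stable_col:
  assumes fF: "filtration F" and sA: "mult_stable F A" and sB: "mult_stable F B"
    and iB: "\<And>n. ideal (B n) R" and x: "x \<in> carrier R"
  shows "mult_stable F (\<lambda>n. col x (A (n + a)) (B n))"
  unfolding mult_stable_def
proof (intro allI ballI)
  fix m n f b assume f: "f \<in> F m" and b: "b \<in> col x (A (n + a)) (B n)"
  hence b: "b \<in> B n" "x \<otimes> b \<in> A (n + a)" by (auto simp: col_def)
  have c: "f \<in> carrier R" "b \<in> carrier R" using filtrationD(5)[OF fF f] b ideal.Icarr[OF iB] by blast+
  have "x \<otimes> (f \<otimes> b) = f \<otimes> (x \<otimes> b)" using c x by (intro m_lcomm)
  moreover have "f \<otimes> (x \<otimes> b) \<in> A (n + m + a)" using mult_stableD[OF sA f b(2)] unfolding ab_group_shift(2)[of n a m] .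
  ultimately show "f \<otimes> b \<in> col x (A (n + m + a)) (B (n + m))"
    using mult_stableD[OF sB f b(1)] unfolding col_def by simp
qed

text \<open>The graded piece of degree \<open>m\<close> of the Rees algebra lies in the ideal generated by the
  reduction for \<open>m\<close> large, so a finitely generated module killed by the reduction vanishes in
  large degrees.\<close>

lemma chi_eventually_zero:
  assumes F: "noeth_filtration F"
  shows "gens xs \<Longrightarrow> (\<forall>(x, a)\<in>set xs. x \<in> F a) \<Longrightarrow> gens ys \<Longrightarrow> reduced_by (ys @ xs) F \<Longrightarrow>
    (\<And>n. ideal (A n) R) \<Longrightarrow> (\<And>n. ideal (B n) R) \<Longrightarrow> (\<And>n. A n \<subseteq> B n) \<Longrightarrow> (\<And>n. B n \<subseteq> F n) \<Longrightarrow>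
    mult_stable F A \<Longrightarrow> mult_stable F B \<Longrightarrow>
    (\<forall>(y, c)\<in>set ys. \<forall>n. \<forall>b\<in>B n. y \<otimes> b \<in> A (n + c)) \<Longrightarrow>
    \<exists>n2. \<forall>n\<ge>n2. chi xs A B n = 0"
\<comment> \<open>The list \<open>ys\<close> collects the elements already processed, each of which
  kills \<open>B/A\<close> in its degree. When \<open>xs\<close> is exhausted, the whole reduction
  does so.\<close>
proof (induction xs arbitrary: ys A B)
  case Nil
  have fF: "filtration F" using F by (simp add: noeth_filtration_def)
  obtain n1 where n1: "\<And>m. m \<ge> n1 \<Longrightarrow> F m \<subseteq> Idl (\<Union>(x, a)\<in>set ys. {x \<otimes> f | f. f \<in> F (m - a)})"
    using Nil.prems(4) by (auto simp: reduced_by_def)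
  have "f \<otimes> b \<in> A (n + m)" if m: "n1 \<le> m" and f: "f \<in> F m" and b: "b \<in> B n" for m n f b
  proof -
    have bc: "b \<in> carrier R" using b Nil.prems(6) ideal.Icarr by metis
    have "(\<Union>(x, a)\<in>set ys. {x \<otimes> f | f. f \<in> F (m - a)}) \<subseteq> col b (A (n + m)) (carrier R)"
    proof safe
      fix y c g assume y: "(y, c) \<in> set ys" and g: "g \<in> F (m - c)"
      have yc: "y \<in> carrier R" "g \<in> carrier R" using y Nil.prems(3) filtrationD(5)[OF fF g] by (auto simp: gens_def)
      have "g \<otimes> b \<in> B (n + (m - c))" by (rule mult_stableD[OF Nil.prems(10) g b])
      hence "y \<otimes> (g \<otimes> b) \<in> A (n + (m - c) + c)" using Nil.prems(11) y by blast
      hence "y \<otimes> (g \<otimes> b) \<in> A (n + m)" unfolding ab_group_shift(3) .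
      moreover have "b \<otimes> (y \<otimes> g) = y \<otimes> (g \<otimes> b)" using yc bc by (simp add: m_ac)
      ultimately show "y \<otimes> g \<in> col b (A (n + m)) (carrier R)" using yc by (simp add: col_def)
    qed
    hence "Idl (\<Union>(x, a)\<in>set ys. {x \<otimes> f | f. f \<in> F (m - a)}) \<subseteq> col b (A (n + m)) (carrier R)"
      by (intro genideal_minimal col_ideal Nil.prems(5) oneideal bc)
    hence "f \<in> col b (A (n + m)) (carrier R)" using n1[OF m] f by blast
    thus ?thesis using bc by (simp add: col_def m_comm)
  qed
  then obtain n2 where n2: "\<And>n. n \<ge> n2 \<Longrightarrow> B n \<subseteq> A n"
    using eventually_subset[OF F Nil.prems(5-10)] by blast
  have "chi [] A B n = 0" if "n \<ge> n2" for n
  proof -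
    have "A n = B n" using n2[OF that] Nil.prems(7) by blast
    thus ?thesis using len_self[OF Nil.prems(6)] by (simp add: length_int_def zero_enat_def)
  qed
  thus ?case by blast
next
  case (Cons p xs)
  obtain x a where p: "p = (x, a)" by (cases p)
  have fF: "filtration F" using F by (simp add: noeth_filtration_def)
  have x: "x \<in> carrier R" and a: "0 \<le> a" and xs: "gens xs" using Cons.prems(1) by (auto simp: p gens_Cons)
  have xF: "x \<in> F a" "\<forall>(x, a)\<in>set xs. x \<in> F a" using Cons.prems(2) p by auto
  have ys: "gens (ys @ [p])" using Cons.prems(3) x a p by (auto simp: gens_def)
  have r: "reduced_by ((ys @ [p]) @ xs) F" using Cons.prems(4) by simp
  note iA = Cons.prems(5) and iB = Cons.prems(6) and AB = Cons.prems(7) and BF = Cons.prems(8)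
    and sA = Cons.prems(9) and sB = Cons.prems(10)
  have st: "b \<in> A n \<Longrightarrow> x \<otimes> b \<in> A (n + a)" "b \<in> B n \<Longrightarrow> x \<otimes> b \<in> B (n + a)" for b n
    by (fact mult_stableD[OF sA xF(1)] mult_stableD[OF sB xF(1)])+
  have "\<exists>n2. \<forall>n\<ge>n2. chi xs (\<lambda>m. lin x (A m) (B (m - a))) B n = 0"
  proof (rule Cons.IH[OF xs xF(2) ys r _ iB _ BF mult_stable_lin[OF fF sA sB iA iB x] sB])
    show "ideal (lin x (A n) (B (n - a))) R" for n by (intro lin_ideal iA iB x)
    show "lin x (A n) (B (n - a)) \<subseteq> B n" for n using AB st(2)[of _ "n - a"] by (intro lin_least iB) auto
    show "\<forall>(y, c)\<in>set (ys @ [p]). \<forall>n. \<forall>b\<in>B n. y \<otimes> b \<in> lin x (A (n + c)) (B (n + c - a))"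
    proof safe
      fix y c n b assume y: "(y, c) \<in> set (ys @ [p])" and b: "b \<in> B n"
      show "y \<otimes> b \<in> lin x (A (n + c)) (B (n + c - a))"
      proof (cases "(y, c) = p")
        case True
        thus ?thesis using lin_upper2[OF iA iB x, of b] b p by simp
      next
        case False
        hence "y \<otimes> b \<in> A (n + c)" using Cons.prems(11) y b by auto
        thus ?thesis using lin_upper1[OF iA iB x] by blast
      qed
    qed
  qed
  then obtain n2 where n2: "\<And>n. n \<ge> n2 \<Longrightarrow> chi xs (\<lambda>m. lin x (A m) (B (m - a))) B n = 0" by blast
  have cB: "col x (A (n + a)) (B n) \<subseteq> B n" for n by (auto simp: col_def)
  have "\<exists>n2. \<forall>n\<ge>n2. chi xs A (\<lambda>m. col x (A (m + a)) (B m)) n = 0"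
  proof (rule Cons.IH[OF xs xF(2) ys r iA _ _ order_trans[OF cB BF] sA mult_stable_col[OF fF sA sB iB x]])
    show "ideal (col x (A (n + a)) (B n)) R" for n by (intro col_ideal iA iB x)
    show "A n \<subseteq> col x (A (n + a)) (B n)" for n using st(1) subsetD[OF AB] by (auto simp: col_def)
    show "\<forall>(y, c)\<in>set (ys @ [p]). \<forall>n. \<forall>b\<in>col x (A (n + a)) (B n). y \<otimes> b \<in> A (n + c)"
      using Cons.prems(11) p by (auto simp: col_def)
  qed
  then obtain n3 where n3: "\<And>n. n \<ge> n3 \<Longrightarrow> chi xs A (\<lambda>m. col x (A (m + a)) (B m)) n = 0" by blast
  have "chi (p # xs) A B n = 0" if "n \<ge> sup n2 (n3 + a)" for n
  proof -
    have "n \<ge> n2" "n3 + a \<le> n" using that by auto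
    hence "n \<ge> n2" "n - a \<ge> n3" by (auto simp: le_diff_eq)
    thus ?thesis using n2 n3 p by simp
  qed
  thus ?case by blast
qed

text \<open>Additivity splits the symbol of \<open>R\<close> along \<open>F\<close>. The part
  \<open>F/0\<close> vanishes in large degrees because \<open>xs\<close> is a reduction, and the
  part \<open>R/F\<close> has finite lengths, where the symbol is the iterated difference.\<close>

theorem iter_diff_length_eq_chi:
  assumes F: "noeth_filtration F" and xs: "gens xs" "\<forall>(x, a)\<in>set xs. x \<in> F a" and r: "reduced_by xs F"
    and fin: "fin_colength (fst ` set xs)" "\<And>n. len (F n) (carrier R) \<noteq> \<infinity>"
  shows "\<exists>n2. \<forall>n\<ge>n2. iter_diff (map snd xs) (\<lambda>n. length_int (F n) (carrier R)) n
     = chi xs (\<lambda>_. {\<zero>}) (\<lambda>_. carrier R) n"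
proof -
  have fF: "filtration F" using F by (simp add: noeth_filtration_def)
  have xc: "x \<in> carrier R" if "(x, a) \<in> set xs" for x a using xs(1) that by (auto simp: gens_def)
  have f0: "fam xs (\<lambda>_. {\<zero>})" using zeroideal xc by (auto simp: fam_def)
  have f1: "fam xs (\<lambda>_. carrier R)" using oneideal xc by (auto simp: fam_def)
  have f2: "fam xs F" unfolding fam_def
    using filtrationD(1,2)[OF fF] xs(2) filtrationD(4)[OF fF] by blast
  have adm: "adm xs (\<lambda>_. {\<zero>}) (\<lambda>_. carrier R)"
    unfolding adm_def using f0 f1 fin(1) by (auto intro!: exI[of _ "{}"])
  have s: "{\<zero>} \<subseteq> F n" "F n \<subseteq> carrier R" for n
    using ideal_zero[OF filtrationD(1)[OF fF]] filtrationD(5)[OF fF] by auto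
  have "\<exists>n2. \<forall>n\<ge>n2. chi xs (\<lambda>_. {\<zero>}) F n = 0"
  proof (rule chi_eventually_zero[OF F xs, of "[]"])
    show "mult_stable F F" unfolding mult_stable_def using filtrationD(4)[OF fF] by blast
    show "mult_stable F (\<lambda>_. {\<zero>})" unfolding mult_stable_def using filtrationD(5)[OF fF] by auto
  qed (use r zeroideal filtrationD(1)[OF fF] s in \<open>auto simp: gens_def\<close>)
  then obtain n2 where n2: "\<And>n. n \<ge> n2 \<Longrightarrow> chi xs (\<lambda>_. {\<zero>}) F n = 0" by blast
  have "chi xs (\<lambda>_. {\<zero>}) (\<lambda>_. carrier R) n = chi xs (\<lambda>_. {\<zero>}) F n + chi xs F (\<lambda>_. carrier R) n" for n
    by (rule chi_add[OF xs(1) adm f2 s])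
  moreover have "chi xs F (\<lambda>_. carrier R) n = iter_diff (map snd xs) (\<lambda>n. length_int (F n) (carrier R)) n" for n
    by (rule chi_eq_iter_diff[OF xs(1) f2 f1 s(2) fin(2)])
  ultimately show ?thesis using n2 by (intro exI[of _ n2]) simp
qed

end

section \<open>Powers of ideals\<close>

context cring
begin

abbreviation ipow :: "'a set \<Rightarrow> nat \<Rightarrow> 'a set" where "ipow I n \<equiv> I [^]\<^bsub>ideals_set R\<^esub> n"

lemma ideals_set_simps [simp]:
  "I \<in> carrier (ideals_set R) \<longleftrightarrow> ideal I R" "I \<otimes>\<^bsub>ideals_set R\<^esub> J = I \<cdot> J" "\<one>\<^bsub>ideals_set R\<^esub> = carrier R"
  by (simp_all add: ideals_set_def)

lemmas ideals_set_comm_monoid = ideals_set_is_comm_monoid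
lemmas ideals_set_monoid = comm_monoid.axioms(1)[OF ideals_set_is_comm_monoid]

lemma prod_least:
  assumes "ideal K R" "\<And>a b. a \<in> A \<Longrightarrow> b \<in> B \<Longrightarrow> a \<otimes> b \<in> K"
  shows "A \<cdot> B \<subseteq> K"
proof
  fix s assume "s \<in> A \<cdot> B"
  thus "s \<in> K" by (induction s rule: ideal_prod.induct) (use assms ideal_add in auto)
qed

lemma prod_mono:
  assumes "A \<subseteq> A'" "B \<subseteq> B'"
  shows "A \<cdot> B \<subseteq> A' \<cdot> B'"
proof
  fix s assume "s \<in> A \<cdot> B"
  thus "s \<in> A' \<cdot> B'"
    by (induction s rule: ideal_prod.induct) (use assms in \<open>auto intro: ideal_prod.intros\<close>)
qed

lemma prod_subset:
  assumes "ideal A R" "ideal B R"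
  shows "A \<cdot> B \<subseteq> A" "A \<cdot> B \<subseteq> B"
  using ideal_prod_inter[OF assms] by auto

lemma ipow_ideal: "ideal I R \<Longrightarrow> ideal (ipow I n) R"
  using monoid.nat_pow_closed[OF ideals_set_monoid, of I n] by simp

lemma ipow_0: "ipow I 0 = carrier R"
  using monoid.nat_pow_0[OF ideals_set_monoid] by simp

lemma ipow_Suc: "ipow I (Suc n) = ipow I n \<cdot> I"
  using monoid.nat_pow_Suc[OF ideals_set_monoid] by simp

lemma carrier_prod: "ideal I R \<Longrightarrow> carrier R \<cdot> I = I"
  using ideal_prod_one ideal_prod_commute oneideal by metis

lemma ipow_1: "ideal I R \<Longrightarrow> ipow I (Suc 0) = I"
  by (simp add: ipow_Suc ipow_0 carrier_prod)

lemma ipow_add: "ideal I R \<Longrightarrow> ipow I m \<cdot> ipow I n = ipow I (m + n)"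
  using monoid.nat_pow_mult[OF ideals_set_monoid, of I m n] by simp

lemma ipow_ipow: "ideal I R \<Longrightarrow> ipow (ipow I m) n = ipow I (m * n)"
  using monoid.nat_pow_pow[OF ideals_set_monoid, of I m n] by simp

lemma ipow_mono: "I \<subseteq> J \<Longrightarrow> ipow I n \<subseteq> ipow J n"
  by (induction n) (simp_all add: ipow_0 ipow_Suc prod_mono)

lemma ipow_antimono:
  assumes "ideal I R" "m \<le> n"
  shows "ipow I n \<subseteq> ipow I m"
proof -
  have "ipow I n = ipow I m \<cdot> ipow I (n - m)" using ipow_add[OF assms(1), of m "n - m"] assms(2) by simp
  thus ?thesis using prod_subset ipow_ideal assms(1) by simp
qed

lemma pow_mem_ipow: "x \<in> I \<Longrightarrow> ideal I R \<Longrightarrow> x [^] n \<in> ipow I n"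
  by (induction n) (auto simp: ipow_0 ipow_Suc intro: ideal_prod.prod)

lemma Idl_insert:
  assumes "S \<subseteq> carrier R" "z \<in> carrier R"
  shows "Idl (insert z S) = lin z (Idl S) (carrier R)"
proof
  have i: "ideal (Idl S) R" using assms genideal_ideal by blast
  have S: "S \<subseteq> Idl S" using assms genideal_self by blast
  show "Idl (insert z S) \<subseteq> lin z (Idl S) (carrier R)"
  proof (rule genideal_minimal)
    show "ideal (lin z (Idl S) (carrier R)) R" using i assms oneideal lin_ideal by blast
    have "z \<in> lin z (Idl S) (carrier R)" using lin_upper2[OF i oneideal assms(2) one_closed] assms(2) by simp
    thus "insert z S \<subseteq> lin z (Idl S) (carrier R)"
      using S lin_upper1[OF i oneideal assms(2)] by blast
  qed
  have j: "ideal (Idl (insert z S)) R" using assms genideal_ideal by blast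
  have z: "z \<in> Idl (insert z S)" "Idl S \<subseteq> Idl (insert z S)"
    using assms genideal_self[of "insert z S"] subset_Idl_subset[of "insert z S" S] by auto
  show "lin z (Idl S) (carrier R) \<subseteq> Idl (insert z S)"
    by (rule lin_least[OF j z(2)]) (use j z(1) assms(2) in \<open>auto simp: m_comm[of z] ideal_mult\<close>)
qed

end

section \<open>Colengths of powers of an ideal with \<open>d\<close> generators\<close>

context noetherian_cring
begin

text \<open>Filter by the ideals \<open>K + z^i R\<close>: each of the \<open>N\<close> factors is
  cyclic and killed by \<open>K + zR\<close>.\<close>

lemma len_lin_pow_le:
  assumes K: "ideal K R" and z: "z \<in> carrier R"
  shows "len (lin (z [^] N) K (carrier R)) (carrier R) \<le> of_nat N * len (lin z K (carrier R)) (carrier R)"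
proof (induction N)
  case 0
  have "lin (z [^] (0::nat)) K (carrier R) = carrier R"
  proof
    show "lin (z [^] (0::nat)) K (carrier R) \<subseteq> carrier R"
      by (rule lin_least[OF oneideal]) (use K ideal_subset_carrier in auto)
    show "carrier R \<subseteq> lin (z [^] (0::nat)) K (carrier R)"
      using lin_upper2[OF K oneideal one_closed] by auto
  qed
  thus ?case using len_self[OF oneideal] by simp
next
  case (Suc N)
  define L where "L = lin (z [^] Suc N) K (carrier R)"
  define M where "M = lin (z [^] N) K (carrier R)"
  have iL: "ideal L R" and iM: "ideal M R" unfolding L_def M_def using K z oneideal by (auto intro: lin_ideal)
  have KL: "K \<subseteq> L" and KM: "K \<subseteq> M" unfolding L_def M_def
    using lin_upper1[OF K oneideal nat_pow_closed[OF z]] by blast+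
  have zL: "z [^] Suc N \<otimes> r \<in> L" if "r \<in> carrier R" for r
    unfolding L_def using lin_upper2[OF K oneideal _ that] z by auto
  have zM: "z [^] N \<otimes> r \<in> M" if "r \<in> carrier R" for r
    unfolding M_def using lin_upper2[OF K oneideal _ that] z by auto
  have LM: "L \<subseteq> M"
  proof -
    have "z [^] Suc N \<otimes> r \<in> M" if "r \<in> carrier R" for r
      using zM[of "z \<otimes> r"] z that by (simp add: m_assoc)
    thus ?thesis unfolding L_def using KM by (intro lin_least[OF iM])
  qed
  have Mc: "M \<subseteq> carrier R" by (rule ideal_subset_carrier[OF iM])
  have M: "M = lin (z [^] N) L (carrier R)"
  proof
    show "M \<subseteq> lin (z [^] N) L (carrier R)" unfolding M_def lin_def using KL by blast
    show "lin (z [^] N) L (carrier R) \<subseteq> M" using zM by (intro lin_least[OF iM LM])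
  qed
  have i1: "ideal (col (z [^] N) L (carrier R)) R" using iL z oneideal by (intro col_ideal) auto
  have "lin z K (carrier R) \<subseteq> col (z [^] N) L (carrier R)"
  proof (rule lin_least[OF i1])
    show "K \<subseteq> col (z [^] N) L (carrier R)"
      using K z KL ideal_mult[OF K] ideal.Icarr[OF K] by (auto simp: col_def)
    fix b assume "b \<in> carrier R"
    thus "z \<otimes> b \<in> col (z [^] N) L (carrier R)" using zL[of b] z by (simp add: col_def m_assoc)
  qed
  hence 1: "len (col (z [^] N) L (carrier R)) (carrier R) \<le> len (lin z K (carrier R)) (carrier R)"
    using i1 K z oneideal by (intro len_carrier_antimono) (auto intro: lin_ideal)
  have "len L (carrier R) = len L M + len M (carrier R)" by (rule len_add[OF iL iM oneideal LM Mc])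
  also have "len L M = len (col (z [^] N) L (carrier R)) (carrier R)"
    unfolding M using iL z by (intro len_principal_step) auto
  also have "\<dots> + len M (carrier R) \<le> len (lin z K (carrier R)) (carrier R) + of_nat N * len (lin z K (carrier R)) (carrier R)"
    using 1 Suc.IH unfolding M_def by (intro add_mono)
  also have "\<dots> = of_nat (Suc N) * len (lin z K (carrier R)) (carrier R)" by (simp add: distrib_right)
  finally show ?case unfolding L_def .
qed

text \<open>Generators are replaced by their powers one at a time; each replacement costs a factor
  \<open>N\<close> at most.\<close>

lemma len_Idl_powers_le:
  assumes "finite Z" "Z \<subseteq> carrier R" "S \<subseteq> carrier R"
  shows "len (Idl (S \<union> (\<lambda>z. z [^] (N::nat)) ` Z)) (carrier R) \<le> of_nat (N ^ card Z) * len (Idl (S \<union> Z)) (carrier R)"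
  using assms
proof (induction Z arbitrary: S rule: finite_induct)
  case (insert z Z)
  have z: "z \<in> carrier R" and Z: "Z \<subseteq> carrier R" and S: "insert (z [^] N) S \<subseteq> carrier R" using insert.prems by auto
  have SZ: "S \<union> Z \<subseteq> carrier R" using insert.prems by auto
  have "len (Idl (S \<union> (\<lambda>z. z [^] N) ` insert z Z)) (carrier R)
     \<le> of_nat (N ^ card Z) * len (Idl (insert (z [^] N) S \<union> Z)) (carrier R)"
    using insert.IH[OF Z S] by simp
  also have "Idl (insert (z [^] N) S \<union> Z) = lin (z [^] N) (Idl (S \<union> Z)) (carrier R)"
    using Idl_insert[OF SZ, of "z [^] N"] z by simp
  also have "of_nat (N ^ card Z) * len \<dots> (carrier R)
     \<le> of_nat (N ^ card Z) * (of_nat N * len (lin z (Idl (S \<union> Z)) (carrier R)) (carrier R))"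
    using z genideal_ideal[OF SZ] by (intro mult_left_mono len_lin_pow_le) auto
  also have "lin z (Idl (S \<union> Z)) (carrier R) = Idl (S \<union> insert z Z)"
    using Idl_insert[OF SZ z] by simp
  finally show ?case using insert.hyps by (simp add: mult_ac)
qed simp

text \<open>With \<open>E = Q\<close> to the power \<open>N + 1\<close>, multiplication by \<open>x\<close> on the finite length modules \<open>A/E\<close>
  and \<open>R/E\<close> has kernel and cokernel of equal length, and the kernel on \<open>A/E\<close> is the smaller one.\<close>

lemma len_prod_le:
  assumes Q: "ideal Q R" and x: "x \<in> Q" and A: "ideal A R" "ipow Q N \<subseteq> A"
    and fin: "len (ipow Q (Suc N)) (carrier R) \<noteq> \<infinity>"
  shows "len (Q \<cdot> A) A \<le> len (lin x (ipow Q (Suc N)) (carrier R)) (carrier R)"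
proof -
  define E where "E = ipow Q (Suc N)"
  have iE: "ideal E R" unfolding E_def using ipow_ideal Q by blast
  have xc: "x \<in> carrier R" using x Q ideal.Icarr by metis
  have iQA: "ideal (Q \<cdot> A) R" using Q A ideal_prod_is_ideal by blast
  have QAA: "Q \<cdot> A \<subseteq> A" using prod_subset Q A by blast
  have E1: "E \<subseteq> Q \<cdot> A" unfolding E_def ipow_Suc
    using prod_mono[OF A(2) subset_refl, of Q] ideal_prod_commute[OF Q A(1)] by simp
  have EA: "E \<subseteq> A" using E1 QAA by blast
  have Ac: "A \<subseteq> carrier R" "E \<subseteq> carrier R" using A iE ideal_subset_carrier by auto
  have eq: "len (lin x E B) B = len E (col x E B)"
    if B: "ideal B R" "E \<subseteq> B" "\<And>b. b \<in> B \<Longrightarrow> x \<otimes> b \<in> B" for B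
  proof -
    have i: "ideal (lin x E B) R" "ideal (col x E B) R"
      using iE B xc by (auto intro: lin_ideal col_ideal)
    have s: "E \<subseteq> lin x E B" "lin x E B \<subseteq> B" "E \<subseteq> col x E B" "col x E B \<subseteq> B"
      using lin_upper1[OF iE B(1) xc] lin_least[OF B(1,2,3)] B(2) ideal_mult[OF iE] xc by (auto simp: col_def)
    have "len E B \<noteq> \<infinity>"
      using lens_finite(1)[OF iE B(1) oneideal B(2) ideal_subset_carrier[OF B(1)]] fin E_def by blast
    moreover have "len E B = len E (lin x E B) + len (lin x E B) B" using len_add i iE B s by blast
    moreover have "len E B = len E (col x E B) + len (col x E B) B" using len_add i iE B s by blast
    moreover have "len E (lin x E B) = len (col x E B) B"
      by (rule len_iso[symmetric]) (use i iE B xc in auto)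
    ultimately show ?thesis
      by (cases "len E (col x E B)"; cases "len (col x E B) B"; cases "len (lin x E B) B") auto
  qed
  have iD: "ideal (lin x E A) R" "ideal (col x E A) R" "ideal (col x E (carrier R)) R"
    using iE A xc oneideal by (auto intro: lin_ideal col_ideal)
  have "lin x E A \<subseteq> Q \<cdot> A"
    using x by (intro lin_least[OF iQA E1]) (auto intro: ideal_prod.prod)
  hence "len (Q \<cdot> A) A \<le> len (lin x E A) A" using len_add[OF iD(1) iQA A(1) _ QAA] by simp
  also have "\<dots> = len E (col x E A)"
    by (rule eq[OF A(1) EA]) (use A(1) xc in \<open>auto intro: ideal_mult\<close>)
  also have "\<dots> \<le> len E (col x E (carrier R))"
  proof -
    have "col x E A \<subseteq> col x E (carrier R)" "E \<subseteq> col x E A"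
      using Ac EA ideal_mult[OF iE] xc by (auto simp: col_def)
    thus ?thesis using len_add[OF iE iD(2,3)] by simp
  qed
  also have "\<dots> = len (lin x E (carrier R)) (carrier R)"
    by (rule eq[symmetric, OF oneideal Ac(2)]) (use xc in auto)
  finally show ?thesis unfolding E_def .
qed

lemma of_nat_enat_mono: "a \<le> b \<Longrightarrow> of_nat a * (c::enat) \<le> of_nat b * c"
  by (intro mult_right_mono) auto

context
  fixes xs :: "'a list" and Q :: "'a set" and d :: nat
  assumes xs: "set xs \<subseteq> carrier R" and Q_def: "Q = Idl (set xs)" and d: "d = length xs"
    and finQ: "len Q (carrier R) \<noteq> \<infinity>"
begin

lemma Q_ideal: "ideal Q R" unfolding Q_def using xs genideal_ideal by blast

text \<open>\<open>Q^N\<close> contains the \<open>N\<close>-th powers of the \<open>d\<close>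
  generators, so its colength grows at most like \<open>N^d\<close>.\<close>

lemma len_ipow_le: 
  assumes "N \<ge> 1"
  shows "len (ipow Q N) (carrier R) \<le> of_nat (N ^ d) * len Q (carrier R)"
proof -
  have "(\<lambda>z. z [^] N) ` set xs \<subseteq> ipow Q N"
    using pow_mem_ipow[OF _ Q_ideal] genideal_self[OF xs] unfolding Q_def by blast
  hence "Idl ({} \<union> (\<lambda>z. z [^] N) ` set xs) \<subseteq> ipow Q N"
    by (intro genideal_minimal ipow_ideal Q_ideal) simp
  hence "len (ipow Q N) (carrier R) \<le> len (Idl ({} \<union> (\<lambda>z. z [^] N) ` set xs)) (carrier R)"
    by (intro len_carrier_antimono ipow_ideal Q_ideal genideal_ideal) (use xs in auto)
  also have "\<dots> \<le> of_nat (N ^ card (set xs)) * len (Idl ({} \<union> set xs)) (carrier R)"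
    by (rule len_Idl_powers_le) (use xs in auto)
  also have "\<dots> \<le> of_nat (N ^ d) * len Q (carrier R)" unfolding Q_def
    using assms card_length[of xs] d by (simp only: Un_empty_left) (intro of_nat_enat_mono power_increasing, auto)
  finally show ?thesis .
qed

lemma len_ipow_finite: "len (ipow Q N) (carrier R) \<noteq> \<infinity>"
proof (cases "N = 0")
  case True
  thus ?thesis using len_self[OF oneideal] by (simp add: ipow_0)
next
  case False
  obtain q where "len Q (carrier R) = enat q" using finQ by auto
  hence "len (ipow Q N) (carrier R) \<le> enat (N ^ d * q)"
    using len_ipow_le[of N] False by (simp add: of_nat_eq_enat)
  thus ?thesis by (cases "len (ipow Q N) (carrier R)") auto
qed

text \<open>One generator \<open>x\<close> serves for the comparison with the colength of
  \<open>Q^(N+1) + xR\<close>. That ideal contains \<open>x\<close> and the powers of the other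
  \<open>d - 1\<close> generators, whence the exponent \<open>d - 1\<close>.\<close>

lemma len_Q_prod_le:
  assumes A: "ideal A R" "ipow Q N \<subseteq> A" and d1: "d \<ge> 1"
  shows "len (Q \<cdot> A) A \<le> of_nat ((N + 1) ^ (d - 1)) * len Q (carrier R)"
proof -
  obtain x zs where x: "xs = x # zs" using d d1 by (cases xs) auto
  have xQ: "x \<in> Q" using x xs genideal_self[OF xs] by (auto simp: Q_def)
  have c: "x \<in> carrier R" "set zs \<subseteq> carrier R" using x xs by auto
  have i: "ideal (ipow Q (Suc N)) R" by (rule ipow_ideal[OF Q_ideal])
  have "len (Q \<cdot> A) A \<le> len (lin x (ipow Q (Suc N)) (carrier R)) (carrier R)"
    by (rule len_prod_le[OF Q_ideal xQ A len_ipow_finite])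
  also have "\<dots> \<le> len (Idl ({x} \<union> (\<lambda>z. z [^] Suc N) ` set zs)) (carrier R)"
  proof (intro len_carrier_antimono genideal_ideal)
    show "{x} \<union> (\<lambda>z. z [^] Suc N) ` set zs \<subseteq> carrier R" using c by auto
    show il: "ideal (lin x (ipow Q (Suc N)) (carrier R)) R" using i c oneideal by (intro lin_ideal)
    have "z [^] Suc N \<in> ipow Q (Suc N)" if "z \<in> set zs" for z
    proof (rule pow_mem_ipow[OF _ Q_ideal])
      show "z \<in> Q" using genideal_self[OF xs] that x unfolding Q_def by auto
    qed
    hence "(\<lambda>z. z [^] Suc N) ` set zs \<subseteq> lin x (ipow Q (Suc N)) (carrier R)"
      using lin_upper1[OF i oneideal c(1)] by blast
    moreover have "x \<in> lin x (ipow Q (Suc N)) (carrier R)"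
      using lin_upper2[OF i oneideal c(1) one_closed] c by simp
    ultimately show "Idl ({x} \<union> (\<lambda>z. z [^] Suc N) ` set zs) \<subseteq> lin x (ipow Q (Suc N)) (carrier R)"
      by (intro genideal_minimal[OF il]) blast
  qed
  also have "\<dots> \<le> of_nat (Suc N ^ card (set zs)) * len (Idl ({x} \<union> set zs)) (carrier R)"
    by (rule len_Idl_powers_le) (use c in auto)
  also have "\<dots> = of_nat (Suc N ^ card (set zs)) * len Q (carrier R)" by (simp add: Q_def x)
  also have "\<dots> \<le> of_nat ((N + 1) ^ (d - 1)) * len Q (carrier R)"
  proof (rule of_nat_enat_mono)
    have "card (set zs) \<le> d - 1" using card_length[of zs] d x by simp
    thus "Suc N ^ card (set zs) \<le> (N + 1) ^ (d - 1)" by (simp add: power_increasing)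
  qed
  finally show ?thesis .
qed

text \<open>Telescoping over the \<open>b\<close> factors \<open>Q\<close>, where after
  \<open>b\<close> steps the ideal still contains \<open>Q^(N+b)\<close>. For fixed \<open>b\<close>
  the extra length is \<open>O(N^(d-1))\<close>: a bounded perturbation of the exponent is invisible
  in the leading term of degree \<open>d\<close>.\<close>

lemma len_ipow_prod_le:
  assumes A: "ideal A R" "ipow Q N \<subseteq> A" and d1: "d \<ge> 1"
  shows "len (ipow Q b \<cdot> A) A \<le> of_nat (b * (N + b) ^ (d - 1)) * len Q (carrier R)"
proof (induction b)
  case 0
  thus ?case using len_self[OF A(1)] by (simp add: ipow_0 carrier_prod[OF A(1)])
next
  case (Suc b)
  define B where "B = ipow Q b \<cdot> A"
  have iB: "ideal B R" unfolding B_def using ipow_ideal Q_ideal A ideal_prod_is_ideal by blast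
  have BA: "B \<subseteq> A" unfolding B_def using prod_subset ipow_ideal Q_ideal A by blast
  have e: "ipow Q (Suc b) \<cdot> A = Q \<cdot> B"
  proof -
    have "ipow Q (Suc b) = Q \<cdot> ipow Q b" unfolding ipow_Suc using ideal_prod_commute ipow_ideal Q_ideal by blast
    thus ?thesis unfolding B_def using ideal_prod_assoc ipow_ideal Q_ideal A by simp
  qed
  have "ipow Q (N + b) \<subseteq> B"
    unfolding B_def ipow_add[OF Q_ideal, of b N, unfolded add.commute[of b N], symmetric]
    using A(2) by (intro prod_mono) auto
  hence 1: "len (Q \<cdot> B) B \<le> of_nat ((N + b + 1) ^ (d - 1)) * len Q (carrier R)"
    by (rule len_Q_prod_le[OF iB _ d1])
  have "len (ipow Q (Suc b) \<cdot> A) A = len (Q \<cdot> B) B + len B A" unfolding e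
    using len_add[OF ideal_prod_is_ideal[OF Q_ideal iB] iB A(1) prod_subset(2)[OF Q_ideal iB] BA] .
  also have "\<dots> \<le> of_nat ((N + b + 1) ^ (d - 1)) * len Q (carrier R) + of_nat (b * (N + b) ^ (d - 1)) * len Q (carrier R)"
    using 1 Suc.IH unfolding B_def by (intro add_mono)
  also have "\<dots> = of_nat ((N + b + 1) ^ (d - 1) + b * (N + b) ^ (d - 1)) * len Q (carrier R)"
    by (simp add: distrib_right)
  also have "\<dots> \<le> of_nat (Suc b * (N + Suc b) ^ (d - 1)) * len Q (carrier R)"
  proof (rule of_nat_enat_mono)
    have "b * (N + b) ^ (d - 1) \<le> b * (N + Suc b) ^ (d - 1)" by (intro mult_left_mono power_mono) auto
    thus "(N + b + 1) ^ (d - 1) + b * (N + b) ^ (d - 1) \<le> Suc b * (N + Suc b) ^ (d - 1)" by simp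
  qed
  finally show ?case .
qed

text \<open>The Noetherian induction of \<open>finite_len_of_nilpotent\<close> again, now combined
  through \<open>(K + zR)(K : z) \<subseteq> K\<close>, so that the exponents for the two larger
  ideals add up.\<close>

lemma ipow_subset_of_nilpotent:
  assumes "ideal J R" "\<And>x. x \<in> set xs \<Longrightarrow> \<exists>k::nat. x [^] k \<in> J"
  shows "\<exists>q. ipow Q q \<subseteq> J"
proof -
  have "(\<forall>x\<in>set xs. \<exists>k::nat. x [^] k \<in> J) \<longrightarrow> (\<exists>q. ipow Q q \<subseteq> J)"
    using assms(1)
  proof (induction J rule: noetherian_induct)
    case (step K)
    note K = step.hyps
    show ?case
    proof
      assume nil: "\<forall>x\<in>set xs. \<exists>k::nat. x [^] k \<in> K"
      have IH: "\<exists>q. ipow Q q \<subseteq> K'" if "ideal K' R" "K \<subset> K'" for K'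
        using step.IH[OF that] nil that by blast
      show "\<exists>q. ipow Q q \<subseteq> K"
      proof (cases "set xs \<subseteq> K")
        case True
        hence "Q \<subseteq> K" unfolding Q_def by (rule genideal_minimal[OF K])
        thus ?thesis using ipow_1[OF Q_ideal] by metis
      next
        case False
        then obtain y where y: "y \<in> set xs" "y \<notin> K" by blast
        have yc: "y \<in> carrier R" using y xs by blast
        define k where "k = (LEAST k::nat. y [^] k \<in> K)"
        have k: "y [^] k \<in> K" unfolding k_def using nil y by (metis LeastI)
        have "k \<noteq> 0"
        proof
          assume "k = 0"
          hence "\<one> \<in> K" using k by simp
          hence "K = carrier R" using ideal.one_imp_carrier K by blast
          thus False using y yc by simp
        qed
        then obtain j where j: "k = Suc j" by (cases k) auto
        define z where "z = y [^] j"
        have z: "z \<notin> K" unfolding z_def using not_less_Least[of j "\<lambda>k. y [^] k \<in> K"] j k_def by simp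
        have zc: "z \<in> carrier R" using yc by (simp add: z_def)
        have i1: "ideal (lin z K (carrier R)) R" "ideal (col z K (carrier R)) R"
          using K zc oneideal by (auto intro: lin_ideal col_ideal)
        have s1: "K \<subset> lin z K (carrier R)"
          using lin_upper1[OF K oneideal zc] lin_upper2[OF K oneideal zc, of \<one>] z zc by auto
        have "K \<subseteq> col z K (carrier R)"
          using K zc by (auto simp: col_def ideal.Icarr ideal_mult)
        moreover have "y \<in> col z K (carrier R)" using k j yc by (simp add: col_def z_def)
        ultimately have s2: "K \<subset> col z K (carrier R)" using y by auto
        obtain p q where pq: "ipow Q p \<subseteq> lin z K (carrier R)" "ipow Q q \<subseteq> col z K (carrier R)"
          using IH[OF i1(1) s1] IH[OF i1(2) s2] by blast
        have "ipow Q p \<cdot> ipow Q q \<subseteq> K"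
        proof (rule prod_least[OF K])
          fix a b assume "a \<in> ipow Q p" "b \<in> ipow Q q"
          then obtain u r where ur: "u \<in> K" "r \<in> carrier R" "a = u \<oplus> z \<otimes> r" and b: "b \<in> carrier R" "z \<otimes> b \<in> K"
            using pq by (auto simp: lin_def col_def dest!: subsetD)
          have uc: "u \<in> carrier R" using ur K ideal.Icarr by metis
          have "a \<otimes> b = b \<otimes> u \<oplus> r \<otimes> (z \<otimes> b)" unfolding ur(3) using uc ur(2) b(1) zc by algebra
          thus "a \<otimes> b \<in> K" using ideal_add[OF K ideal_mult[OF K ur(1) b(1)] ideal_mult[OF K b(2) ur(2)]] by simp
        qed
        thus ?thesis using ipow_add[OF Q_ideal] by metis
      qed
    qed
  qed
  thus ?thesis using assms(2) by blast
qed

end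

end

section \<open>The filtration of a tuple of ideals\<close>

context cring
begin

abbreviation iprod :: "('i \<Rightarrow> 'a set) \<Rightarrow> 'i set \<Rightarrow> 'a set" where
  "iprod f S \<equiv> finprod (ideals_set R) f S"

lemma iprod_empty: "iprod f {} = carrier R"
  using comm_monoid.finprod_empty[OF ideals_set_comm_monoid, of f] by simp

lemma iprod_insert:
  "finite S \<Longrightarrow> i \<notin> S \<Longrightarrow> (\<And>j. ideal (f j) R) \<Longrightarrow> iprod f (insert i S) = f i \<cdot> iprod f S"
  using comm_monoid.finprod_insert[OF ideals_set_comm_monoid, of S i f] by simp

lemma iprod_ideal: "(\<And>j. ideal (f j) R) \<Longrightarrow> ideal (iprod f S) R"
  using comm_monoid.finprod_closed[OF ideals_set_comm_monoid, of f S] by auto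

lemma iprod_mult:
  "(\<And>j. ideal (f j) R) \<Longrightarrow> (\<And>j. ideal (g j) R) \<Longrightarrow> iprod f S \<cdot> iprod g S = iprod (\<lambda>j. f j \<cdot> g j) S"
  using comm_monoid.finprod_multf[OF ideals_set_comm_monoid, of f S g] by simp

lemma iprod_mono:
  assumes "finite S" "\<And>j. ideal (f j) R" "\<And>j. ideal (g j) R" "\<And>j. f j \<subseteq> g j"
  shows "iprod f S \<subseteq> iprod g S"
  using assms(1) by (induction S rule: finite_induct) (simp_all add: iprod_empty iprod_insert assms prod_mono)

lemma iprod_ipow:
  assumes "\<And>j. ideal (f j) R"
  shows "ipow (iprod f S) k = iprod (\<lambda>j. ipow (f j) k) S"
proof (induction k)
  case 0
  have "iprod (\<lambda>_. \<one>\<^bsub>ideals_set R\<^esub>) S = \<one>\<^bsub>ideals_set R\<^esub>"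
    by (rule comm_monoid.finprod_one_eqI[OF ideals_set_comm_monoid]) simp
  thus ?case by (simp add: ipow_0)
next
  case (Suc k)
  show ?case unfolding ipow_Suc Suc.IH by (rule iprod_mult) (use assms ipow_ideal in auto)
qed

lemma iprod_graded_subset:
  fixes P :: "'g::ab_group_add \<Rightarrow> 'a set"
  assumes P: "\<And>n. ideal (P n) R" "P 0 = carrier R" "\<And>m n f b. f \<in> P m \<Longrightarrow> b \<in> P n \<Longrightarrow> f \<otimes> b \<in> P (m + n)"
    and f: "\<And>j. ideal (f j) R" "\<And>j. f j \<subseteq> P (b j)" and S: "finite S"
  shows "iprod f S \<subseteq> P (\<Sum>j\<in>S. b j)"
  using S
proof (induction S rule: finite_induct)
  case empty
  thus ?case by (simp add: iprod_empty P(2))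
next
  case (insert i S)
  have "f i \<cdot> iprod f S \<subseteq> P (b i + (\<Sum>j\<in>S. b j))"
    by (rule prod_least[OF P(1)]) (use insert.IH f(2) P(3) in blast)
  thus ?case using insert.hyps f(1) by (simp add: iprod_insert)
qed

lemma ipow_graded_subset:
  fixes P :: "('s \<Rightarrow> int) \<Rightarrow> 'a set"
  assumes P: "\<And>n. ideal (P n) R" "P 0 = carrier R" "\<And>m n f b. f \<in> P m \<Longrightarrow> b \<in> P n \<Longrightarrow> f \<otimes> b \<in> P (m + n)"
    and J: "J \<subseteq> P e"
  shows "ipow J k \<subseteq> P (\<lambda>i. int k * e i)"
proof (induction k)
  case 0
  thus ?case using P(2) by (simp add: ipow_0 zero_fun_def)
next
  case (Suc k)
  have "ipow J k \<cdot> J \<subseteq> P ((\<lambda>i. int k * e i) + e)"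
    by (rule prod_least[OF P(1)]) (use Suc.IH J P(3) in blast)
  moreover have "(\<lambda>i. int k * e i) + e = (\<lambda>i. int (Suc k) * e i)" by (simp add: plus_fun_def algebra_simps)
  ultimately show ?case by (simp add: ipow_Suc)
qed

lemma iprod_single:
  assumes f: "\<And>j. ideal (f j) R" and "\<And>j. j \<noteq> i \<Longrightarrow> f j = carrier R"
  shows "iprod f (UNIV :: 's::finite set) = f i"
proof -
  have "iprod f UNIV = iprod f (insert i (UNIV - {i}))" by (simp add: insert_absorb)
  also have "\<dots> = f i \<cdot> iprod f (UNIV - {i})" using f by (intro iprod_insert) auto
  also have "iprod f (UNIV - {i}) = \<one>\<^bsub>ideals_set R\<^esub>"
    by (rule comm_monoid.finprod_one_eqI[OF ideals_set_comm_monoid]) (use assms(2) in auto)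
  finally show ?thesis using ideal_prod_one f by simp
qed

lemma iprod_pow_mem:
  assumes "finite S" "y \<in> carrier R" "\<And>j. ideal (f j) R" "\<And>j. \<exists>k::nat. y [^] k \<in> f j"
  shows "\<exists>k::nat. y [^] k \<in> iprod f S"
  using assms(1)
proof (induction S rule: finite_induct)
  case (insert i S)
  obtain k l :: nat where "y [^] k \<in> iprod f S" "y [^] l \<in> f i" using insert.IH assms(4) by blast
  hence "y [^] (l + k) \<in> f i \<cdot> iprod f S"
    using assms(2) by (subst nat_pow_mult[symmetric]) (auto intro: ideal_prod.prod)
  thus ?case using insert.hyps assms(3) by (auto simp: iprod_insert)
qed (use assms(2) in \<open>simp add: iprod_empty\<close>)

end

lemma unit_vec_nonneg: "0 \<le> unit_vec i"
  by (simp add: unit_vec_def le_fun_def)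

lemma sum_unit_vec:
  fixes k :: "'s::finite \<Rightarrow> int"
  shows "(\<Sum>j\<in>UNIV. (\<lambda>i. k j * unit_vec j i)) = k"
proof
  fix i
  have s: "(\<Sum>j\<in>S. (\<lambda>i. k j * unit_vec j i)) i = (\<Sum>j\<in>S. k j * unit_vec j i)" if "finite S" for S
    using that by (induction S rule: finite_induct) (simp_all add: plus_fun_apply)
  have "(\<Sum>j\<in>UNIV. k j * unit_vec j i) = (\<Sum>j\<in>UNIV. if j = i then k j else 0)"
    by (rule sum.cong) (auto simp: unit_vec_def)
  thus "(\<Sum>j\<in>UNIV. (\<lambda>i. k j * unit_vec j i)) i = k i" using s by simp
qed

section \<open>The multigraded \<open>J\<close>-adic filtration\<close>

context noetherian_cring
begin

abbreviation jadic :: "('s::finite \<Rightarrow> 'a set) \<Rightarrow> ('s \<Rightarrow> int) \<Rightarrow> 'a set" where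
  "jadic \<equiv> ideal_tuple_power R"

context
  fixes J :: "'s::finite \<Rightarrow> 'a set"
  assumes J: "\<And>i. ideal (J i) R"
begin

lemma jadic_ideal: "ideal (jadic J n) R"
  unfolding ideal_tuple_power_def by (intro iprod_ideal ipow_ideal J)

lemma jadic_antimono: "m \<le> n \<Longrightarrow> jadic J n \<subseteq> jadic J m"
  unfolding ideal_tuple_power_def
  by (intro iprod_mono ipow_ideal J ipow_antimono nat_mono) (auto simp: le_fun_def)

lemma jadic_nonpos: "n \<le> 0 \<Longrightarrow> jadic J n = carrier R"
proof -
  assume "n \<le> 0"
  hence "nat (n i) = 0" for i by (simp add: le_fun_def)
  hence "jadic J n = iprod (\<lambda>_. \<one>\<^bsub>ideals_set R\<^esub>) (UNIV :: 's set)" unfolding ideal_tuple_power_def by (simp add: ipow_0)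
  also have "\<dots> = \<one>\<^bsub>ideals_set R\<^esub>"
    by (rule comm_monoid.finprod_one_eqI[OF ideals_set_comm_monoid]) simp
  finally show ?thesis by simp
qed

lemma jadic_prod:
  assumes "0 \<le> m" "0 \<le> n"
  shows "jadic J m \<cdot> jadic J n = jadic J (m + n)"
proof -
  have "nat (m i + n i) = nat (m i) + nat (n i)" for i
    using assms by (simp add: le_fun_def nat_add_distrib)
  thus ?thesis unfolding ideal_tuple_power_def using J ipow_ideal
    by (subst iprod_mult) (auto simp: ipow_add plus_fun_apply)
qed

lemma jadic_pos: "jadic J n = jadic J (\<lambda>i. max 0 (n i))"
proof -
  have "nat (max 0 (n i)) = nat (n i)" for i by simp
  thus ?thesis unfolding ideal_tuple_power_def by simp
qed

lemma jadic_ipow: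
  assumes "0 \<le> n"
  shows "ipow (jadic J n) k = jadic J (\<lambda>i. int k * n i)"
  unfolding ideal_tuple_power_def using J ipow_ideal
  by (subst iprod_ipow) (auto simp: ipow_ipow nat_mult_distrib mult.commute)

lemma jadic_filtration: "filtration (jadic J)"
  unfolding filtration_def
proof (intro conjI allI impI ballI)
  fix m n f b assume f: "f \<in> jadic J m" and b: "b \<in> jadic J n"
  let ?m = "\<lambda>i. max 0 (m i)" and ?n = "\<lambda>i. max 0 (n i)"
  have "f \<otimes> b \<in> jadic J ?m \<cdot> jadic J ?n" using f b jadic_pos by (auto intro: ideal_prod.prod)
  also have "jadic J ?m \<cdot> jadic J ?n = jadic J (?m + ?n)" by (rule jadic_prod) (auto simp: le_fun_def)
  also have "\<dots> \<subseteq> jadic J (n + m)" by (rule jadic_antimono) (auto simp: le_fun_def plus_fun_apply)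
  finally show "f \<otimes> b \<in> jadic J (n + m)" .
qed (use jadic_ideal jadic_antimono jadic_nonpos in auto)

lemma jadic_unit_vec: "jadic J (unit_vec i) = J i"
proof -
  have "jadic J (unit_vec i) = ipow (J i) (nat (unit_vec i i))" unfolding ideal_tuple_power_def
    by (rule iprod_single[where f = "\<lambda>j. ipow (J j) (nat (unit_vec i j))"])
      (rule ipow_ideal[OF J], simp add: unit_vec_def ipow_0)
  thus ?thesis using ipow_1[OF J] by (simp add: unit_vec_def)
qed

text \<open>The Noetherian ambient family is generated by a copy of \<open>R\<close> in each degree
  of the box between \<open>0\<close> and \<open>c\<close>, with the generators of
  \<open>J i\<close> acting in degree \<open>unit_vec i\<close>. Since
  \<open>F n \<subseteq> J^(n-c)\<close>, each \<open>F n\<close> is reached by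
  \<open>J\<close>-powers from a degree in the box.\<close>

lemma noeth_filtration_of_sandwich:
  assumes F: "filtration F" and JF: "\<And>i. J i \<subseteq> F (unit_vec i)"
    and c: "\<And>n. 0 \<le> n \<Longrightarrow> F n \<subseteq> jadic J (n - c)" "0 \<le> c"
  shows "noeth_filtration F"
proof -
  have "\<forall>i. \<exists>G. G \<subseteq> carrier R \<and> finite G \<and> J i = Idl G" using finetely_gen[OF J] by blast
  then obtain G where G: "\<And>i. G i \<subseteq> carrier R" "\<And>i. finite (G i)" "\<And>i. J i = Idl (G i)" by metis
  define W where "W = (\<Union>i. (\<lambda>g. (g, unit_vec i :: 's \<Rightarrow> int)) ` G i)"
  define K where "K = {n. 0 \<le> n \<and> n \<le> c}"
  have "K \<subseteq> {n. range n \<subseteq> {0..Max (range c)}}"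
  proof
    fix n assume "n \<in> K"
    hence n: "0 \<le> n i" "n i \<le> c i" for i by (auto simp: K_def le_fun_def)
    have "n i \<le> Max (range c)" for i by (rule order_trans[OF n(2)]) simp
    thus "n \<in> {n. range n \<subseteq> {0..Max (range c)}}" using n by auto
  qed
  moreover have "finite {n :: 's \<Rightarrow> int. range n \<subseteq> {0..Max (range c)}}"
    using finite_set_of_finite_funs[of UNIV "{0..Max (range c)}" 0]
    by (rule finite_subset[rotated]) (auto simp: image_subset_iff)
  ultimately have "finite K" by (rule finite_subset)
  moreover have "finite W" unfolding W_def using G by auto
  moreover have "fst ` W \<subseteq> carrier R" unfolding W_def using G by force
  ultimately obtain B where B: "noeth_fam W B" "\<And>n. ideal (B n) R" "stable W B" "\<And>n. n \<in> K \<Longrightarrow> B n = carrier R"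
    using exists_noeth_fam[of W K] by blast
  \<comment> \<open>The multipliers of degree \<open>n\<close> on \<open>B\<close>. They form a
    multiplicative family of ideals, so containing each \<open>J i\<close> in degree
    \<open>unit_vec i\<close> suffices for containing every \<open>J^k\<close>.\<close>
  define P where "P = (\<lambda>n. {f \<in> carrier R. \<forall>m. \<forall>b\<in>B m. f \<otimes> b \<in> B (m + n)})"
  have cB: "b \<in> B m \<Longrightarrow> b \<in> carrier R" for b m using B(2) ideal.Icarr by metis
  have iP: "ideal (P n) R" for n
  proof (rule idealI')
    show "P n \<subseteq> carrier R" by (auto simp: P_def)
    show "\<zero> \<in> P n" unfolding P_def using ideal_zero[OF B(2)] cB by simp
    { fix u v assume "u \<in> P n" "v \<in> P n"
      thus "u \<oplus> v \<in> P n" unfolding P_def using ideal_add[OF B(2)] by (simp add: l_distr cB) }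
    { fix u r assume "u \<in> P n" "r \<in> carrier R"
      thus "r \<otimes> u \<in> P n" unfolding P_def using ideal_mult[OF B(2)] by (simp add: m_assoc cB) }
  qed
  have P0: "P 0 = carrier R" unfolding P_def using ideal_mult[OF B(2)] by auto
  have PP: "f \<otimes> g \<in> P (m + n)" if "f \<in> P m" "g \<in> P n" for f g m n
  proof -
    have fg: "f \<in> carrier R" "g \<in> carrier R" using that by (auto simp: P_def)
    have "f \<otimes> g \<otimes> b \<in> B (k + (m + n))" if b: "b \<in> B k" for b k
    proof -
      have "g \<otimes> b \<in> B (k + n)" using \<open>g \<in> P n\<close> b by (simp add: P_def)
      hence "f \<otimes> (g \<otimes> b) \<in> B (k + n + m)" using \<open>f \<in> P m\<close> by (simp add: P_def)
      moreover have "k + n + m = k + (m + n)" by (simp add: add_ac)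
      ultimately show ?thesis using fg cB[OF b] by (simp add: m_assoc)
    qed
    thus ?thesis using fg by (simp add: P_def)
  qed
  have JP: "J i \<subseteq> P (unit_vec i)" for i
    unfolding G(3)
  proof (rule genideal_minimal[OF iP])
    show "G i \<subseteq> P (unit_vec i)"
    proof
      fix g assume g: "g \<in> G i"
      hence "(g, unit_vec i) \<in> W" by (auto simp: W_def)
      thus "g \<in> P (unit_vec i)" unfolding P_def using stableD[OF B(3)] g G(1) by blast
    qed
  qed
  have JPk: "ipow (J i) k \<subseteq> P (\<lambda>a. int k * unit_vec i a)" for i k
    by (rule ipow_graded_subset[OF iP P0 _ JP]) (rule PP)
  have jP: "jadic J k \<subseteq> P k" if k: "0 \<le> k" for k
  proof -
    have "jadic J k \<subseteq> P (\<Sum>j\<in>UNIV. (\<lambda>i. int (nat (k j)) * unit_vec j i))"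
      unfolding ideal_tuple_power_def
      by (rule iprod_graded_subset[where P = P and b = "\<lambda>j i. int (nat (k j)) * unit_vec j i", OF iP P0];
        (rule ipow_ideal[OF J] | rule JPk | rule finite_UNIV | (rule PP; assumption)))
    moreover have "int (nat (k j)) = k j" for j using k by (simp add: le_fun_def)
    ultimately show ?thesis using sum_unit_vec[of k] by simp
  qed
  have FB: "F n \<subseteq> B n" if n: "0 \<le> n" for n
  proof -
    \<comment> \<open>The positive part of \<open>n - c\<close>. Then \<open>n - k\<close> is the
      componentwise minimum of \<open>n\<close> and \<open>c\<close>, hence in the box, where
      \<open>B\<close> contains \<open>\<one>\<close>; multiplying by
      \<open>F n \<subseteq> P k\<close> lands in \<open>B n\<close>.\<close>
    define k where "k = (\<lambda>i. max 0 ((n - c) i))"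
    have k: "0 \<le> k" by (auto simp: k_def le_fun_def)
    have "0 \<le> (n - k) i \<and> (n - k) i \<le> c i" for i
    proof -
      have "0 \<le> n i" "0 \<le> c i" using n c(2) by (simp_all add: le_fun_def)
      thus ?thesis by (simp add: k_def minus_apply max_def)
    qed
    hence "n - k \<in> K" by (simp add: K_def le_fun_def)
    hence "\<one> \<in> B (n - k)" using B(4) by simp
    moreover have "F n \<subseteq> P k" using c(1)[OF n] jadic_pos[of "n - c"] jP[OF k] unfolding k_def by blast
    ultimately have "f \<otimes> \<one> \<in> B (n - k + k)" if "f \<in> F n" for f using that unfolding P_def by blast
    thus ?thesis using filtrationD(5)[OF F] by auto
  qed
  have "y \<in> F a \<and> 0 \<le> a" if "(y, a) \<in> W" for y a
    using that JF G genideal_self[OF G(1)] unit_vec_nonneg by (fastforce simp: W_def)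
  thus ?thesis unfolding noeth_filtration_def using F B(1,2) FB by blast
qed

lemma jadic_noeth_filtration: "noeth_filtration (jadic J)"
  by (rule noeth_filtration_of_sandwich[of _ 0]) (use jadic_filtration jadic_unit_vec in auto)

text \<open>As soon as the coordinate \<open>m i\<close> is at least \<open>1\<close>, one factor
  \<open>J i\<close> splits off \<open>J^m\<close>. Generators of a single \<open>J i\<close>, all
  placed in degree \<open>unit_vec i\<close>, therefore already reduce the filtration.\<close>

lemma jadic_reduced_by:
  assumes xs: "set xs \<subseteq> carrier R" "J i = Idl (set xs)"
  shows "reduced_by (map (\<lambda>x. (x, unit_vec i)) xs) (jadic J)"
  unfolding reduced_by_def
proof (intro exI[of _ "unit_vec i"] allI impI)
  fix m assume m: "unit_vec i \<le> m"
  let ?U = "(\<Union>(x, a)\<in>set (map (\<lambda>x. (x, unit_vec i)) xs). {x \<otimes> f | f. f \<in> jadic J (m - a)})"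
  define Y where "Y = jadic J (m - unit_vec i)"
  have Xc: "f \<in> carrier R" if "f \<in> Y" for f using that jadic_ideal ideal.Icarr unfolding Y_def by metis
  have U: "?U = {x \<otimes> f | x f. x \<in> set xs \<and> f \<in> Y}" by (auto simp: Y_def)
  have Uc: "?U \<subseteq> carrier R" unfolding U using xs Xc by auto
  have iK: "ideal (Idl ?U) R" using genideal_ideal[OF Uc] .
  let ?m = "\<lambda>j. max 0 (m j)"
  have mi: "1 \<le> m i" using m unfolding le_fun_def by (metis unit_vec_def)
  have "jadic J m = jadic J ?m" by (rule jadic_pos)
  also have "?m = unit_vec i + (\<lambda>j. max 0 ((m - unit_vec i) j))"
    using mi by (auto simp: plus_fun_def minus_apply unit_vec_def)
  also have "jadic J \<dots> = J i \<cdot> jadic J (\<lambda>j. max 0 ((m - unit_vec i) j))"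
    by (subst jadic_prod[symmetric, OF unit_vec_nonneg]) (simp_all add: jadic_unit_vec le_fun_def)
  also have "\<dots> = J i \<cdot> Y" unfolding Y_def using jadic_pos by metis
  also have "\<dots> \<subseteq> Idl ?U"
  proof (rule prod_least[OF iK])
    fix a f assume a: "a \<in> J i" and f: "f \<in> Y"
    have fc: "f \<in> carrier R" using Xc f .
    have "J i \<subseteq> col f (Idl ?U) (carrier R)" unfolding xs(2)
    proof (rule genideal_minimal)
      show "ideal (col f (Idl ?U) (carrier R)) R" using iK oneideal fc by (rule col_ideal)
      show "set xs \<subseteq> col f (Idl ?U) (carrier R)"
      proof
        fix x assume x: "x \<in> set xs"
        have "x \<otimes> f \<in> Idl ?U" using genideal_self[OF Uc] x f unfolding U by blast
        thus "x \<in> col f (Idl ?U) (carrier R)" using x xs fc by (auto simp: col_def m_comm)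
      qed
    qed
    thus "a \<otimes> f \<in> Idl ?U" using a fc by (auto simp: col_def m_comm)
  qed
  finally show "jadic J m \<subseteq> Idl ?U" .
qed

end

end

section \<open>Polynomial growth\<close>

definition monom_val :: "('s::finite \<Rightarrow> nat) \<Rightarrow> ('s \<Rightarrow> real) \<Rightarrow> real" where
  "monom_val \<kappa> v = (\<Prod>i\<in>UNIV. v i ^ \<kappa> i)"

definition polyfun :: "(('s::finite \<Rightarrow> real) \<Rightarrow> real) \<Rightarrow> bool" where
  "polyfun f \<longleftrightarrow> (\<exists>K C. finite K \<and> (\<forall>v. f v = (\<Sum>\<kappa>\<in>K. C \<kappa> * monom_val \<kappa> v)))"

text \<open>Several indices may carry the same exponent vector, so the coefficients are collected
  over the fibres of \<open>e\<close>. Sums and products of polynomial functions can then be written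
  over any convenient index set.\<close>

lemma polyfunI_sum:
  assumes "finite T" "\<And>v. f v = (\<Sum>t\<in>T. a t * monom_val (e t) v)"
  shows "polyfun f"
  unfolding polyfun_def
proof (intro exI conjI allI)
  show "finite (e ` T)" using assms by simp
  fix v
  have "f v = (\<Sum>\<kappa>\<in>e ` T. \<Sum>t\<in>{t\<in>T. e t = \<kappa>}. a t * monom_val (e t) v)"
    unfolding assms(2) by (rule sum.image_gen[OF assms(1)])
  also have "\<dots> = (\<Sum>\<kappa>\<in>e ` T. (\<Sum>t\<in>{t\<in>T. e t = \<kappa>}. a t) * monom_val \<kappa> v)"
    by (intro sum.cong refl) (simp add: sum_distrib_right)
  finally show "f v = (\<Sum>\<kappa>\<in>e ` T. (\<lambda>\<kappa>. \<Sum>t\<in>{t\<in>T. e t = \<kappa>}. a t) \<kappa> * monom_val \<kappa> v)" .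
qed

lemma polyfun_const: "polyfun (\<lambda>_. c)"
  by (rule polyfunI_sum[of "{()}" _ "\<lambda>_. c" "\<lambda>_ _. 0"]) (auto simp: monom_val_def)

lemma polyfun_coord: "polyfun (\<lambda>v :: 's::finite \<Rightarrow> real. v i)"
proof (rule polyfunI_sum[of "{()}" _ "\<lambda>_. 1" "\<lambda>_ j. if j = i then 1 else 0"])
  fix v :: "'s \<Rightarrow> real"
  have "monom_val (\<lambda>j. if j = i then 1 else 0) v = (\<Prod>j\<in>UNIV. if j = i then v j else 1)"
    unfolding monom_val_def by (rule prod.cong) auto
  thus "v i = (\<Sum>t\<in>{()}. 1 * monom_val (\<lambda>j. if j = i then 1 else 0) v)" by simp
qed simp

lemma polyfun_add:
  fixes f g :: "('s::finite \<Rightarrow> real) \<Rightarrow> real"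
  assumes "polyfun f" "polyfun g"
  shows "polyfun (\<lambda>v. f v + g v)"
proof -
  obtain K C where K: "finite K" "\<And>v. f v = (\<Sum>\<kappa>\<in>K. C \<kappa> * monom_val \<kappa> v)"
    using assms(1) unfolding polyfun_def by blast
  obtain L D where L: "finite L" "\<And>v. g v = (\<Sum>\<kappa>\<in>L. D \<kappa> * monom_val \<kappa> v)"
    using assms(2) unfolding polyfun_def by blast
  show ?thesis
  proof (rule polyfunI_sum)
    show "finite (K <+> L)" using K(1) L(1) by simp
    show "f v + g v = (\<Sum>t\<in>K <+> L. case_sum C D t * monom_val (case_sum id id t) v)" for v
      unfolding K(2) L(2) sum.Plus[OF K(1) L(1)] by (simp only: comp_def sum.case id_apply)
  qed
qed

lemma polyfun_mult:
  fixes f g :: "('s::finite \<Rightarrow> real) \<Rightarrow> real"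
  assumes "polyfun f" "polyfun g"
  shows "polyfun (\<lambda>v. f v * g v)"
proof -
  obtain K C where K: "finite K" "\<And>v. f v = (\<Sum>\<kappa>\<in>K. C \<kappa> * monom_val \<kappa> v)"
    using assms(1) unfolding polyfun_def by blast
  obtain L D where L: "finite L" "\<And>v. g v = (\<Sum>\<kappa>\<in>L. D \<kappa> * monom_val \<kappa> v)"
    using assms(2) unfolding polyfun_def by blast
  show ?thesis
  proof (rule polyfunI_sum)
    show "finite (K \<times> L)" using K(1) L(1) by simp
    fix v :: "'s \<Rightarrow> real"
    have "monom_val (\<lambda>i. \<kappa> i + \<mu> i) v = monom_val \<kappa> v * monom_val \<mu> v" for \<kappa> \<mu>
      by (simp add: monom_val_def power_add prod.distrib)
    thus "f v * g v = (\<Sum>t\<in>K \<times> L. (C (fst t) * D (snd t)) * monom_val (\<lambda>i. fst t i + snd t i) v)"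
      unfolding K L sum_product sum.cartesian_product by (intro sum.cong) (auto simp: mult_ac)
  qed
qed

lemma polyfun_sum: "finite A \<Longrightarrow> (\<And>a. a \<in> A \<Longrightarrow> polyfun (f a)) \<Longrightarrow> polyfun (\<lambda>v. \<Sum>a\<in>A. f a v)"
  by (induction A rule: finite_induct) (auto intro: polyfun_add polyfun_const)

lemma polyfun_prod: "finite A \<Longrightarrow> (\<And>a. a \<in> A \<Longrightarrow> polyfun (f a)) \<Longrightarrow> polyfun (\<lambda>v. \<Prod>a\<in>A. f a v)"
  by (induction A rule: finite_induct) (auto intro: polyfun_mult polyfun_const)

lemma polyfun_gchoose: "polyfun (\<lambda>v. v i gchoose k)"
proof -
  have "polyfun (\<lambda>v. v i + - real j)" for j by (intro polyfun_add polyfun_coord polyfun_const)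
  hence "polyfun (\<lambda>v. (\<Prod>j\<in>{0..<k}. v i + - real j) * (1 / fact k))"
    by (intro polyfun_mult polyfun_prod polyfun_const) auto
  thus ?thesis by (simp add: gbinomial_prod_rev)
qed

section \<open>Vanishing differences and Newton interpolation\<close>

definition fdiff :: "'s \<Rightarrow> (('s \<Rightarrow> nat) \<Rightarrow> real) \<Rightarrow> ('s \<Rightarrow> nat) \<Rightarrow> real" where
  "fdiff i f m = f (m(i := Suc (m i))) - f m"

lemma sum_choose_lt: "(\<Sum>t<n. t choose k) = n choose Suc k"
  by (induction n) auto

text \<open>Newton's forward difference formula in the coordinate \<open>i\<close>: \<open>f\<close>
  is recovered by summing its first difference, and \<open>sum_choose_lt\<close> turns the summed
  binomials into the next ones.\<close>

lemma newton_one: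
  assumes "(fdiff i ^^ r) f = (\<lambda>_. 0)"
  shows "f (m(i := n)) = (\<Sum>k<r. real (n choose k) * (fdiff i ^^ k) f (m(i := 0)))"
  using assms
proof (induction r arbitrary: f n)
  case (Suc r)
  have z: "(fdiff i ^^ r) (fdiff i f) = (\<lambda>_. 0)" using Suc.prems by (simp add: funpow_swap1)
  have e: "fdiff i f (m(i := t)) = f (m(i := Suc t)) - f (m(i := t))" for t
    by (simp add: fdiff_def)
  have "f (m(i := n)) = f (m(i := 0)) + (\<Sum>t<n. fdiff i f (m(i := t)))"
    unfolding e by (simp add: sum_lessThan_telescope[of "\<lambda>t. f (m(i := t))"])
  also have "(\<Sum>t<n. fdiff i f (m(i := t)))
      = (\<Sum>t<n. \<Sum>k<r. real (t choose k) * (fdiff i ^^ k) (fdiff i f) (m(i := 0)))"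
    by (simp only: Suc.IH[OF z])
  also have "\<dots> = (\<Sum>k<r. \<Sum>t<n. real (t choose k) * (fdiff i ^^ Suc k) f (m(i := 0)))"
    by (subst sum.swap) (simp add: funpow_swap1)
  also have "\<dots> = (\<Sum>k<r. real (n choose Suc k) * (fdiff i ^^ Suc k) f (m(i := 0)))"
    by (simp add: sum_distrib_right[symmetric] sum_choose_lt flip: of_nat_sum)
  finally show ?case by (simp add: sum.lessThan_Suc_shift del: sum.lessThan_Suc fun_upd_apply)
qed simp

lemma fdiff_zero: "(fdiff i ^^ k) (\<lambda>_. 0) = (\<lambda>_. 0)"
  by (induction k) (auto simp: fdiff_def)

lemma fdiff_commute: "fdiff i (fdiff j f) = fdiff j (fdiff i f)"
proof
  fix m
  show "fdiff i (fdiff j f) m = fdiff j (fdiff i f) m"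
    by (cases "i = j") (auto simp: fdiff_def fun_upd_twist)
qed

lemma fdiff_pow_commute1: "(fdiff i ^^ k) (fdiff j f) = fdiff j ((fdiff i ^^ k) f)"
  by (induction k) (simp_all add: fdiff_commute[of i j])

lemma fdiff_pow_commute: "(fdiff i ^^ k) ((fdiff j ^^ l) f) = (fdiff j ^^ l) ((fdiff i ^^ k) f)"
  by (induction l) (simp_all add: fdiff_pow_commute1)

lemma fdiff_subst:
  assumes "i \<noteq> j"
  shows "(fdiff j ^^ l) (\<lambda>m. f (m(i := 0))) m = (fdiff j ^^ l) f (m(i := 0))"
proof (induction l arbitrary: m)
  case (Suc l)
  have e: "(m(i := 0))(j := Suc ((m(i := 0)) j)) = (m(j := Suc (m j)))(i := 0)"
    using assms by (auto simp: fun_eq_iff)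
  show ?case unfolding funpow.simps comp_apply
    unfolding fdiff_def[of j "(fdiff j ^^ l) (\<lambda>m. f (m(i := 0)))" m]
      fdiff_def[of j "(fdiff j ^^ l) f" "m(i := 0)"] e Suc.IH ..
qed simp

lemma fdiff_indep:
  assumes "\<And>m t. f (m(j := t)) = f m" "i \<noteq> j"
  shows "(fdiff i ^^ k) f (m(j := t)) = (fdiff i ^^ k) f m"
proof (induction k arbitrary: m)
  case (Suc k)
  have "(m(j := t))(i := Suc ((m(j := t)) i)) = (m(i := Suc (m i)))(j := t)"
    using assms(2) by (auto simp: fun_eq_iff)
  thus ?case unfolding funpow.simps comp_apply
    unfolding fdiff_def[of i "(fdiff i ^^ k) f" "m(j := t)"] fdiff_def[of i "(fdiff i ^^ k) f" m]
    using Suc.IH by metis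
qed (use assms in simp)

text \<open>Induction on the set \<open>S\<close> of coordinates on which \<open>f\<close> may
  depend. Newton's formula in one coordinate has as coefficients the differences at
  \<open>m i = 0\<close>; these are free of that coordinate and satisfy the same vanishing in the
  others, since differences in distinct directions commute.\<close>

lemma polyfun_of_fdiff:
  fixes f :: "('s::finite \<Rightarrow> nat) \<Rightarrow> real"
  assumes "finite S" "\<And>i. i \<in> S \<Longrightarrow> (fdiff i ^^ r) f = (\<lambda>_. 0)"
    and "\<And>i m t. i \<notin> S \<Longrightarrow> f (m(i := t)) = f m"
  shows "\<exists>p. polyfun p \<and> (\<forall>m. f m = p (\<lambda>i. real (m i)))"
  using assms
proof (induction S arbitrary: f rule: finite_induct)
  case empty
  have all: "f (\<lambda>i. if i \<in> A then 0 else m i) = f m" if "finite A" for A m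
    using that
  proof (induction A rule: finite_induct)
    case (insert a A)
    have eq: "(\<lambda>i. if i \<in> insert a A then 0 else m i) = (\<lambda>i. if i \<in> A then 0 else m i)(a := 0)" by auto
    have "f ((\<lambda>i. if i \<in> A then 0 else m i)(a := 0)) = f (\<lambda>i. if i \<in> A then 0 else m i)"
      by (rule empty.prems(2)) simp
    thus ?case unfolding eq using insert.IH by (rule trans)
  qed simp
  have "f m = f (\<lambda>_. 0)" for m using all[of UNIV m, symmetric] by simp
  thus ?case using polyfun_const by (intro exI[of _ "\<lambda>_. f (\<lambda>_. 0)"]) auto
next
  case (insert i S)
  define g where "g k = (\<lambda>m. (fdiff i ^^ k) f (m(i := 0)))" for k
  have "\<exists>p. polyfun p \<and> (\<forall>m. g k m = p (\<lambda>i. real (m i)))" for k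
  proof (rule insert.IH)
    fix j assume j: "j \<in> S"
    hence ij: "i \<noteq> j" using insert.hyps by auto
    have "(fdiff j ^^ r) ((fdiff i ^^ k) f) = (\<lambda>_. 0)"
      unfolding fdiff_pow_commute[where i = j and k = r and j = i and l = k] using insert.prems(1)[of j] j fdiff_zero by simp
    thus "(fdiff j ^^ r) (g k) = (\<lambda>_. 0)" unfolding g_def by (intro ext) (simp only: fdiff_subst[OF ij])
  next
    fix j m t assume j: "j \<notin> S"
    show "g k (m(j := t)) = g k m"
    proof (cases "j = i")
      case False
      hence j': "j \<notin> insert i S" using j by simp
      have "(fdiff i ^^ k) f ((m(i := 0))(j := t)) = (fdiff i ^^ k) f (m(i := 0))"
        by (rule fdiff_indep[OF insert.prems(2)[OF j']]) (use False in simp)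
      thus ?thesis unfolding g_def fun_upd_twist[OF False] .
    qed (simp add: g_def)
  qed
  then obtain P where P: "\<And>k. polyfun (P k)" "\<And>k m. g k m = P k (\<lambda>i. real (m i))" by metis
  have "f m = (\<Sum>k<r. (real (m i) gchoose k) * P k (\<lambda>i. real (m i)))" for m
    using newton_one[OF insert.prems(1)[of i], of m "m i"] P(2) by (simp add: g_def binomial_gbinomial)
  moreover have "polyfun (\<lambda>v. \<Sum>k<r. (v i gchoose k) * P k v)"
    by (intro polyfun_sum polyfun_mult polyfun_gchoose P(1)) auto
  ultimately show ?case by (intro exI[of _ "\<lambda>v. \<Sum>k<r. (v i gchoose k) * P k v"]) auto
qed

text \<open>Forward differences from a point are backward differences from the point
  \<open>r\<close> steps further on.\<close>

lemma fdiff_eq_iter_diff: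
  fixes h :: "('s::finite \<Rightarrow> int) \<Rightarrow> real"
  shows "(fdiff i ^^ r) (\<lambda>m. h (\<lambda>j. n0 j + int (m j))) m
    = iter_diff (replicate r (unit_vec i)) h (\<lambda>j. n0 j + int (m j) + int r * unit_vec i j)"
proof (induction r arbitrary: m)
  case (Suc r)
  have e1: "(\<lambda>j. n0 j + int ((m(i := Suc (m i))) j) + int r * unit_vec i j)
     = (\<lambda>j. n0 j + int (m j) + int (Suc r) * unit_vec i j)"
    by (auto simp: unit_vec_def algebra_simps)
  have e2: "(\<lambda>j. n0 j + int (m j) + int (Suc r) * unit_vec i j) - unit_vec i
     = (\<lambda>j. n0 j + int (m j) + int r * unit_vec i j)"
    by (rule ext) (simp add: unit_vec_def minus_apply algebra_simps)
  show ?case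
    unfolding funpow.simps comp_apply fdiff_def[of i "(fdiff i ^^ r) (\<lambda>m. h (\<lambda>j. n0 j + int (m j)))" m]
      Suc.IH e1 replicate_Suc iter_diff.simps e2 ..
qed simp

lemma eventually_polyfun:
  fixes h :: "('s::finite \<Rightarrow> int) \<Rightarrow> real"
  assumes "\<And>i. \<exists>r n2 c. \<forall>n\<ge>n2. iter_diff (replicate r (unit_vec i)) h n = c"
  shows "\<exists>n0 p. polyfun p \<and> (\<forall>m. h (\<lambda>j. n0 j + int (m j)) = p (\<lambda>j. real (m j)))"
proof -
  obtain r n2 c where H: "\<And>i n. n2 i \<le> n \<Longrightarrow> iter_diff (replicate (r i) (unit_vec i)) h n = c i"
    using assms by metis
  define n0 where "n0 = (\<lambda>j. Max (range (\<lambda>i. n2 i j)))"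
  have n0: "n2 i \<le> n0" for i by (auto simp: n0_def le_fun_def)
  define f where "f = (\<lambda>m. h (\<lambda>j. n0 j + int (m j)))"
  \<comment> \<open>One more difference than \<open>r i\<close> turns an eventually constant
    difference into zero; the maximum gives a common order for all coordinates.\<close>
  define q where "q = Suc (Max (range r))"
  have "(fdiff i ^^ q) f = (\<lambda>_. 0)" for i
  proof -
    have "n2 i \<le> (\<lambda>j. n0 j + int (m j) + int (r i) * unit_vec i j)" for m
      using n0[of i] by (auto simp: le_fun_def unit_vec_def intro: order_trans)
    hence "(fdiff i ^^ r i) f m = c i" for m
      unfolding f_def fdiff_eq_iter_diff using H by blast
    hence "(fdiff i ^^ Suc (r i)) f = (\<lambda>_. 0)" by (auto simp: fdiff_def)
    moreover have "q = (q - Suc (r i)) + Suc (r i)" unfolding q_def by simp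
    ultimately show ?thesis by (metis comp_apply fdiff_zero funpow_add)
  qed
  hence "\<exists>p. polyfun p \<and> (\<forall>m. f m = p (\<lambda>i. real (m i)))"
    by (intro polyfun_of_fdiff[of UNIV]) auto
  thus ?thesis unfolding f_def by blast
qed

text \<open>Coordinates are treated one at a time: with the others fixed, a polynomial in one
  variable vanishes at all naturals, so its coefficient of exponent \<open>\<rho> i\<close> is zero.
  After all coordinates only the term of \<open>\<rho>\<close> is left.\<close>

lemma polyfun_coeffs_zero:
  fixes C :: "('s::finite \<Rightarrow> nat) \<Rightarrow> real"
  assumes K: "finite K" and z: "\<And>m :: 's \<Rightarrow> nat. (\<Sum>\<kappa>\<in>K. C \<kappa> * monom_val \<kappa> (\<lambda>i. real (m i))) = 0"
    and "\<rho> \<in> K"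
  shows "C \<rho> = 0"
proof -
  have "finite S \<Longrightarrow> (\<And>m :: 's \<Rightarrow> nat. (\<Sum>\<kappa>\<in>K. C \<kappa> * (\<Prod>i\<in>S. real (m i) ^ \<kappa> i)) = 0) \<Longrightarrow>
    (\<Sum>\<kappa>\<in>K. if \<forall>i\<in>S. \<kappa> i = \<rho> i then C \<kappa> else 0) = 0" for S C
  proof (induction S arbitrary: C rule: finite_induct)
    case (insert i S)
    define C' where "C' = (\<lambda>\<kappa>. if \<kappa> i = \<rho> i then C \<kappa> else 0)"
    have "(\<Sum>\<kappa>\<in>K. C' \<kappa> * (\<Prod>j\<in>S. real (m j) ^ \<kappa> j)) = 0" for m :: "'s \<Rightarrow> nat"
    proof -
      define p where "p = (\<Sum>\<kappa>\<in>K. monom (C \<kappa> * (\<Prod>j\<in>S. real (m j) ^ \<kappa> j)) (\<kappa> i))"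
      have "poly p (real t) = 0" for t :: nat
      proof -
        have "(\<Sum>\<kappa>\<in>K. C \<kappa> * (\<Prod>j\<in>insert i S. real ((m(i := t)) j) ^ \<kappa> j)) = 0" by (rule insert.prems)
        moreover have "(\<Prod>j\<in>insert i S. real ((m(i := t)) j) ^ \<kappa> j) = real t ^ \<kappa> i * (\<Prod>j\<in>S. real (m j) ^ \<kappa> j)" for \<kappa>
        proof -
          have "(\<Prod>j\<in>S. real ((m(i := t)) j) ^ \<kappa> j) = (\<Prod>j\<in>S. real (m j) ^ \<kappa> j)"
            using insert.hyps by (intro prod.cong) auto
          thus ?thesis using insert.hyps by simp
        qed
        ultimately show ?thesis by (simp add: p_def poly_sum poly_monom mult_ac)
      qed
      hence "range real \<subseteq> {x. poly p x = 0}" by auto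
      moreover have "infinite (range real)" using infinite_UNIV_nat by (simp add: finite_image_iff inj_on_def)
      ultimately have "p = 0" using poly_roots_finite finite_subset by blast
      hence "coeff p (\<rho> i) = 0" by simp
      thus ?thesis by (simp add: p_def coeff_sum C'_def if_distrib[of "\<lambda>x. x * _"] cong: if_cong) 
    qed
    hence "(\<Sum>\<kappa>\<in>K. if \<forall>i\<in>S. \<kappa> i = \<rho> i then C' \<kappa> else 0) = 0" by (rule insert.IH)
    also have "(\<Sum>\<kappa>\<in>K. if \<forall>i\<in>S. \<kappa> i = \<rho> i then C' \<kappa> else 0)
       = (\<Sum>\<kappa>\<in>K. if \<forall>i\<in>insert i S. \<kappa> i = \<rho> i then C \<kappa> else 0)"
      by (intro sum.cong) (auto simp: C'_def)
    finally show ?case .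
  qed simp
  from this[of UNIV C] z have "(\<Sum>\<kappa>\<in>K. if \<forall>i\<in>UNIV. \<kappa> i = \<rho> i then C \<kappa> else 0) = 0"
    by (simp add: monom_val_def)
  also have "(\<Sum>\<kappa>\<in>K. if \<forall>i\<in>UNIV. \<kappa> i = \<rho> i then C \<kappa> else 0) = (\<Sum>\<kappa>\<in>K. if \<kappa> = \<rho> then C \<kappa> else 0)"
    by (intro sum.cong) (auto simp: fun_eq_iff)
  finally show ?thesis using K assms(3) by simp
qed

abbreviation tdeg :: "('s::finite \<Rightarrow> nat) \<Rightarrow> nat" where "tdeg \<kappa> \<equiv> (\<Sum>i\<in>UNIV. \<kappa> i)"

lemma monom_val_limit:
  fixes v w :: "'s::finite \<Rightarrow> real"
  shows "(\<lambda>k. monom_val \<kappa> (\<lambda>i. real k * v i + w i) / real k ^ tdeg \<kappa>) \<longlonglongrightarrow> monom_val \<kappa> v"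
proof -
  have "(\<lambda>k. (real k * v i + w i) / real k) \<longlonglongrightarrow> v i" for i
  proof -
    have "(\<lambda>k. v i + w i / real k) \<longlonglongrightarrow> v i + 0"
      by (intro tendsto_add tendsto_const lim_const_over_n)
    moreover have "\<forall>\<^sub>F k in sequentially. v i + w i / real k = (real k * v i + w i) / real k"
      using eventually_gt_at_top[of 0] by eventually_elim (simp add: field_simps)
    ultimately show ?thesis using Lim_transform_eventually by fastforce
  qed
  hence "(\<lambda>k. \<Prod>i\<in>UNIV. ((real k * v i + w i) / real k) ^ \<kappa> i) \<longlonglongrightarrow> (\<Prod>i\<in>UNIV. v i ^ \<kappa> i)"
    by (intro tendsto_prod tendsto_power)
  thus ?thesis by (simp add: monom_val_def power_divide prod_dividef power_sum)
qed

lemma polyfun_limit: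
  fixes C :: "('s::finite \<Rightarrow> nat) \<Rightarrow> real" and v w :: "'s \<Rightarrow> real"
  assumes "finite K" and D: "\<And>\<kappa>. \<kappa> \<in> K \<Longrightarrow> C \<kappa> \<noteq> 0 \<Longrightarrow> tdeg \<kappa> \<le> D"
  shows "(\<lambda>k. (\<Sum>\<kappa>\<in>K. C \<kappa> * monom_val \<kappa> (\<lambda>i. real k * v i + w i)) / real k ^ D)
    \<longlonglongrightarrow> (\<Sum>\<kappa>\<in>K. if tdeg \<kappa> = D then C \<kappa> * monom_val \<kappa> v else 0)"
proof -
  have "(\<lambda>k. C \<kappa> * monom_val \<kappa> (\<lambda>i. real k * v i + w i) / real k ^ D)
      \<longlonglongrightarrow> (if tdeg \<kappa> = D then C \<kappa> * monom_val \<kappa> v else 0)" if k: "\<kappa> \<in> K" for \<kappa>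
  proof (cases "C \<kappa> = 0")
    case False
    hence le: "tdeg \<kappa> \<le> D" using D k by blast
    have lim: "(\<lambda>k. (1 / real k) ^ (D - tdeg \<kappa>)) \<longlonglongrightarrow> (if tdeg \<kappa> = D then 1 else 0)"
    proof (cases "tdeg \<kappa> = D")
      case False
      have "(\<lambda>k. (1 / real k) ^ (D - tdeg \<kappa>)) \<longlonglongrightarrow> 0 ^ (D - tdeg \<kappa>)"
        by (intro tendsto_power lim_1_over_n)
      thus ?thesis using False le by (simp add: power_0_left)
    qed simp
    have "(\<lambda>k. C \<kappa> * ((monom_val \<kappa> (\<lambda>i. real k * v i + w i) / real k ^ tdeg \<kappa>) * (1 / real k) ^ (D - tdeg \<kappa>)))
      \<longlonglongrightarrow> C \<kappa> * (monom_val \<kappa> v * (if tdeg \<kappa> = D then 1 else 0))"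
      by (intro tendsto_mult tendsto_const monom_val_limit lim)
    moreover have "real k ^ tdeg \<kappa> * real k ^ (D - tdeg \<kappa>) = real k ^ D" for k
      using le by (simp flip: power_add)
    ultimately show ?thesis by (simp add: power_divide if_distrib cong: if_cong)
  qed simp
  thus ?thesis unfolding sum_divide_distrib by (intro tendsto_sum)
qed

lemma finite_tdeg: "finite {\<kappa> :: 's::finite \<Rightarrow> nat. tdeg \<kappa> = d}"
proof (rule finite_subset)
  show "{\<kappa> :: 's \<Rightarrow> nat. tdeg \<kappa> = d} \<subseteq> PiE UNIV (\<lambda>_. {..d})"
  proof
    fix \<kappa> :: "'s \<Rightarrow> nat" assume "\<kappa> \<in> {\<kappa>. tdeg \<kappa> = d}"
    hence "\<kappa> i \<le> d" for i using member_le_sum[of i UNIV \<kappa>] by simp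
    thus "\<kappa> \<in> PiE UNIV (\<lambda>_. {..d})" by auto
  qed
qed (intro finite_PiE, auto)

text \<open>The difference conditions make \<open>h\<close> polynomial beyond some point
  \<open>n0\<close>, and growth along rays bounds its total degree by \<open>d\<close>. The form of
  degree \<open>d\<close> is then the limit along any ray, independently of the starting point
  \<open>w\<close> as long as it lies beyond \<open>n0\<close>.\<close>

lemma polynomial_growth_limit:
  fixes h :: "('s::finite \<Rightarrow> int) \<Rightarrow> real"
  assumes diffs: "\<And>i. \<exists>r n2 c. \<forall>n\<ge>n2. iter_diff (replicate r (unit_vec i)) h n = c"
    and growth: "\<And>w (v :: 's \<Rightarrow> nat). \<exists>B. \<forall>k\<ge>1. \<bar>h (\<lambda>i. w i + int k * int (v i))\<bar> \<le> B * real k ^ d"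
  shows "\<exists>n0 C. (\<forall>\<kappa>. tdeg \<kappa> \<noteq> d \<longrightarrow> C \<kappa> = 0) \<and> (\<forall>w\<ge>n0. \<forall>v :: 's \<Rightarrow> nat.
    (\<lambda>k. h (\<lambda>i. w i + int k * int (v i)) / real k ^ d)
      \<longlonglongrightarrow> (\<Sum>\<kappa> | tdeg \<kappa> = d. C \<kappa> * monom_val \<kappa> (\<lambda>i. real (v i))))"
proof -
  obtain n0 p where p: "polyfun p" "\<And>m. h (\<lambda>j. n0 j + int (m j)) = p (\<lambda>j. real (m j))"
    using eventually_polyfun[OF diffs] by blast
  obtain K C where K: "finite K" "\<And>v. p v = (\<Sum>\<kappa>\<in>K. C \<kappa> * monom_val \<kappa> v)"
    using p(1) unfolding polyfun_def by blast
  have ray: "h (\<lambda>i. n0 i + int k * int (v i)) = p (\<lambda>i. real k * real (v i) + 0)" for k and v :: "'s \<Rightarrow> nat"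
    using p(2)[of "\<lambda>i. k * v i"] by simp
  have deg: "tdeg \<kappa> \<le> d" if "\<kappa> \<in> K" "C \<kappa> \<noteq> 0" for \<kappa>
  proof (rule ccontr)
    assume gt: "\<not> tdeg \<kappa> \<le> d"
    define S where "S = {\<kappa>\<in>K. C \<kappa> \<noteq> 0}"
    define D where "D = Max (tdeg ` S)"
    have S: "finite S" "\<kappa> \<in> S" using K(1) that by (auto simp: S_def)
    have DK: "tdeg \<mu> \<le> D" if "\<mu> \<in> K" "C \<mu> \<noteq> 0" for \<mu> unfolding D_def using S(1) that by (simp add: S_def)
    have Dd: "d < D" using DK[OF that] gt by simp
    have "D \<in> tdeg ` S" unfolding D_def using S by (intro Max_in) auto
    then obtain \<rho> where \<rho>: "\<rho> \<in> K" "C \<rho> \<noteq> 0" "tdeg \<rho> = D" by (auto simp: S_def)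
    \<comment> \<open>If the top degree \<open>D\<close> exceeded \<open>d\<close>, division by
      \<open>k^D\<close> would send \<open>h\<close> to \<open>0\<close> along each ray, while the
      limit is the top form; it would vanish at all natural vectors and hence be zero.\<close>
    have "(\<Sum>\<kappa>\<in>K. (if tdeg \<kappa> = D then C \<kappa> else 0) * monom_val \<kappa> (\<lambda>i. real (v i))) = 0" for v :: "'s \<Rightarrow> nat"
    proof -
      obtain B where B: "\<And>k. k \<ge> 1 \<Longrightarrow> \<bar>h (\<lambda>i. n0 i + int k * int (v i))\<bar> \<le> B * real k ^ d"
        using growth[of n0 v] by blast
      have "(\<lambda>k. \<bar>p (\<lambda>i. real k * real (v i) + 0) / real k ^ D\<bar>) \<longlonglongrightarrow> 0"
      proof (rule tendsto_sandwich[OF _ _ tendsto_const])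
        show "\<forall>\<^sub>F k in sequentially. \<bar>p (\<lambda>i. real k * real (v i) + 0) / real k ^ D\<bar> \<le> \<bar>B\<bar> * (1 / real k)"
          using eventually_ge_at_top[of 1]
        proof eventually_elim
          case (elim k)
          have "\<bar>p (\<lambda>i. real k * real (v i) + 0)\<bar> \<le> \<bar>B\<bar> * real k ^ d"
            using B[OF elim] unfolding ray by (rule order_trans) (simp add: mult_right_mono)
          also have "\<dots> \<le> \<bar>B\<bar> * real k ^ (D - 1)" using Dd elim by (intro mult_left_mono power_increasing) auto
          also have "\<dots> = \<bar>B\<bar> * (1 / real k) * real k ^ D" using Dd elim by (cases D) auto
          finally show ?case using elim by (simp add: divide_le_eq)
        qed
        show "(\<lambda>k. \<bar>B\<bar> * (1 / real k)) \<longlonglongrightarrow> 0" using tendsto_mult[OF tendsto_const lim_1_over_n, of "\<bar>B\<bar>"] by simp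
      qed simp
      hence "(\<lambda>k. p (\<lambda>i. real k * real (v i) + 0) / real k ^ D) \<longlonglongrightarrow> 0"
        by (rule tendsto_rabs_zero_cancel)
      moreover have "(\<lambda>k. p (\<lambda>i. real k * real (v i) + 0) / real k ^ D)
          \<longlonglongrightarrow> (\<Sum>\<kappa>\<in>K. if tdeg \<kappa> = D then C \<kappa> * monom_val \<kappa> (\<lambda>i. real (v i)) else 0)"
        unfolding K(2) by (rule polyfun_limit[OF K(1) DK])
      ultimately have "(\<Sum>\<kappa>\<in>K. if tdeg \<kappa> = D then C \<kappa> * monom_val \<kappa> (\<lambda>i. real (v i)) else 0) = 0"
        by (rule LIMSEQ_unique[symmetric])
      thus ?thesis by (simp add: if_distrib[of "\<lambda>x. x * _"] cong: if_cong)
    qed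
    from polyfun_coeffs_zero[OF K(1) this \<rho>(1)] \<rho> show False by simp
  qed
  define C' where "C' \<kappa> = (if \<kappa> \<in> K \<and> tdeg \<kappa> = d then C \<kappa> else 0)" for \<kappa>
  have lim: "(\<lambda>k. h (\<lambda>i. w i + int k * int (v i)) / real k ^ d)
      \<longlonglongrightarrow> (\<Sum>\<kappa> | tdeg \<kappa> = d. C' \<kappa> * monom_val \<kappa> (\<lambda>i. real (v i)))" if w: "n0 \<le> w" for w and v :: "'s \<Rightarrow> nat"
  proof -
    have w': "int (nat (w i - n0 i)) = w i - n0 i" for i using w by (simp add: le_fun_def)
    have "h (\<lambda>i. w i + int k * int (v i)) = p (\<lambda>i. real k * real (v i) + real (nat (w i - n0 i)))" for k
    proof -
      have "(\<lambda>i. w i + int k * int (v i)) = (\<lambda>i. n0 i + int (k * v i + nat (w i - n0 i)))"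
        using w' by auto
      thus ?thesis using p(2)[of "\<lambda>i. k * v i + nat (w i - n0 i)"] by simp
    qed
    hence "(\<lambda>k. h (\<lambda>i. w i + int k * int (v i)) / real k ^ d)
      \<longlonglongrightarrow> (\<Sum>\<kappa>\<in>K. if tdeg \<kappa> = d then C \<kappa> * monom_val \<kappa> (\<lambda>i. real (v i)) else 0)"
      unfolding K(2) by (simp only:) (rule polyfun_limit[OF K(1) deg])
    also have "(\<Sum>\<kappa>\<in>K. if tdeg \<kappa> = d then C \<kappa> * monom_val \<kappa> (\<lambda>i. real (v i)) else 0)
        = (\<Sum>\<kappa>\<in>K \<inter> {\<kappa>. tdeg \<kappa> = d}. C' \<kappa> * monom_val \<kappa> (\<lambda>i. real (v i)))"
      unfolding sum.inter_restrict[OF K(1)] by (intro sum.cong) (auto simp: C'_def)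
    also have "\<dots> = (\<Sum>\<kappa> | tdeg \<kappa> = d. C' \<kappa> * monom_val \<kappa> (\<lambda>i. real (v i)))"
      by (rule sum.mono_neutral_left[OF finite_tdeg]) (auto simp: C'_def)
    finally show ?thesis .
  qed
  show ?thesis by (intro exI[of _ n0] exI[of _ C']) (use lim in \<open>auto simp: C'_def\<close>)
qed

section \<open>Extracting a coefficient of the leading form by iterated differences\<close>

definition scale :: "nat \<Rightarrow> ('s \<Rightarrow> int) \<Rightarrow> 's \<Rightarrow> int" where
  "scale N a = (\<lambda>i. int N * a i)"

lemma scale_simps:
  "scale N (a + b) = scale N a + scale N b" "scale N (a - b) = scale N a - scale N b"
  "scale (Suc N) a = scale N a + a" "scale 0 a = 0"
  by (auto simp: scale_def plus_fun_def fun_diff_def zero_fun_def algebra_simps)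

lemma scale_nonneg: "0 \<le> a \<Longrightarrow> 0 \<le> scale N a"
  by (simp add: scale_def le_fun_def)

lemma scale_mono: "0 \<le> a \<Longrightarrow> M \<le> N \<Longrightarrow> scale M a \<le> scale N a"
  by (simp add: scale_def le_fun_def mult_right_mono)

text \<open>A step of \<open>N b\<close> is a telescoping sum of \<open>N\<close> steps of
  \<open>b\<close>, so each difference contributes a factor \<open>N\<close>. The shifted threshold
  keeps all intermediate points in the region where the unscaled difference is constant.\<close>

lemma iter_diff_scaled:
  fixes f :: "('s \<Rightarrow> int) \<Rightarrow> real"
  assumes "\<forall>a\<in>set as. 0 \<le> a" "\<And>m. n2 \<le> m \<Longrightarrow> iter_diff as f m = c"
    and "n2 + scale N (sum_list as) \<le> m"
  shows "iter_diff (map (scale N) as) f m = real N ^ length as * c"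
  using assms
proof (induction as arbitrary: f m)
  case Nil
  thus ?case by (simp add: scale_def zero_fun_def plus_fun_def)
next
  case (Cons b as)
  define f' where "f' = (\<lambda>m. f m - f (m - b))"
  define g where "g = iter_diff (map (scale N) as) f"
  have b: "0 \<le> b" and as: "\<forall>a\<in>set as. 0 \<le> a" using Cons.prems(1) unfolding list.set by blast+
  have "iter_diff as f' m = c" if "n2 \<le> m" for m
    using Cons.prems(2)[OF that] unfolding f'_def iter_diff_diff by simp
  hence IH: "iter_diff (map (scale N) as) f' m = real N ^ length as * c"
    if "n2 + scale N (sum_list as) \<le> m" for m
    using Cons.IH[OF as, of f' m] that by blast
  have step: "g m - g (m - b) = real N ^ length as * c" if "n2 + scale N (sum_list as) \<le> m" for m
    using IH[OF that] unfolding f'_def iter_diff_diff g_def .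
  have m: "n2 + scale N (sum_list as) + scale N b \<le> m"
    using Cons.prems(3) by (simp add: scale_simps add_ac)
  have "g m - g (m - scale t b) = real t * (real N ^ length as * c)" if "t \<le> N" for t
    using that
  proof (induction t)
    case (Suc t)
    have "scale t b \<le> scale N b" using Suc.prems b by (intro scale_mono) auto
    hence "n2 + scale N (sum_list as) + scale t b \<le> m" using m by (meson add_left_mono order_trans)
    hence base: "n2 + scale N (sum_list as) \<le> m - scale t b" by (simp add: le_diff_eq)
    have eq: "m - scale (Suc t) b = m - scale t b - b" by (simp add: scale_simps diff_diff_eq)
    have "g (m - scale t b) - g (m - scale (Suc t) b) = real N ^ length as * c"
      unfolding eq by (rule step[OF base])
    moreover have "g m - g (m - scale t b) = real t * (real N ^ length as * c)"
      by (rule Suc.IH) (use Suc.prems in simp)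
    moreover have "x - y = p \<Longrightarrow> y - z = q \<Longrightarrow> x - z = p + q" for x y z p q :: real by simp
    ultimately have "g m - g (m - scale (Suc t) b) = real t * (real N ^ length as * c) + real N ^ length as * c"
      by blast
    thus ?case by (simp only: of_nat_Suc distrib_right mult_1 add.commute)
  qed (simp add: scale_simps)
  from this[of N] show ?case by (simp add: g_def)
qed

text \<open>The scaled difference evaluates \<open>h\<close> only at multiples
  \<open>scale N w\<close> with \<open>w\<close> at least \<open>u - sum_list as\<close>, so limits
  are required only for these \<open>w\<close>.\<close>

lemma iter_diff_limit:
  fixes h G :: "('s \<Rightarrow> int) \<Rightarrow> real"
  assumes "\<forall>a\<in>set as. 0 \<le> a"
    and "\<And>w. u - sum_list as \<le> w \<Longrightarrow> (\<lambda>N. h (scale N w) / real N ^ d) \<longlonglongrightarrow> G w"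
  shows "(\<lambda>N. iter_diff (map (scale N) as) h (scale N u) / real N ^ d) \<longlonglongrightarrow> iter_diff as G u"
  using assms
proof (induction as arbitrary: u)
  case Nil
  show ?case using Nil(2)[of u] by (simp add: le_fun_def minus_apply)
next
  case (Cons a as)
  have a: "0 \<le> a" and as: "\<forall>a\<in>set as. 0 \<le> a" using Cons.prems(1) unfolding list.set by blast+
  have "u - sum_list (a # as) \<le> w" if "u - sum_list as \<le> w" for w
  proof -
    have "u - sum_list (a # as) \<le> u - sum_list as" using a by (simp add: diff_left_mono)
    thus ?thesis using that by (rule order_trans)
  qed
  hence 1: "(\<lambda>N. iter_diff (map (scale N) as) h (scale N u) / real N ^ d) \<longlonglongrightarrow> iter_diff as G u"
    using Cons.prems(2) by (intro Cons.IH[OF as]) blast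
  have eq: "u - sum_list (a # as) = u - a - sum_list as" by (simp add: diff_diff_eq)
  hence 2: "(\<lambda>N. iter_diff (map (scale N) as) h (scale N (u - a)) / real N ^ d) \<longlonglongrightarrow> iter_diff as G (u - a)"
    using Cons.prems(2) unfolding eq by (intro Cons.IH[OF as]) blast
  show ?case using tendsto_diff[OF 1 2] by (simp add: scale_simps diff_divide_distrib)
qed

definition pdiff :: "real \<Rightarrow> real poly \<Rightarrow> real poly" where
  "pdiff b p = p - pcompose p [:- b, 1:]"

text \<open>A formal leading coefficient: \<open>c = 0\<close> is allowed, so the notion survives
  differencing even when the true degree is below \<open>e\<close>.\<close>

definition ptop :: "real poly \<Rightarrow> nat \<Rightarrow> real \<Rightarrow> bool" where
  "ptop p e c \<longleftrightarrow> degree p \<le> e \<and> coeff p e = c"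

lemma poly_pdiff: "poly (pdiff b p) t = poly p t - poly p (t - b)"
  by (simp add: pdiff_def poly_pcompose)

lemma pdiff_pCons: "pdiff b (pCons a q) = pCons 0 (pdiff b q) + smult b (pcompose q [:- b, 1:])"
  by (simp add: pdiff_def pcompose_pCons)

lemma ptop_pcompose: "ptop p e c \<Longrightarrow> ptop (pcompose p [:- b, 1:]) e c"
proof -
  assume p: "ptop p e c"
  have d: "degree (pcompose p [:- b, 1:]) = degree p" by (simp add: degree_pcompose)
  show ?thesis
  proof (cases "degree p = e")
    case True
    have "lead_coeff (pcompose p [:- b, 1:]) = lead_coeff p" by (subst lead_coeff_comp) auto
    thus ?thesis using p d True by (simp add: ptop_def)
  next
    case False
    hence "degree p < e" using p by (simp add: ptop_def)
    thus ?thesis using p d coeff_eq_0[of p e] coeff_eq_0[of "pcompose p [:- b, 1:]" e] by (simp add: ptop_def)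
  qed
qed

lemma ptop_0: "ptop p 0 c \<longleftrightarrow> p = [:c:]"
  by (auto simp: ptop_def degree_eq_zeroE elim: degree_eq_zeroE)

lemma pdiff_ptop_0: "ptop p 0 c \<Longrightarrow> pdiff b p = 0"
  by (simp add: ptop_0 pdiff_def)

text \<open>Discrete counterpart of differentiation, from
  \<open>t^n - (t - b)^n = n b t^(n-1) + ...\<close>; the induction peels off the constant term and
  uses the product rule for \<open>t\<close> times a polynomial.\<close>

lemma pdiff_ptop_Suc: "ptop p (Suc e) c \<Longrightarrow> ptop (pdiff b p) e (real (Suc e) * b * c)"
proof (induction e arbitrary: p)
  case 0
  obtain a q where p: "p = pCons a q" by (cases p)
  have "ptop q 0 c" using 0 by (auto simp: ptop_def p split: if_splits)
  thus ?case by (simp add: p pdiff_pCons pdiff_ptop_0 ptop_0)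
next
  case (Suc e)
  obtain a q where p: "p = pCons a q" by (cases p)
  have q: "ptop q (Suc e) c" using Suc.prems by (auto simp: ptop_def p split: if_splits)
  have "ptop (pCons 0 (pdiff b q)) (Suc e) (real (Suc e) * b * c)"
    using Suc.IH[OF q] by (auto simp: ptop_def)
  moreover have "ptop (smult b (pcompose q [:- b, 1:])) (Suc e) (b * c)"
    using ptop_pcompose[OF q, of b] degree_smult_le[of b "pcompose q [:- b, 1:]"] by (auto simp: ptop_def)
  ultimately show ?case unfolding p pdiff_pCons ptop_def
    by (auto simp: algebra_simps intro: degree_add_le)
qed

definition step_vec :: "'s::finite \<times> nat \<Rightarrow> 's \<Rightarrow> int" where
  "step_vec p = scale (snd p) (unit_vec (fst p))"

abbreviation cnt :: "('s \<times> nat) list \<Rightarrow> 's \<Rightarrow> nat" where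
  "cnt ps j \<equiv> length (filter (\<lambda>p. fst p = j) ps)"

definition prodfun :: "('s::finite \<Rightarrow> real poly) \<Rightarrow> ('s \<Rightarrow> int) \<Rightarrow> real" where
  "prodfun P w = (\<Prod>j\<in>UNIV. poly (P j) (real_of_int (w j)))"

lemma prodfun_diff: "prodfun P w - prodfun P (w - step_vec (i, b)) = prodfun (P(i := pdiff (real b) (P i))) w"
proof -
  have split: "prodfun P w = poly (P i) (real_of_int (w i)) * (\<Prod>j\<in>UNIV - {i}. poly (P j) (real_of_int (w j)))" for P w
    unfolding prodfun_def by (subst prod.remove[of _ i]) auto
  have "(\<Prod>j\<in>UNIV - {i}. poly (P j) (real_of_int ((w - step_vec (i, b)) j)))
      = (\<Prod>j\<in>UNIV - {i}. poly (P j) (real_of_int (w j)))"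
    by (intro prod.cong) (auto simp: step_vec_def scale_def unit_vec_def minus_apply)
  moreover have "(\<Prod>j\<in>UNIV - {i}. poly ((P(i := pdiff (real b) (P i))) j) (real_of_int (w j)))
      = (\<Prod>j\<in>UNIV - {i}. poly (P j) (real_of_int (w j)))"
    by (intro prod.cong) auto
  ultimately show ?thesis unfolding split
    by (simp add: poly_pdiff step_vec_def scale_def unit_vec_def minus_apply algebra_simps)
qed

lemma iter_diff_Cons': "iter_diff (a # as) f n = iter_diff as (\<lambda>n. f n - f (n - a)) n"
  by (simp add: iter_diff_diff)

lemma iter_diff_prodfun_Cons:
  "iter_diff (map step_vec ((i, b) # ps)) (prodfun P) u
   = iter_diff (map step_vec ps) (prodfun (P(i := pdiff (real b) (P i)))) u"
  unfolding list.map iter_diff_Cons' prodfun_diff ..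

text \<open>A difference by \<open>b\<close> in direction \<open>i\<close> touches only the factor
  of coordinate \<open>i\<close>, lowers its degree by one and multiplies its leading coefficient by
  that degree times \<open>b\<close>. The degrees count down to a factorial and the step lengths
  multiply.\<close>

lemma iter_diff_prodfun_eq:
  assumes "\<And>j. ptop (P j) (cnt ps j) (c j)"
  shows "iter_diff (map step_vec ps) (prodfun P) u
    = (\<Prod>j\<in>UNIV. c j * fact (cnt ps j)) * (\<Prod>p\<leftarrow>ps. real (snd p))"
  using assms
proof (induction ps arbitrary: P c)
  case Nil
  thus ?case by (simp add: ptop_0 prodfun_def)
next
  case (Cons p ps)
  obtain i b where p: "p = (i, b)" by (cases p)
  define c' where "c' = c(i := real (Suc (cnt ps i)) * real b * c i)"
  have top: "ptop ((P(i := pdiff (real b) (P i))) j) (cnt ps j) (c' j)" for j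
  proof (cases "j = i")
    case True
    thus ?thesis using pdiff_ptop_Suc[of "P i" "cnt ps i" "c i" "real b"] Cons.prems[of i] p by (simp add: c'_def)
  next
    case False
    thus ?thesis using Cons.prems[of j] p by (simp add: c'_def)
  qed
  have "iter_diff (map step_vec (p # ps)) (prodfun P) u
      = (\<Prod>j\<in>UNIV. c' j * fact (cnt ps j)) * (\<Prod>p\<leftarrow>ps. real (snd p))"
    unfolding p iter_diff_prodfun_Cons by (rule Cons.IH[OF top])
  also have "(\<Prod>j\<in>UNIV. c' j * fact (cnt ps j)) = (\<Prod>j\<in>UNIV. c j * fact (cnt (p # ps) j)) * real b"
  proof -
    have "(\<Prod>j\<in>UNIV - {i}. c' j * fact (cnt ps j)) = (\<Prod>j\<in>UNIV - {i}. c j * fact (cnt (p # ps) j))"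
      by (intro prod.cong) (auto simp: c'_def p)
    thus ?thesis
      by (subst (1 2) prod.remove[of _ i]) (auto simp: c'_def p algebra_simps)
  qed
  finally show ?case by (simp add: p)
qed

lemma iter_diff_const_zero: "iter_diff as (\<lambda>_. 0) n = 0"
  by (induction as arbitrary: n) auto

text \<open>A factor of degree at most \<open>e j0\<close> is annihilated by more than
  \<open>e j0\<close> differences in its direction. In the other coordinates the truncated
  \<open>e i - 1\<close> is harmless, as the difference of a constant is zero.\<close>

lemma iter_diff_prodfun_zero:
  assumes "\<And>j. ptop (P j) (e j) (c j)" "e j0 < cnt ps j0"
  shows "iter_diff (map step_vec ps) (prodfun P) u = 0"
  using assms
proof (induction ps arbitrary: P e c)
  case (Cons p ps)
  obtain i b where p: "p = (i, b)" by (cases p)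
  show ?case
  proof (cases "i = j0 \<and> e j0 = 0")
    case True
    hence "pdiff (real b) (P i) = 0" using pdiff_ptop_0 Cons.prems(1) by metis
    hence "prodfun (P(i := pdiff (real b) (P i))) = (\<lambda>_. 0)"
      by (auto simp: prodfun_def fun_eq_iff intro!: exI[of _ i])
    thus ?thesis unfolding p iter_diff_prodfun_Cons by (simp add: iter_diff_const_zero)
  next
    case False
    have "\<exists>c'. ptop (pdiff (real b) (P i)) (e i - 1) c'"
    proof (cases "e i")
      case 0
      thus ?thesis using pdiff_ptop_0[of "P i" "c i" "real b"] Cons.prems(1)[of i] by (simp add: ptop_def)
    next
      case (Suc e')
      thus ?thesis using pdiff_ptop_Suc[of "P i" e' "c i" "real b"] Cons.prems(1)[of i] by auto
    qed
    then obtain c' where "ptop (pdiff (real b) (P i)) (e i - 1) c'" by blast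
    hence top: "ptop ((P(i := pdiff (real b) (P i))) j) ((e(i := e i - 1)) j) ((c(i := c')) j)" for j
      using Cons.prems(1)[of j] by simp
    have "(e(i := e i - 1)) j0 < cnt ps j0"
      using Cons.prems(2) False p by (cases "i = j0") auto
    thus ?thesis unfolding p iter_diff_prodfun_Cons by (rule Cons.IH[OF top])
  qed
qed simp

lemma iter_diff_sum:
  fixes f :: "'k \<Rightarrow> 'g::ab_group_add \<Rightarrow> real"
  shows "iter_diff as (\<lambda>n. \<Sum>k\<in>K. C k * f k n) u = (\<Sum>k\<in>K. C k * iter_diff as (f k) u)"
  by (induction as arbitrary: u) (simp_all add: sum_subtractf algebra_simps)

lemma sum_cnt: "(\<Sum>j\<in>UNIV. cnt (ps :: ('s::finite \<times> nat) list) j) = length ps"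
proof (induction ps)
  case (Cons p ps)
  have "(\<Sum>j\<in>UNIV. cnt (p # ps) j) = (\<Sum>j\<in>UNIV. cnt ps j + (if fst p = j then 1 else 0))"
    by (intro sum.cong) auto
  thus ?case using Cons by (simp add: sum.distrib)
qed simp

lemma monom_val_prodfun: "monom_val \<kappa> (\<lambda>i. real_of_int (w i)) = prodfun (\<lambda>j. monom 1 (\<kappa> j)) w"
  by (simp add: monom_val_def prodfun_def poly_monom)

lemma ptop_monom: "ptop (monom 1 k) k 1"
  by (simp add: ptop_def degree_monom_eq)

text \<open>An exponent vector of the same total degree that differs from \<open>cnt ps\<close> is
  smaller in some coordinate, so its monomial is killed; only the monomial with exponents
  \<open>cnt ps\<close> survives.\<close>

lemma iter_diff_homogeneous:
  fixes C :: "('s::finite \<Rightarrow> nat) \<Rightarrow> real"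
  assumes "length ps = d"
  shows "iter_diff (map step_vec ps) (\<lambda>w. \<Sum>\<kappa> | tdeg \<kappa> = d. C \<kappa> * monom_val \<kappa> (\<lambda>i. real_of_int (w i))) u
    = C (cnt ps) * (\<Prod>j\<in>UNIV. fact (cnt ps j)) * (\<Prod>p\<leftarrow>ps. real (snd p))"
proof -
  have z: "iter_diff (map step_vec ps) (prodfun (\<lambda>j. monom 1 (\<kappa> j))) u = 0" if k: "tdeg \<kappa> = d" "\<kappa> \<noteq> cnt ps" for \<kappa>
  proof -
    have "\<exists>j. \<kappa> j < cnt ps j"
    proof (rule ccontr)
      assume "\<not> (\<exists>j. \<kappa> j < cnt ps j)"
      hence le: "cnt ps j \<le> \<kappa> j" for j by (meson not_le)
      obtain j where "\<kappa> j \<noteq> cnt ps j" using k(2) by auto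
      hence "cnt ps j < \<kappa> j" using le[of j] by simp
      hence "(\<Sum>j\<in>UNIV. cnt ps j) < tdeg \<kappa>" using le by (intro sum_strict_mono_ex1) auto
      thus False using k(1) assms sum_cnt[of ps] by simp
    qed
    then obtain j0 where "\<kappa> j0 < cnt ps j0" by blast
    thus ?thesis by (rule iter_diff_prodfun_zero[OF ptop_monom])
  qed
  have "iter_diff (map step_vec ps) (\<lambda>w. \<Sum>\<kappa> | tdeg \<kappa> = d. C \<kappa> * monom_val \<kappa> (\<lambda>i. real_of_int (w i))) u
      = (\<Sum>\<kappa> | tdeg \<kappa> = d. C \<kappa> * iter_diff (map step_vec ps) (prodfun (\<lambda>j. monom 1 (\<kappa> j))) u)"
    unfolding monom_val_prodfun by (rule iter_diff_sum)
  also have "\<dots> = (\<Sum>\<kappa>\<in>{cnt ps}. C \<kappa> * iter_diff (map step_vec ps) (prodfun (\<lambda>j. monom 1 (\<kappa> j))) u)"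
    by (rule sum.mono_neutral_right[OF finite_tdeg]) (use z sum_cnt[of ps] assms in auto)
  also have "\<dots> = C (cnt ps) * (\<Prod>j\<in>UNIV. fact (cnt ps j)) * (\<Prod>p\<leftarrow>ps. real (snd p))"
    using iter_diff_prodfun_eq[of "\<lambda>j. monom 1 (cnt ps j)" ps "\<lambda>_. 1" u] ptop_monom by simp
  finally show ?thesis .
qed

text \<open>The difference with steps scaled by \<open>N\<close>, divided by \<open>N^d\<close>, is
  computed in two ways: it equals \<open>c\<close> for large \<open>N\<close> by telescoping, and it
  tends to the difference of the leading form. The values of \<open>h\<close> themselves need not be
  polynomial.\<close>

lemma iter_diff_leading_coeff:
  fixes h :: "('s::finite \<Rightarrow> int) \<Rightarrow> real"
  assumes lim: "\<And>v :: 's \<Rightarrow> nat. (\<lambda>k. h (\<lambda>i. int k * int (v i)) / real k ^ d)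
      \<longlonglongrightarrow> (\<Sum>\<kappa> | tdeg \<kappa> = d. C \<kappa> * monom_val \<kappa> (\<lambda>i. real (v i)))"
    and diff: "\<And>n. n2 \<le> n \<Longrightarrow> iter_diff (map step_vec ps) h n = c" and d: "length ps = d"
  shows "c = C (cnt ps) * (\<Prod>j\<in>UNIV. fact (cnt ps j)) * (\<Prod>p\<leftarrow>ps. real (snd p))"
proof -
  let ?as = "map step_vec ps"
  let ?G = "\<lambda>w :: 's \<Rightarrow> int. \<Sum>\<kappa> | tdeg \<kappa> = d. C \<kappa> * monom_val \<kappa> (\<lambda>i. real_of_int (w i))"
  \<comment> \<open>The additional \<open>(1, ..., 1)\<close> keeps all evaluation points positive,
    where the limit is given, and makes \<open>scale N u\<close> exceed
    \<open>scale N (sum_list ?as)\<close> by \<open>(N, ..., N)\<close>, which passes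
    \<open>n2\<close>.\<close>
  define u where "u = sum_list ?as + (\<lambda>_. 1)"
  have as: "\<forall>a\<in>set ?as. 0 \<le> a" by (auto simp: step_vec_def intro!: scale_nonneg unit_vec_nonneg)
  have "(\<lambda>N. h (scale N w) / real N ^ d) \<longlonglongrightarrow> ?G w" if "u - sum_list ?as \<le> w" for w
  proof -
    have "(\<lambda>_. 1) \<le> w" using that by (simp add: u_def)
    hence w: "int (nat (w i)) = w i" for i by (simp add: le_fun_def order_trans[of 0 1])
    hence "real (nat (w i)) = real_of_int (w i)" for i by (metis of_int_of_nat_eq)
    thus ?thesis using lim[of "\<lambda>i. nat (w i)"] w by (simp add: scale_def)
  qed
  hence 1: "(\<lambda>N. iter_diff (map (scale N) ?as) h (scale N u) / real N ^ d) \<longlonglongrightarrow> iter_diff ?as ?G u"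
    by (rule iter_diff_limit[OF as])
  obtain j0 where j0: "\<And>j. j \<ge> j0 \<Longrightarrow> n2 \<le> (\<lambda>_. int j)" using ex_nat_const_ge by blast
  have "\<forall>\<^sub>F N in sequentially. iter_diff (map (scale N) ?as) h (scale N u) / real N ^ d = c"
    using eventually_ge_at_top[of "max j0 1"]
  proof eventually_elim
    case (elim N)
    have "scale N u = (\<lambda>_. int N) + scale N (sum_list ?as)"
      by (simp add: u_def scale_simps(1) add.commute) (simp add: scale_def)
    hence "n2 + scale N (sum_list ?as) \<le> scale N u" using j0[of N] elim by (simp add: add_right_mono)
    hence "iter_diff (map (scale N) ?as) h (scale N u) = real N ^ length ?as * c"
      by (intro iter_diff_scaled[OF as] diff)
    thus ?case using elim d by simp
  qed
  hence "(\<lambda>N. iter_diff (map (scale N) ?as) h (scale N u) / real N ^ d) \<longlonglongrightarrow> c"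
    by (rule tendsto_eventually)
  hence "c = iter_diff ?as ?G u" using 1 LIMSEQ_unique by blast
  thus ?thesis using iter_diff_homogeneous[OF d] by simp
qed

lemma enat_finite_le: "(a :: enat) \<le> b \<Longrightarrow> b \<noteq> \<infinity> \<Longrightarrow> a \<noteq> \<infinity>"
  by (metis enat_ord_simps(5))

lemma of_int_iter_diff:
  "iter_diff as (\<lambda>n. real_of_int (f n)) n = real_of_int (iter_diff as f n)"
  by (induction as arbitrary: n) auto

section \<open>Colengths of the \<open>J\<close>-adic filtration along rays\<close>

context noetherian_cring
begin

definition colen :: "'a set \<Rightarrow> real" where
  "colen A = real (the_enat (len A (carrier R)))"

lemma colen_eq_length_int: "colen A = real_of_int (length_int A (carrier R))"
  by (simp add: colen_def length_int_def)

lemma colen_nonneg: "0 \<le> colen A"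
  by (simp add: colen_def)

lemma real_the_enat_le:
  assumes "e \<le> of_nat m * f" "f \<noteq> \<infinity>"
  shows "real (the_enat e) \<le> real m * real (the_enat f)" "e \<noteq> \<infinity>"
proof -
  obtain g where g: "f = enat g" using assms(2) by auto
  hence le: "e \<le> enat (m * g)" using assms(1) by (simp add: of_nat_eq_enat)
  then obtain h where h: "e = enat h" by (cases e) auto
  show "e \<noteq> \<infinity>" using h by simp
  have "h \<le> m * g" using le h by simp
  thus "real (the_enat e) \<le> real m * real (the_enat f)" using g h by (simp flip: of_nat_mult)
qed

lemma colen_antimono:
  assumes "ideal A R" "ideal B R" "A \<subseteq> B" "len A (carrier R) \<noteq> \<infinity>"
  shows "colen B \<le> colen A"
  using real_the_enat_le(1)[of "len B (carrier R)" 1 "len A (carrier R)"] len_carrier_antimono[OF assms(1-3)] assms(4)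
  by (simp add: colen_def)

context
  fixes J :: "'s::finite \<Rightarrow> 'a set" and xs :: "'a list" and Q :: "'a set" and d :: nat
  assumes J: "\<And>i. ideal (J i) R" and finJ: "\<And>n. len (jadic J n) (carrier R) \<noteq> \<infinity>"
    and xs: "set xs \<subseteq> carrier R" and Q_def: "Q = Idl (set xs)" and d: "d = length xs" "d \<ge> 1"
    and finQ: "len Q (carrier R) \<noteq> \<infinity>"
    and nil: "\<And>i x. x \<in> set xs \<Longrightarrow> \<exists>k::nat. x [^] k \<in> J i"
begin

text \<open>Generators of \<open>J i\<close>, placed in degree \<open>unit_vec i\<close>, reduce the
  filtration, so the difference in direction \<open>i\<close>, repeated once per generator, is
  eventually a value of the symbol of \<open>R\<close>; on constant families this value does not
  depend on the degree.\<close>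

lemma colen_jadic_diffs:
  "\<exists>r n2 c. \<forall>n\<ge>n2. iter_diff (replicate r (unit_vec i)) (\<lambda>n. colen (jadic J n)) n = c"
proof -
  obtain G where G: "G \<subseteq> carrier R" "finite G" "J i = Idl G" using finetely_gen[OF J] by blast
  obtain ys where ys: "set ys = G" using finite_list[OF G(2)] by blast
  define zs where "zs = map (\<lambda>y. (y, unit_vec i :: 's \<Rightarrow> int)) ys"
  have GJ: "G \<subseteq> J i" using genideal_self[OF G(1)] G(3) by simp
  have Ji: "jadic J (unit_vec i) = J i" by (rule jadic_unit_vec) (rule J)
  have f: "fst ` set zs = G" using ys by (force simp: zs_def)
  have "\<exists>n2. \<forall>n\<ge>n2. iter_diff (map snd zs) (\<lambda>n. length_int (jadic J n) (carrier R)) n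
     = chi zs (\<lambda>_. {\<zero>}) (\<lambda>_. carrier R) n"
  proof (rule iter_diff_length_eq_chi[OF jadic_noeth_filtration[OF J]])
    show "gens zs" using G(1) ys unit_vec_nonneg by (auto simp: gens_def zs_def)
    show "\<forall>(x, a)\<in>set zs. x \<in> jadic J a" using GJ ys Ji by (auto simp: zs_def)
    show "reduced_by zs (jadic J)" unfolding zs_def
      by (rule jadic_reduced_by[OF J]) (use G ys in auto)
    show "fin_colength (fst ` set zs)" unfolding f fin_colength_def
      using G(1) finJ[of "unit_vec i"] Ji G(3) by simp
    show "len (jadic J n) (carrier R) \<noteq> \<infinity>" for n by (rule finJ)
  qed
  then obtain n2 where n2: "\<And>n. n \<ge> n2 \<Longrightarrow> iter_diff (map snd zs) (\<lambda>n. length_int (jadic J n) (carrier R)) n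
     = chi zs (\<lambda>_. {\<zero>}) (\<lambda>_. carrier R) n" by blast
  have m: "map snd zs = replicate (length ys) (unit_vec i)" by (simp add: zs_def comp_def map_replicate_const)
  show ?thesis
  proof (intro exI allI impI)
    fix n :: "'s \<Rightarrow> int" assume "n2 \<le> n"
    hence "iter_diff (map snd zs) (\<lambda>n. length_int (jadic J n) (carrier R)) n = chi zs (\<lambda>_. {\<zero>}) (\<lambda>_. carrier R) n2"
      using n2 chi_const[of zs zs "{\<zero>}" "carrier R" n n2] by simp
    thus "iter_diff (replicate (length ys) (unit_vec i)) (\<lambda>n. colen (jadic J n)) n
       = real_of_int (chi zs (\<lambda>_. {\<zero>}) (\<lambda>_. carrier R) n2)"
      unfolding colen_eq_length_int of_int_iter_diff m by simp
  qed
qed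

text \<open>Nilpotency of the generators modulo each \<open>J i\<close> puts one power of
  \<open>Q\<close> into the product of all \<open>J i\<close>, and \<open>k\<close>-th powers give
  the rest. The successor of that exponent is taken to secure \<open>q \<ge> 1\<close>.\<close>

lemma ipow_subset_jadic: "\<exists>q\<ge>1. \<forall>k. ipow Q (q * k) \<subseteq> jadic J (\<lambda>_. int k)"
proof -
  note iQ = Q_ideal[OF xs Q_def d(1) finQ]
  have "\<exists>q. ipow Q q \<subseteq> jadic J (\<lambda>_. 1)"
  proof (rule ipow_subset_of_nilpotent[OF xs Q_def d(1) finQ jadic_ideal[OF J]])
    fix x assume "x \<in> set xs"
    hence "\<exists>k::nat. x [^] k \<in> ipow (J i) (nat 1)" for i using nil ipow_1[OF J] by simp
    thus "\<exists>k::nat. x [^] k \<in> jadic J (\<lambda>_. 1)" unfolding ideal_tuple_power_def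
      using \<open>x \<in> set xs\<close> xs by (intro iprod_pow_mem ipow_ideal J) auto
  qed
  then obtain q where q: "ipow Q q \<subseteq> jadic J (\<lambda>_. 1)" by blast
  have "ipow Q (Suc q * k) \<subseteq> jadic J (\<lambda>_. int k)" for k
  proof -
    have "ipow Q (Suc q * k) = ipow (ipow Q (Suc q)) k" by (rule ipow_ipow[OF iQ, symmetric])
    also have "\<dots> \<subseteq> ipow (jadic J (\<lambda>_. 1)) k"
      using ipow_antimono[OF iQ, of q "Suc q"] q by (intro ipow_mono) auto
    also have "\<dots> = jadic J (\<lambda>_. int k)" by (subst jadic_ipow[OF J]) (auto simp: le_fun_def)
    finally show ?thesis .
  qed
  thus ?thesis by (intro exI[of _ "Suc q"]) auto
qed

lemma colen_ipow_le: "N \<ge> 1 \<Longrightarrow> colen (ipow Q N) \<le> real N ^ d * colen Q"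
  unfolding colen_def using real_the_enat_le(1)[OF len_ipow_le[OF xs Q_def d(1) finQ] finQ] by simp

lemma vec_upper_bound: "\<exists>V::nat. V \<ge> 1 \<and> (\<forall>i. (w :: 's \<Rightarrow> int) i \<le> int V)"
proof -
  obtain j0 where "\<forall>j\<ge>j0. w \<le> (\<lambda>_. int j)" using ex_nat_const_ge by blast
  from this[rule_format, of "max 1 j0"] show ?thesis by (intro exI[of _ "max 1 j0"]) (auto simp: le_fun_def)
qed

text \<open>A power of \<open>Q\<close> with exponent proportional to \<open>k\<close> lies in the
  ideal, so the bound of degree \<open>d\<close> for \<open>d\<close> generators carries over to
  \<open>J\<close>.\<close>

lemma colen_jadic_growth:
  "\<exists>B. \<forall>k\<ge>1. \<bar>colen (jadic J (\<lambda>i. w i + int k * int (v i)))\<bar> \<le> B * real k ^ d"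
proof -
  note iQ = Q_ideal[OF xs Q_def d(1) finQ]
  obtain q where q: "q \<ge> 1" "\<And>k. ipow Q (q * k) \<subseteq> jadic J (\<lambda>_. int k)" using ipow_subset_jadic by blast
  obtain W :: nat where W: "W \<ge> 1" "\<And>i. w i \<le> int W" using vec_upper_bound by blast
  obtain V :: nat where V: "V \<ge> 1" "\<And>i. int (v i) \<le> int V" using vec_upper_bound[of "\<lambda>i. int (v i)"] by blast
  have "\<bar>colen (jadic J (\<lambda>i. w i + int k * int (v i)))\<bar> \<le> (real (q * (W + V)) ^ d * colen Q) * real k ^ d"
    if k: "k \<ge> 1" for k
  proof -
    define N where "N = k * (W + V)"
    have "w i + int k * int (v i) \<le> int N" for i
    proof -
      have "int W \<le> int k * int W" using mult_right_mono[of 1 "int k" "int W"] k by simp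
      moreover have "int k * int (v i) \<le> int k * int V" using V by (intro mult_left_mono) auto
      moreover have "int N = int k * int W + int k * int V" by (simp add: N_def algebra_simps)
      ultimately show ?thesis using W(2)[of i] by linarith
    qed
    hence "jadic J (\<lambda>_. int N) \<subseteq> jadic J (\<lambda>i. w i + int k * int (v i))"
      by (intro jadic_antimono[OF J]) (simp add: le_fun_def)
    hence "ipow Q (q * N) \<subseteq> jadic J (\<lambda>i. w i + int k * int (v i))" using q(2) by blast
    hence "colen (jadic J (\<lambda>i. w i + int k * int (v i))) \<le> colen (ipow Q (q * N))"
      by (intro colen_antimono jadic_ideal J ipow_ideal iQ len_ipow_finite[OF xs Q_def d(1) finQ])
    also have "\<dots> \<le> real (q * N) ^ d * colen Q" using q(1) k V by (intro colen_ipow_le) (simp add: N_def)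
    also have "\<dots> = (real (q * (W + V)) ^ d * colen Q) * real k ^ d"
      by (simp add: N_def power_mult_distrib mult_ac)
    finally show ?thesis using colen_nonneg by simp
  qed
  thus ?thesis by blast
qed

text \<open>One \<open>C\<close> serves all families \<open>A\<close> squeezed between
  \<open>J^(w+kv)\<close> and \<open>J^(kv-c)\<close>. The lower ideal, shifted beyond
  \<open>n0\<close>, bounds the colength above. The upper ideal may leave the region where the
  \<open>J\<close>-adic colength is polynomial; multiplying it by a fixed power of \<open>Q\<close>
  brings it below \<open>J^(n0+kv)\<close> at a cost of \<open>O(k^(d-1))\<close>.\<close>

theorem mixed_limit:
  "\<exists>C. (\<forall>\<kappa>. tdeg \<kappa> \<noteq> d \<longrightarrow> C \<kappa> = 0) \<and>
    (\<forall>v A w c. 0 \<le> c \<longrightarrow> (\<forall>k. ideal (A k) R) \<longrightarrow>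
       (\<forall>k. jadic J (\<lambda>i. w i + int k * int (v i)) \<subseteq> A k) \<longrightarrow>
       (\<forall>k. A k \<subseteq> jadic J (\<lambda>i. int k * int (v i) - c i)) \<longrightarrow>
       (\<lambda>k. colen (A k) / real k ^ d) \<longlonglongrightarrow> (\<Sum>\<kappa> | tdeg \<kappa> = d. C \<kappa> * monom_val \<kappa> (\<lambda>i. real (v i))))"
proof -
  note iQ = Q_ideal[OF xs Q_def d(1) finQ]
  note finP = len_ipow_finite[OF xs Q_def d(1) finQ]
  have jf: "filtration (jadic J)" by (rule jadic_filtration) (rule J)
  obtain n0 C where C: "\<forall>\<kappa>. tdeg \<kappa> \<noteq> d \<longrightarrow> C \<kappa> = 0"
    "\<And>w v. n0 \<le> w \<Longrightarrow> (\<lambda>k. colen (jadic J (\<lambda>i. w i + int k * int (v i))) / real k ^ d)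
      \<longlonglongrightarrow> (\<Sum>\<kappa> | tdeg \<kappa> = d. C \<kappa> * monom_val \<kappa> (\<lambda>i. real (v i)))"
    using polynomial_growth_limit[OF colen_jadic_diffs colen_jadic_growth] by blast
  obtain q where q: "q \<ge> 1" "\<And>k. ipow Q (q * k) \<subseteq> jadic J (\<lambda>_. int k)" using ipow_subset_jadic by blast
  have lim: "(\<lambda>k. colen (A k) / real k ^ d) \<longlonglongrightarrow> (\<Sum>\<kappa> | tdeg \<kappa> = d. C \<kappa> * monom_val \<kappa> (\<lambda>i. real (v i)))"
    if c: "0 \<le> c" and A: "\<And>k. ideal (A k) R" and lo: "\<And>k. jadic J (\<lambda>i. w i + int k * int (v i)) \<subseteq> A k"
      and up: "\<And>k. A k \<subseteq> jadic J (\<lambda>i. int k * int (v i) - c i)" for v A w c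
  proof -
    \<comment> \<open>\<open>M\<close> absorbs both the threshold \<open>n0\<close> and the shift
      \<open>c\<close>: \<open>Q^(qM) \<subseteq> J^(M, ..., M)\<close>, and this times
      \<open>J^(kv-c)\<close> lies in \<open>J^(n0+kv)\<close>.\<close>
    obtain M :: nat where M: "M \<ge> 1" "\<And>i. n0 i + c i \<le> int M" using vec_upper_bound[of "n0 + c"]
      by (auto simp: plus_fun_apply)
    obtain V :: nat where V: "V \<ge> 1" "\<And>i. int (v i) \<le> int V" using vec_upper_bound[of "\<lambda>i. int (v i)"] by blast
    define b where "b = q * M"
    \<comment> \<open>The constant in \<open>O(k^(d-1))\<close>: \<open>len_ipow_prod_le\<close> is
      applied with \<open>N = qkV\<close>, for which \<open>Q^N \<subseteq> B\<close>, and
      \<open>N + b \<le> k (qV + b)\<close>.\<close>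
    define E where "E = real b * real (q * V + b) ^ (d - 1) * colen Q"
    have b: "b \<ge> 1" using q(1) M(1) by (simp add: b_def)
    have lower: "colen (jadic J (\<lambda>i. n0 i + int k * int (v i))) - E * real k ^ (d - 1) \<le> colen (A k)" if k: "k \<ge> 1" for k
    proof -
      define B where "B = jadic J (\<lambda>i. int k * int (v i) - c i)"
      have iB: "ideal B R" unfolding B_def by (rule jadic_ideal[OF J])
      have ci: "0 \<le> c i" for i using c by (simp add: le_fun_def)
      define N where "N = q * (k * V)"
      have "jadic J (\<lambda>_. int (k * V)) \<subseteq> B" unfolding B_def
      proof (rule jadic_antimono[OF J], unfold le_fun_def, intro allI)
        fix i
        have "int k * int (v i) \<le> int k * int V" using V by (intro mult_left_mono) auto
        thus "int k * int (v i) - c i \<le> int (k * V)" using ci[of i] by simp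
      qed
      hence NB: "ipow Q N \<subseteq> B" unfolding N_def using q(2)[of "k * V"] by blast
      have iP: "ideal (ipow Q b \<cdot> B) R" using ideal_prod_is_ideal ipow_ideal iQ iB by blast
      have PB: "ipow Q b \<cdot> B \<subseteq> B" using prod_subset ipow_ideal iQ iB by blast
      have "ipow Q b \<cdot> B \<subseteq> jadic J (\<lambda>i. n0 i + int k * int (v i))"
      proof (rule prod_least[OF jadic_ideal[OF J]])
        fix f g assume f: "f \<in> ipow Q b" and g: "g \<in> B"
        have "f \<in> jadic J (\<lambda>_. int M)" using f q(2)[of M] b_def by blast
        hence "f \<otimes> g \<in> jadic J ((\<lambda>i. int k * int (v i) - c i) + (\<lambda>_. int M))"
          using filtrationD(4)[OF jf] g unfolding B_def by blast
        moreover have "(\<lambda>i. n0 i + int k * int (v i)) \<le> (\<lambda>i. int k * int (v i) - c i) + (\<lambda>_. int M)"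
          unfolding le_fun_def plus_fun_apply
        proof
          fix i show "n0 i + int k * int (v i) \<le> int k * int (v i) - c i + int M" using M(2)[of i] by linarith
        qed
        ultimately show "f \<otimes> g \<in> jadic J (\<lambda>i. n0 i + int k * int (v i))"
          using filtrationD(2)[OF jf] by blast
      qed
      moreover have finPB: "len (ipow Q b \<cdot> B) (carrier R) \<noteq> \<infinity>"
      proof -
        have "ipow Q (b + N) \<subseteq> ipow Q b \<cdot> B"
          unfolding ipow_add[OF iQ, symmetric] using NB by (intro prod_mono) auto
        hence "len (ipow Q b \<cdot> B) (carrier R) \<le> len (ipow Q (b + N)) (carrier R)"
          by (intro len_carrier_antimono ipow_ideal iQ iP)
        thus ?thesis using finP[of "b + N"] enat_finite_le by blast
      qed
      ultimately have 1: "colen (jadic J (\<lambda>i. n0 i + int k * int (v i))) \<le> colen (ipow Q b \<cdot> B)"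
        by (intro colen_antimono iP jadic_ideal J)
      have "length_int (ipow Q b \<cdot> B) (carrier R) = length_int (ipow Q b \<cdot> B) B + length_int B (carrier R)"
        by (rule length_int_add[OF iP iB oneideal PB ideal_subset_carrier[OF iB] finPB])
      hence 2: "colen (ipow Q b \<cdot> B) = real (the_enat (len (ipow Q b \<cdot> B) B)) + colen B"
        by (simp add: colen_eq_length_int length_int_def)
      have 3: "real (the_enat (len (ipow Q b \<cdot> B) B)) \<le> real (b * (N + b) ^ (d - 1)) * colen Q"
        unfolding colen_def
        by (rule real_the_enat_le(1)[OF len_ipow_prod_le[OF xs Q_def d(1) finQ iB NB d(2)] finQ])
      have "N + b \<le> k * (q * V + b)" using k by (simp add: N_def algebra_simps)
      hence "(N + b) ^ (d - 1) \<le> (k * (q * V + b)) ^ (d - 1)" by (intro power_mono) auto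
      hence "real (b * (N + b) ^ (d - 1)) \<le> real (b * (k * (q * V + b)) ^ (d - 1))"
        by (simp only: of_nat_le_iff mult_le_mono2)
      hence "real (b * (N + b) ^ (d - 1)) * colen Q \<le> real (b * (k * (q * V + b)) ^ (d - 1)) * colen Q"
        using colen_nonneg by (intro mult_right_mono)
      also have "\<dots> = E * real k ^ (d - 1)" by (simp add: E_def power_mult_distrib mult_ac)
      finally have 4: "real (b * (N + b) ^ (d - 1)) * colen Q \<le> E * real k ^ (d - 1)" .
      have 5: "colen B \<le> colen (A k)"
      proof (rule colen_antimono[OF A iB])
        show "A k \<subseteq> B" unfolding B_def by (rule up)
        have "len (A k) (carrier R) \<le> len (jadic J (\<lambda>i. w i + int k * int (v i))) (carrier R)"
          by (rule len_carrier_antimono[OF jadic_ideal[OF J] A lo])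
        thus "len (A k) (carrier R) \<noteq> \<infinity>"
          using finJ enat_finite_le by blast
      qed
      show ?thesis using 1 2 3 4 5 by linarith
    qed
    \<comment> \<open>The limit is known only for starting points beyond \<open>n0\<close>; raising
      \<open>w\<close> to \<open>w'\<close> shrinks the ideal, so it stays inside
      \<open>A k\<close>.\<close>
    define w' where "w' = (\<lambda>i. max (n0 i) (w i))"
    have upper: "colen (A k) \<le> colen (jadic J (\<lambda>i. w' i + int k * int (v i)))" for k
    proof (rule colen_antimono[OF jadic_ideal[OF J] A _ finJ])
      have "jadic J (\<lambda>i. w' i + int k * int (v i)) \<subseteq> jadic J (\<lambda>i. w i + int k * int (v i))"
        by (rule jadic_antimono[OF J]) (simp add: le_fun_def w'_def)
      thus "jadic J (\<lambda>i. w' i + int k * int (v i)) \<subseteq> A k" using lo by blast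
    qed
    show ?thesis
    proof (rule tendsto_sandwich)
      show "\<forall>\<^sub>F k in sequentially. colen (jadic J (\<lambda>i. n0 i + int k * int (v i))) / real k ^ d - E * (1 / real k)
         \<le> colen (A k) / real k ^ d"
        using eventually_ge_at_top[of 1]
      proof eventually_elim
        case (elim k)
        have "real k ^ d = real k * real k ^ (d - 1)" using d(2) by (cases d) auto
        hence "E * (1 / real k) = E * real k ^ (d - 1) / real k ^ d" using elim by simp
        thus ?case using lower[OF elim] by (simp add: divide_right_mono flip: diff_divide_distrib)
      qed
      show "\<forall>\<^sub>F k in sequentially. colen (A k) / real k ^ d \<le> colen (jadic J (\<lambda>i. w' i + int k * int (v i))) / real k ^ d"
        using upper by (intro always_eventually allI divide_right_mono) auto
      show "(\<lambda>k. colen (jadic J (\<lambda>i. w' i + int k * int (v i))) / real k ^ d)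
        \<longlonglongrightarrow> (\<Sum>\<kappa> | tdeg \<kappa> = d. C \<kappa> * monom_val \<kappa> (\<lambda>i. real (v i)))"
        by (rule C(2)) (simp add: w'_def le_fun_def)
      have "(\<lambda>k. colen (jadic J (\<lambda>i. n0 i + int k * int (v i))) / real k ^ d - E * (1 / real k))
        \<longlonglongrightarrow> (\<Sum>\<kappa> | tdeg \<kappa> = d. C \<kappa> * monom_val \<kappa> (\<lambda>i. real (v i))) - E * 0"
        by (intro tendsto_diff C(2) tendsto_mult tendsto_const lim_1_over_n) simp
      thus "(\<lambda>k. colen (jadic J (\<lambda>i. n0 i + int k * int (v i))) / real k ^ d - E * (1 / real k))
        \<longlonglongrightarrow> (\<Sum>\<kappa> | tdeg \<kappa> = d. C \<kappa> * monom_val \<kappa> (\<lambda>i. real (v i)))" by simp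
    qed
  qed
  show ?thesis
  proof (rule exI[of _ C], rule conjI[OF C(1)], intro allI impI)
    fix v A w c
    assume H: "0 \<le> c" "\<forall>k. ideal (A k) R" "\<forall>k. jadic J (\<lambda>i. w i + int k * int (v i)) \<subseteq> A k"
      "\<forall>k. A k \<subseteq> jadic J (\<lambda>i. int k * int (v i) - c i)"
    show "(\<lambda>k. colen (A k) / real k ^ d) \<longlonglongrightarrow> (\<Sum>\<kappa> | tdeg \<kappa> = d. C \<kappa> * monom_val \<kappa> (\<lambda>i. real (v i)))"
      by (rule lim[OF H(1) H(2)[rule_format] H(3)[rule_format] H(4)[rule_format]])
  qed
qed

end

end

section \<open>Extended Rees algebras\<close>

lemma quot_module_simps:
  "carrier (quot_module R I) = carrier (R Quot I)"
  "ring.add (quot_module R I) = ring.add (R Quot I)" "ring.zero (quot_module R I) = ring.zero (R Quot I)"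
  "module.smult (quot_module R I) = (\<lambda>a c. (I +>\<^bsub>R\<^esub> a) \<otimes>\<^bsub>R Quot I\<^esub> c)"
  by (simp_all add: quot_module_def ring.extend_def module.fields_def)

context cring
begin

context
  fixes I assumes I: "ideal I R"
begin

lemma carrier_Quot: "carrier (R Quot I) = (\<lambda>r. I +> r) ` carrier R"
  by (auto simp: FactRing_simps)

lemma coset_eq_iff: "r \<in> carrier R \<Longrightarrow> s \<in> carrier R \<Longrightarrow> I +> r = I +> s \<longleftrightarrow> r \<ominus> s \<in> I"
  using quotient_eq_iff_same_a_r_cos[OF I] by blast

lemma coset_add: "r \<in> carrier R \<Longrightarrow> s \<in> carrier R \<Longrightarrow> (I +> r) \<oplus>\<^bsub>R Quot I\<^esub> (I +> s) = I +> (r \<oplus> s)"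
  using ideal.a_rcos_sum[OF I] by (simp add: FactRing_def)

lemma coset_mult: "r \<in> carrier R \<Longrightarrow> s \<in> carrier R \<Longrightarrow> (I +> r) \<otimes>\<^bsub>R Quot I\<^esub> (I +> s) = I +> (r \<otimes> s)"
  using ideal.rcoset_mult_add[OF I] by (simp add: FactRing_def)

lemma coset_zero: "\<zero>\<^bsub>R Quot I\<^esub> = I +> \<zero>"
  using a_rcos_zero[OF I ideal_zero[OF I]] by (simp add: FactRing_def)

lemma subgroup_quot_module:
  "subgroup N (add_monoid (quot_module R I)) \<longleftrightarrow> subgroup N (add_monoid (R Quot I))"
  by (simp add: subgroup_def m_inv_def quot_module_simps)

lemma submodule_to_ideal:
  assumes N: "submodule N R (quot_module R I)"
  shows "ideal {r \<in> carrier R. I +> r \<in> N} R"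
proof (rule idealI')
  have sg: "subgroup N (add_monoid (R Quot I))"
    using submodule.axioms(1)[OF N] by (simp only: subgroup_quot_module)
  show "{r \<in> carrier R. I +> r \<in> N} \<subseteq> carrier R" by auto
  show "\<zero> \<in> {r \<in> carrier R. I +> r \<in> N}" using subgroup.one_closed[OF sg] coset_zero by simp
  { fix a b assume "a \<in> {r \<in> carrier R. I +> r \<in> N}" "b \<in> {r \<in> carrier R. I +> r \<in> N}"
    thus "a \<oplus> b \<in> {r \<in> carrier R. I +> r \<in> N}"
      using subgroup.m_closed[OF sg, of "I +> a" "I +> b"] coset_add[of a b] by simp }
  { fix a r assume "a \<in> {r \<in> carrier R. I +> r \<in> N}" "r \<in> carrier R"
    thus "r \<otimes> a \<in> {r \<in> carrier R. I +> r \<in> N}"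
      using submodule.smult_closed[OF N, of r "I +> a"] coset_mult[of r a] by (simp add: quot_module_simps) }
qed

lemma ideal_to_submodule:
  assumes K: "ideal K R"
  shows "submodule ((\<lambda>r. I +> r) ` K) R (quot_module R I)"
proof (rule submodule.intro)
  note c = ideal.Icarr[OF K]
  interpret Q: cring "R Quot I" by (rule ideal.quotient_is_cring[OF I is_cring])
  have "subgroup ((\<lambda>r. I +> r) ` K) (add_monoid (R Quot I))"
  proof (rule group.subgroupI)
    show "group (add_monoid (R Quot I))" by (rule Q.a_group)
    show "(\<lambda>r. I +> r) ` K \<subseteq> carrier (add_monoid (R Quot I))" using c carrier_Quot by auto
    show "(\<lambda>r. I +> r) ` K \<noteq> {}" using ideal_zero[OF K] by auto
    fix a assume "a \<in> (\<lambda>r. I +> r) ` K"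
    then obtain r where r: "r \<in> K" "a = I +> r" by blast
    have m: "\<ominus> r \<in> K" using ideal_diff[OF K ideal_zero[OF K] r(1)] c[OF r(1)] by (simp add: a_minus_def)
    have "\<ominus>\<^bsub>R Quot I\<^esub> a = I +> (\<ominus> r)"
    proof (rule Q.minus_equality)
      show "(I +> (\<ominus> r)) \<oplus>\<^bsub>R Quot I\<^esub> a = \<zero>\<^bsub>R Quot I\<^esub>"
        unfolding r(2) coset_zero using coset_add[of "\<ominus> r" r] c[OF r(1)] by (simp add: l_neg)
    qed (use r c carrier_Quot in auto)
    thus "inv\<^bsub>add_monoid (R Quot I)\<^esub> a \<in> (\<lambda>r. I +> r) ` K" using m by (simp add: a_inv_def)
    fix b assume "b \<in> (\<lambda>r. I +> r) ` K"
    then obtain s where s: "s \<in> K" "b = I +> s" by blast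
    thus "a \<otimes>\<^bsub>add_monoid (R Quot I)\<^esub> b \<in> (\<lambda>r. I +> r) ` K"
      using r s coset_add[of r s] c ideal_add[OF K] by auto
  qed
  thus "subgroup ((\<lambda>r. I +> r) ` K) (add_monoid (quot_module R I))" by (simp only: subgroup_quot_module)
  show "submodule_axioms ((\<lambda>r. I +> r) ` K) R (quot_module R I)"
  proof
    fix a y assume a: "a \<in> carrier R" and "y \<in> (\<lambda>r. I +> r) ` K"
    then obtain r where r: "r \<in> K" "y = I +> r" by blast
    thus "a \<odot>\<^bsub>quot_module R I\<^esub> y \<in> (\<lambda>r. I +> r) ` K"
      using coset_mult[of a r] a c ideal_mult[OF K] by (auto simp: quot_module_simps)
  qed
qed

text \<open>Correspondence theorem: preimages of submodules of \<open>R/I\<close> are the ideals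
  containing \<open>I\<close>, with strict inclusions preserved both ways. This links the
  multiplicity to \<open>len\<close>.\<close>

lemma module_length_quot: "module_length R (quot_module R I) = len I (carrier R)"
proof -
  have 1: "(\<exists>N. (\<forall>i\<le>n. submodule (N i) R (quot_module R I)) \<and> (\<forall>i<n. N i \<subset> N (Suc i)))
     \<longleftrightarrow> (\<exists>N. (\<forall>i\<le>n. ideal (N i) R \<and> I \<subseteq> N i \<and> N i \<subseteq> carrier R) \<and> (\<forall>i<n. N i \<subset> N (Suc i)))" for n
  proof
    assume "\<exists>N. (\<forall>i\<le>n. submodule (N i) R (quot_module R I)) \<and> (\<forall>i<n. N i \<subset> N (Suc i))"
    then obtain N where N: "\<forall>i\<le>n. submodule (N i) R (quot_module R I)" "\<forall>i<n. N i \<subset> N (Suc i)" by blast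
    define M where "M i = {r \<in> carrier R. I +> r \<in> N i}" for i
    have "I \<subseteq> M i" if "i \<le> n" for i
    proof
      fix r assume r: "r \<in> I"
      have "subgroup (N i) (add_monoid (R Quot I))"
        using submodule.axioms(1) N(1) that subgroup_quot_module by blast
      hence "I +> \<zero> \<in> N i" using subgroup.one_closed coset_zero by fastforce
      thus "r \<in> M i" using r I ideal.Icarr[OF I r] a_rcos_zero[OF I r] a_rcos_zero[OF I ideal_zero[OF I]]
        by (simp add: M_def)
    qed
    moreover have "ideal (M i) R" "M i \<subseteq> carrier R" if "i \<le> n" for i
      using submodule_to_ideal N(1) that by (auto simp: M_def)
    moreover have "M i \<subset> M (Suc i)" if i: "i < n" for i
    proof -
      have s: "N i \<subset> N (Suc i)" using N(2) i by blast
      then obtain y where y: "y \<in> N (Suc i)" "y \<notin> N i" by blast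
      have "subgroup (N (Suc i)) (add_monoid (R Quot I))"
      proof -
        have "submodule (N (Suc i)) R (quot_module R I)" using N(1) i by simp
        thus ?thesis using submodule.axioms(1) by (simp only: subgroup_quot_module[symmetric]) blast
      qed
      hence "y \<in> carrier (R Quot I)" using subgroup.subset y(1) by fastforce
      then obtain r where r: "r \<in> carrier R" "y = I +> r" using carrier_Quot by auto
      hence "r \<in> M (Suc i)" "r \<notin> M i" using y by (auto simp: M_def)
      moreover have "M i \<subseteq> M (Suc i)" using s by (auto simp: M_def)
      ultimately show ?thesis by blast
    qed
    ultimately show "\<exists>N. (\<forall>i\<le>n. ideal (N i) R \<and> I \<subseteq> N i \<and> N i \<subseteq> carrier R) \<and> (\<forall>i<n. N i \<subset> N (Suc i))"
      by (intro exI[of _ M]) simp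
  next
    assume "\<exists>N. (\<forall>i\<le>n. ideal (N i) R \<and> I \<subseteq> N i \<and> N i \<subseteq> carrier R) \<and> (\<forall>i<n. N i \<subset> N (Suc i))"
    then obtain N where N: "\<forall>i\<le>n. ideal (N i) R \<and> I \<subseteq> N i \<and> N i \<subseteq> carrier R" "\<forall>i<n. N i \<subset> N (Suc i)" by blast
    define M where "M i = (\<lambda>r. I +> r) ` N i" for i
    have "submodule (M i) R (quot_module R I)" if "i \<le> n" for i
      using ideal_to_submodule N(1) that by (simp add: M_def)
    moreover have "M i \<subset> M (Suc i)" if i: "i < n" for i
    proof -
      have s: "N i \<subset> N (Suc i)" using N(2) i by blast
      then obtain r where r: "r \<in> N (Suc i)" "r \<notin> N i" by blast
      have id: "ideal (N i) R" "I \<subseteq> N i" "N (Suc i) \<subseteq> carrier R" using N(1) i by auto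
      have "I +> r \<notin> M i"
      proof
        assume "I +> r \<in> M i"
        then obtain t where t: "t \<in> N i" "I +> r = I +> t" by (auto simp: M_def)
        have c: "r \<in> carrier R" "t \<in> carrier R" using subsetD[OF id(3) r(1)] ideal.Icarr[OF id(1) t(1)] by simp_all
        hence "r \<ominus> t \<in> N i" using coset_eq_iff t(2) id(2) by blast
        hence "(r \<ominus> t) \<oplus> t \<in> N i" using ideal_add[OF id(1)] t(1) by blast
        moreover have "(r \<ominus> t) \<oplus> t = r" using c by algebra
        ultimately show False using r(2) by simp
      qed
      moreover have "I +> r \<in> M (Suc i)" using r by (simp add: M_def)
      moreover have "M i \<subseteq> M (Suc i)" using s by (auto simp: M_def)
      ultimately show ?thesis by blast
    qed
    ultimately show "\<exists>N. (\<forall>i\<le>n. submodule (N i) R (quot_module R I)) \<and> (\<forall>i<n. N i \<subset> N (Suc i))"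
      by (intro exI[of _ M]) simp
  qed
  show ?thesis unfolding module_length_def ideal_length_def 1 ..
qed

end

lemma finsum_mem_ideal:
  assumes K: "ideal K R" and "finite A" "\<And>a. a \<in> A \<Longrightarrow> f a \<in> K"
  shows "finsum R f A \<in> K"
  using assms(2,3)
proof (induction A rule: finite_induct)
  case empty
  thus ?case using ideal_zero[OF K] by simp
next
  case (insert a A)
  have "f \<in> A \<rightarrow> carrier R" "f a \<in> carrier R" using insert.prems ideal.Icarr[OF K] by auto
  hence "finsum R f (insert a A) = f a \<oplus> finsum R f A" using insert.hyps by simp
  thus ?case using insert.IH insert.prems ideal_add[OF K] by simp
qed

section \<open>Laurent polynomials and their coefficients\<close>

abbreviation LR :: "'s::finite itself \<Rightarrow> (('s \<Rightarrow> int) \<Rightarrow> 'a) ring" where "LR \<equiv> laurent_ring R"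

lemma laurent_simps:
  "carrier (LR t) = {f. (\<forall>n. f n \<in> carrier R) \<and> finite {n. f n \<noteq> \<zero>}}"
  "f \<otimes>\<^bsub>LR t\<^esub> g = (\<lambda>n. \<Oplus>k\<in>{k. f k \<noteq> \<zero>}. f k \<otimes> g (\<lambda>i. n i - k i))"
  "\<one>\<^bsub>LR t\<^esub> = (\<lambda>n. if n = (\<lambda>_. 0) then \<one> else \<zero>)"
  "\<zero>\<^bsub>LR t\<^esub> = (\<lambda>_. \<zero>)" "f \<oplus>\<^bsub>LR t\<^esub> g = (\<lambda>n. f n \<oplus> g n)"
  by (simp_all add: laurent_ring_def)

lemma laurent_add_closed:
  assumes "f \<in> carrier (LR t)" "g \<in> carrier (LR t)"
  shows "f \<oplus>\<^bsub>LR t\<^esub> g \<in> carrier (LR t)"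
proof -
  have "{n. f n \<oplus> g n \<noteq> \<zero>} \<subseteq> {n. f n \<noteq> \<zero>} \<union> {n. g n \<noteq> \<zero>}" by auto
  moreover have "finite ({n. f n \<noteq> \<zero>} \<union> {n. g n \<noteq> \<zero>})" using assms by (simp add: laurent_simps)
  ultimately have "finite {n. f n \<oplus> g n \<noteq> \<zero>}" by (rule finite_subset)
  thus ?thesis using assms by (simp add: laurent_simps)
qed

lemma laurent_neg_closed:
  assumes "f \<in> carrier (LR t)"
  shows "(\<lambda>n. \<ominus> f n) \<in> carrier (LR t)"
proof -
  have "{n. \<ominus> f n \<noteq> \<zero>} \<subseteq> {n. f n \<noteq> \<zero>}" by auto
  moreover have "finite {n. f n \<noteq> \<zero>}" using assms by (simp add: laurent_simps)
  ultimately have "finite {n. \<ominus> f n \<noteq> \<zero>}" by (rule finite_subset)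
  thus ?thesis using assms by (simp add: laurent_simps)
qed

lemma laurent_abelian_group: "abelian_group (LR t)"
proof (rule abelian_groupI, goal_cases)
  case (1 f g)
  thus ?case by (rule laurent_add_closed)
next
  case (6 f)
  thus ?case using laurent_neg_closed[OF 6]
    by (intro bexI[of _ "\<lambda>n. \<ominus> f n"]) (auto simp: laurent_simps l_neg)
qed (auto simp: laurent_simps a_ac)

lemma laurent_neg:
  assumes "f \<in> carrier (LR t)"
  shows "\<ominus>\<^bsub>LR t\<^esub> f = (\<lambda>n. \<ominus> f n)"
proof (rule abelian_group.minus_equality[OF laurent_abelian_group])
  show "(\<lambda>n. \<ominus> f n) \<oplus>\<^bsub>LR t\<^esub> f = \<zero>\<^bsub>LR t\<^esub>" using assms by (auto simp: laurent_simps l_neg)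
qed (use assms laurent_neg_closed in auto)

lemma laurent_mult_closed:
  assumes f: "f \<in> carrier (LR t)" and g: "g \<in> carrier (LR t)"
  shows "f \<otimes>\<^bsub>LR t\<^esub> g \<in> carrier (LR t)"
proof -
  have fc: "f n \<in> carrier R" and gc: "g n \<in> carrier R" for n using f g by (auto simp: laurent_simps)
  have fin: "finite {n. f n \<noteq> \<zero>}" "finite {n. g n \<noteq> \<zero>}" using f g by (auto simp: laurent_simps)
  define h where "h = (\<lambda>n. \<Oplus>k\<in>{k. f k \<noteq> \<zero>}. f k \<otimes> g (\<lambda>i. n i - k i))"
  have "{n. h n \<noteq> \<zero>} \<subseteq> (\<lambda>(k, l). (\<lambda>i. k i + l i)) ` ({n. f n \<noteq> \<zero>} \<times> {n. g n \<noteq> \<zero>})"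
  proof
    fix n assume n: "n \<in> {n. h n \<noteq> \<zero>}"
    have "\<exists>k. f k \<noteq> \<zero> \<and> g (\<lambda>i. n i - k i) \<noteq> \<zero>"
    proof (rule ccontr)
      assume "\<not> (\<exists>k. f k \<noteq> \<zero> \<and> g (\<lambda>i. n i - k i) \<noteq> \<zero>)"
      hence "h n \<in> {\<zero>}" unfolding h_def using fin fc
        by (intro finsum_mem_ideal zeroideal) auto
      thus False using n by simp
    qed
    then obtain k where k: "f k \<noteq> \<zero>" "g (\<lambda>i. n i - k i) \<noteq> \<zero>" by blast
    thus "n \<in> (\<lambda>(k, l). (\<lambda>i. k i + l i)) ` ({n. f n \<noteq> \<zero>} \<times> {n. g n \<noteq> \<zero>})"
      by (intro image_eqI[of _ _ "(k, \<lambda>i. n i - k i)"]) auto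
  qed
  hence "finite {n. h n \<noteq> \<zero>}" using fin by (auto intro: finite_subset)
  moreover have "h n \<in> carrier R" for n unfolding h_def using fc gc by (intro finsum_closed) auto
  ultimately show ?thesis by (simp add: laurent_simps h_def)
qed

lemma laurent_finsum_apply:
  assumes "finite G" "\<And>g. g \<in> G \<Longrightarrow> h g \<in> carrier (LR t)"
  shows "finsum (LR t) h G n = finsum R (\<lambda>g. h g n) G"
  using assms
proof (induction G rule: finite_induct)
  case empty
  thus ?case using abelian_monoid.finsum_empty[OF abelian_group.axioms(1)[OF laurent_abelian_group], of t h]
    by (simp add: laurent_simps)
next
  case (insert a G)
  have hc: "h g n \<in> carrier R" if "g \<in> insert a G" for g using insert.prems[OF that] by (simp add: laurent_simps)
  have "finsum (LR t) h (insert a G) = h a \<oplus>\<^bsub>LR t\<^esub> finsum (LR t) h G"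
    using insert by (intro abelian_monoid.finsum_insert[OF abelian_group.axioms(1)[OF laurent_abelian_group]]) auto
  hence "finsum (LR t) h (insert a G) n = h a n \<oplus> finsum R (\<lambda>g. h g n) G" using insert by (simp add: laurent_simps)
  also have "\<dots> = finsum R (\<lambda>g. h g n) (insert a G)"
    using insert.hyps hc by (intro finsum_insert[symmetric]) auto
  finally show ?case .
qed

end

context noetherian_cring
begin

lemma laurent_monom_closed: "r \<in> carrier R \<Longrightarrow> laurent_monom R r e \<in> carrier (LR t)"
  by (auto simp: laurent_simps laurent_monom_def)

text \<open>Each generator has its coefficient in the right power of \<open>J\<close>: for the
  inverse variables the degree is at most \<open>0\<close>, where that power is \<open>R\<close>.
  Sums and convolutions preserve this because the \<open>J\<close>-adic powers form a
  filtration.\<close>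

lemma extended_rees_base_coeff:
  fixes J :: "'s::finite \<Rightarrow> 'a set"
  assumes J: "\<And>i. ideal (J i) R" and f: "f \<in> extended_rees_base R J"
  shows "f \<in> carrier (LR TYPE('s)) \<and> (\<forall>m. f m \<in> jadic J m)"
  using f unfolding extended_rees_base_def
proof (induction f rule: generate_ring.induct)
  note jz = ideal_zero[OF jadic_ideal[where J = J, OF J]]
  have j0: "jadic J n = carrier R" if "n \<le> 0" for n using that by (intro jadic_nonpos J)
  {
    case one
    show ?case using jz j0[of "\<lambda>_. 0"] by (auto simp: laurent_simps zero_fun_def)
  next
    case (incl h)
    then consider r where "r \<in> carrier R" "h = laurent_monom R r (\<lambda>_. 0)"
      | r i where "r \<in> J i" "h = laurent_monom R r (unit_vec i)"
      | i where "h = laurent_monom R \<one> (\<lambda>k. - unit_vec i k)" by blast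
    thus ?case
    proof cases
      case 1
      thus ?thesis using jz j0[of "\<lambda>_. 0"] laurent_monom_closed by (auto simp: laurent_monom_def zero_fun_def)
    next
      case 2
      have "r \<in> carrier R" using 2(1) J ideal.Icarr by metis
      moreover have "jadic J (unit_vec i) = J i" by (rule jadic_unit_vec) (rule J)
      ultimately show ?thesis using 2 jz laurent_monom_closed by (auto simp: laurent_monom_def)
    next
      case 3
      have "(\<lambda>k. - unit_vec i k) \<le> 0" by (simp add: le_fun_def unit_vec_def)
      moreover have "h \<in> carrier (LR TYPE('s))" unfolding 3 by (rule laurent_monom_closed) simp
      ultimately show ?thesis using 3 jz j0 by (auto simp: laurent_monom_def)
    qed
  next
    case (a_inv h)
    hence "\<zero> \<ominus> h m \<in> jadic J m" for m using jz ideal_diff[OF jadic_ideal[where J = J, OF J]] by blast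
    hence "\<ominus> h m \<in> jadic J m" for m using a_inv by (simp add: a_minus_def laurent_simps)
    moreover have "h \<in> carrier (LR TYPE('s))" using a_inv by blast
    ultimately show ?case using laurent_neg[of h] laurent_neg_closed[of h] by simp
  next
    case (eng_add h1 h2)
    have "h1 m \<oplus> h2 m \<in> jadic J m" for m
      using eng_add by (intro ideal_add[OF jadic_ideal[where J = J, OF J]]) blast+
    moreover have "h1 \<oplus>\<^bsub>LR TYPE('s)\<^esub> h2 \<in> carrier (LR TYPE('s))"
      using eng_add by (intro laurent_add_closed) blast+
    ultimately show ?case by (simp add: laurent_simps(5))
  next
    case (eng_mult h1 h2)
    have "(h1 \<otimes>\<^bsub>LR TYPE('s)\<^esub> h2) m \<in> jadic J m" for m
      unfolding laurent_simps(2)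
    proof (rule finsum_mem_ideal[OF jadic_ideal[where J = J, OF J]])
      have "h1 \<in> carrier (LR TYPE('s))" using eng_mult by blast
      thus "finite {k. h1 k \<noteq> \<zero>}" by (simp add: laurent_simps)
      fix k assume "k \<in> {k. h1 k \<noteq> \<zero>}"
      have "h1 k \<otimes> h2 (\<lambda>i. m i - k i) \<in> jadic J ((\<lambda>i. m i - k i) + k)"
        using eng_mult by (intro filtrationD(4)[OF jadic_filtration[where J = J, OF J]]) blast+
      thus "h1 k \<otimes> h2 (\<lambda>i. m i - k i) \<in> jadic J m" by (simp add: plus_fun_def)
    qed
    moreover have "h1 \<otimes>\<^bsub>LR TYPE('s)\<^esub> h2 \<in> carrier (LR TYPE('s))"
      using eng_mult by (intro laurent_mult_closed) blast+
    ultimately show ?case by blast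
  }
qed

text \<open>Write the monomial of \<open>f\<close> in degree \<open>n\<close> through the finitely
  many module generators. A product of a coefficient in degree \<open>k\<close> with one in degree
  \<open>n - k\<close> contributes only if \<open>n - k\<close> is in the support of a generator;
  then \<open>n - k \<le> c\<close>, so the first coefficient lies in
  \<open>J^k \<subseteq> J^(n-c)\<close>.\<close>

lemma finite_module_sandwich:
  fixes J :: "'s::finite \<Rightarrow> 'a set" and I :: "'s \<Rightarrow> nat \<Rightarrow> 'a set"
  assumes J: "\<And>i. ideal (J i) R" and F: "\<And>n. ideal (family_prod_int R I n) R"
    and fin: "finite_module_over (LR TYPE('s)) (extended_rees_base R J) (extended_rees R I)"
  shows "\<exists>c\<ge>0. \<forall>n. family_prod_int R I n \<subseteq> jadic J (n - c)"
proof -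
  note ij = jadic_ideal[where J = J, OF J]
  obtain G where G: "finite G" "G \<subseteq> extended_rees R I"
    "extended_rees R I = {\<Oplus>\<^bsub>LR TYPE('s)\<^esub>g\<in>G. a g \<otimes>\<^bsub>LR TYPE('s)\<^esub> g | a. a \<in> G \<rightarrow> extended_rees_base R J}"
    using fin by (auto simp: finite_module_over_def)
  have GL: "g \<in> carrier (LR TYPE('s))" if "g \<in> G" for g using G(2) that by (auto simp: extended_rees_def)
  define S where "S = (\<Union>g\<in>G. {k. g k \<noteq> \<zero>})"
  have "finite S" unfolding S_def using G(1) GL by (auto simp: laurent_simps)
  \<comment> \<open>Componentwise bound for the degrees occurring in the generators; the inserted
    \<open>0\<close> ensures \<open>0 \<le> c\<close>.\<close>
  define c where "c = (\<lambda>i. Max (insert 0 ((\<lambda>k. k i) ` S)))"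
  have c0: "0 \<le> c" using \<open>finite S\<close> by (auto simp: c_def le_fun_def)
  have Sc: "k \<le> c" if "k \<in> S" for k using \<open>finite S\<close> that by (auto simp: c_def le_fun_def)
  have "family_prod_int R I n \<subseteq> jadic J (n - c)" for n
  proof
    fix f assume f: "f \<in> family_prod_int R I n"
    have fc: "f \<in> carrier R" using f F ideal.Icarr by metis
    have "laurent_monom R f n \<in> extended_rees R I"
      using laurent_monom_closed[OF fc] f ideal_zero[OF F] by (auto simp: extended_rees_def laurent_monom_def)
    then obtain a where a: "a \<in> G \<rightarrow> extended_rees_base R J"
      "laurent_monom R f n = (\<Oplus>\<^bsub>LR TYPE('s)\<^esub>g\<in>G. a g \<otimes>\<^bsub>LR TYPE('s)\<^esub> g)" using G(3) by blast
    have ab: "a g \<in> carrier (LR TYPE('s))" "a g m \<in> jadic J m" if "g \<in> G" for g m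
      using extended_rees_base_coeff[where J = J, OF J, of "a g"] a(1) that by auto
    have "f = laurent_monom R f n n" by (simp add: laurent_monom_def)
    also have "\<dots> = (\<Oplus>g\<in>G. (a g \<otimes>\<^bsub>LR TYPE('s)\<^esub> g) n)"
      unfolding a(2) by (rule laurent_finsum_apply[OF G(1)]) (use ab GL laurent_mult_closed in blast)
    also have "\<dots> \<in> jadic J (n - c)"
    proof (rule finsum_mem_ideal[OF ij G(1)])
      fix g assume g: "g \<in> G"
      show "(a g \<otimes>\<^bsub>LR TYPE('s)\<^esub> g) n \<in> jadic J (n - c)" unfolding laurent_simps(2)
      proof (rule finsum_mem_ideal[OF ij])
        show "finite {k. a g k \<noteq> \<zero>}" using ab(1)[OF g] by (simp add: laurent_simps)
        fix k assume "k \<in> {k. a g k \<noteq> \<zero>}"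
        have gc: "g m \<in> carrier R" for m using GL[OF g] by (simp add: laurent_simps)
        show "a g k \<otimes> g (\<lambda>i. n i - k i) \<in> jadic J (n - c)"
        proof (cases "g (\<lambda>i. n i - k i) = \<zero>")
          case True
          have "a g k \<in> carrier R" using ab(1)[OF g] by (simp add: laurent_simps)
          thus ?thesis using True ideal_zero[OF ij] by simp
        next
          case False
          hence le: "(\<lambda>i. n i - k i) \<le> c" using Sc g by (auto simp: S_def)
          have "n i - c i \<le> k i" for i using le_funD[OF le, of i] by simp
          hence "n - c \<le> k" by (simp add: le_fun_def minus_apply)
          hence "a g k \<in> jadic J (n - c)"
            using ab(2)[OF g, of k] filtrationD(2)[OF jadic_filtration[where J = J, OF J]] by blast
          hence "g (\<lambda>i. n i - k i) \<otimes> a g k \<in> jadic J (n - c)" using ideal_mult[OF ij] gc by blast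
          thus ?thesis using gc ab(1)[OF g] by (simp add: m_comm laurent_simps)
        qed
      qed
    qed
    finally show "f \<in> jadic J (n - c)" .
  qed
  thus ?thesis using c0 by blast
qed

end

section \<open>Mixed multiplicities\<close>

context cring
begin

lemma ideals_set_abelian_monoid: "abelian_monoid (ideals_set R)"
  using ideals_set_is_semiring by (simp add: semiring_def)

lemma isum_least:
  assumes "finite A" "\<And>i. i \<in> A \<Longrightarrow> ideal (f i) R" "\<And>i. i \<in> A \<Longrightarrow> f i \<subseteq> K" "ideal K R"
  shows "ideal (finsum (ideals_set R) f A) R \<and> finsum (ideals_set R) f A \<subseteq> K"
  using assms(1-3)
proof (induction A rule: finite_induct)
  case empty
  show ?case using abelian_monoid.finsum_empty[OF ideals_set_abelian_monoid, of f] zeroideal ideal_zero[OF assms(4)]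
    by (simp add: ideals_set_def)
next
  case (insert a A)
  have "finsum (ideals_set R) f (insert a A) = f a \<oplus>\<^bsub>ideals_set R\<^esub> finsum (ideals_set R) f A"
    using insert by (intro abelian_monoid.finsum_insert[OF ideals_set_abelian_monoid]) auto
  also have "\<dots> = f a <+> finsum (ideals_set R) f A" by (simp add: ideals_set_def)
  finally have e: "finsum (ideals_set R) f (insert a A) = f a <+> finsum (ideals_set R) f A" .
  have IH: "ideal (finsum (ideals_set R) f A) R" "finsum (ideals_set R) f A \<subseteq> K" using insert by auto
  have "f a <+> finsum (ideals_set R) f A \<subseteq> K"
    using insert.prems(2)[of a] IH(2) ideal_add[OF assms(4)] by (auto simp: set_add_def' ; blast)
  moreover have "ideal (f a <+> finsum (ideals_set R) f A) R"
    using insert.prems(1)[of a] IH(1) by (intro add_ideals) auto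
  ultimately show ?case unfolding e by blast
qed

lemma l_coset_ideal:
  assumes "x \<in> carrier R" "ideal A R"
  shows "ideal (x <# A) R"
proof -
  have "\<zero> \<oplus> x \<otimes> b = x \<otimes> b" if "b \<in> A" for b using assms(1) ideal.Icarr[OF assms(2) that] by simp
  hence "x <# A = lin x {\<zero>} A" unfolding l_coset_def lin_def by force
  thus ?thesis using lin_ideal[OF zeroideal assms(2,1)] by simp
qed

end

section \<open>Primary ideals of a local ring\<close>

context noetherian_cring
begin

lemma exists_maximalideal:
  assumes "ideal K R" "K \<noteq> carrier R"
  shows "\<exists>M. maximalideal M R \<and> K \<subseteq> M"
proof -
  have "K \<noteq> carrier R \<longrightarrow> (\<exists>M. maximalideal M R \<and> K \<subseteq> M)" using assms(1)
  proof (induction K rule: noetherian_induct)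
    case (step K)
    show ?case
    proof
      assume nc: "K \<noteq> carrier R"
      show "\<exists>M. maximalideal M R \<and> K \<subseteq> M"
      proof (cases "\<exists>K'. ideal K' R \<and> K \<subset> K' \<and> K' \<noteq> carrier R")
        case True
        then obtain K' where K': "ideal K' R" "K \<subset> K'" "K' \<noteq> carrier R" by blast
        then obtain M where "maximalideal M R" "K' \<subseteq> M" using step.IH[OF K'(1,2)] by blast
        thus ?thesis using K'(2) by blast
      next
        case False
        have "maximalideal K R"
          by (rule maximalidealI[OF step.hyps]) (use nc False in blast)+
        thus ?thesis by blast
      qed
    qed
  qed
  thus ?thesis using assms(2) by blast
qed

context
  fixes \<mm>
  assumes loc: "local_ring R \<mm>"
begin

lemma max_ideal: "maximalideal \<mm> R" "ideal \<mm> R" "\<mm> \<noteq> carrier R" "\<mm> \<subseteq> carrier R"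
proof -
  show m: "maximalideal \<mm> R" using loc by (simp add: local_ring_def)
  show i: "ideal \<mm> R" using m by (simp add: maximalideal_def)
  show "\<mm> \<noteq> carrier R" using maximalideal.I_notcarr[OF m] by blast
  show "\<mm> \<subseteq> carrier R" using ideal_subset_carrier[OF i] .
qed

lemma unit_of_not_mem:
  assumes "y \<in> carrier R" "y \<notin> \<mm>"
  shows "\<exists>u\<in>carrier R. u \<otimes> y = \<one>"
proof -
  have "PIdl y = carrier R"
  proof (rule ccontr)
    assume "PIdl y \<noteq> carrier R"
    then obtain M where "maximalideal M R" "PIdl y \<subseteq> M"
      using exists_maximalideal cgenideal_ideal[OF assms(1)] by blast
    hence "PIdl y \<subseteq> \<mm>" using loc by (auto simp: local_ring_def)
    thus False using cgenideal_self[OF assms(1)] assms(2) by blast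
  qed
  hence "\<one> \<in> PIdl y" by simp
  thus ?thesis by (auto simp: cgenideal_def)
qed

text \<open>Elements outside \<open>\<mm>\<close> are units and can be cancelled, while elements of
  \<open>\<mm>\<close> lie in the radical by nilpotency.\<close>

lemma primary_toI:
  assumes Q: "ideal Q R" "Q \<subseteq> \<mm>" and nil: "\<And>y. y \<in> \<mm> \<Longrightarrow> \<exists>k::nat. y [^] k \<in> Q"
  shows "primary_to R \<mm> Q"
proof -
  have prime: "primeideal \<mm> R" by (rule maximalideal_prime[OF max_ideal(1)])
  have pow: "x \<in> \<mm>" if "x \<in> carrier R" "x [^] k \<in> \<mm>" for x and k :: nat
    using that(2)
  proof (induction k)
    case 0
    hence "\<one> \<in> \<mm>" by simp
    thus ?case using ideal.one_imp_carrier[OF max_ideal(2)] max_ideal(3) by blast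
  next
    case (Suc k)
    thus ?case using primeideal.I_prime[OF prime, of "x [^] k" x] that(1) by auto
  qed
  have rad: "radical R Q = \<mm>"
    using nil pow Q(2) max_ideal(4) by (auto simp: radical_def)
  have "x \<in> Q \<or> y \<in> radical R Q" if xy: "x \<in> carrier R" "y \<in> carrier R" "x \<otimes> y \<in> Q" for x y
  proof (cases "y \<in> \<mm>")
    case False
    then obtain u where u: "u \<in> carrier R" "u \<otimes> y = \<one>" using unit_of_not_mem xy(2) by blast
    have "u \<otimes> (x \<otimes> y) = x \<otimes> (u \<otimes> y)" using u(1) xy by (simp add: m_lcomm)
    also have "\<dots> = x" using u(2) xy(1) by simp
    finally show ?thesis using ideal_mult[OF Q(1) xy(3) u(1)] by simp
  qed (simp add: rad)
  thus ?thesis unfolding primary_to_def primary_ideal_def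
    using Q max_ideal(3,4) rad by auto
qed

lemma primary_toD:
  assumes "primary_to R \<mm> A"
  shows "ideal A R" "y \<in> \<mm> \<Longrightarrow> \<exists>k::nat. y [^] k \<in> A" "A \<subseteq> \<mm>"
proof -
  have A: "ideal A R" "radical R A = \<mm>" using assms by (auto simp: primary_to_def primary_ideal_def)
  show "ideal A R" by fact
  show "\<exists>k::nat. y [^] k \<in> A" if "y \<in> \<mm>" using that A(2) by (auto simp: radical_def)
  show "A \<subseteq> \<mm>"
  proof
    fix y assume y: "y \<in> A"
    hence "y \<in> carrier R" using A(1) ideal.Icarr by metis
    hence "y \<in> radical R A" using y by (auto simp: radical_def intro!: exI[of _ "Suc 0"])
    thus "y \<in> \<mm>" using A(2) by simp
  qed
qed

end

lemma hs_multiplicity_eq: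
  assumes "the_enat (krull_dim R) = d" and A: "ideal A R"
    and lim: "(\<lambda>k. colen (ipow A k) / real k ^ d) \<longlonglongrightarrow> g"
  shows "hs_multiplicity R A = fact d * g"
proof -
  have "module_length R (quot_module R (ipow A n)) = len (ipow A n) (carrier R)" for n
    by (rule module_length_quot[OF ipow_ideal[OF A]])
  hence "hs_multiplicity R A = lim (\<lambda>n. fact d * (colen (ipow A n) / real n ^ d))"
    by (simp add: hs_multiplicity_def assms(1) colen_def Let_def)
  also have "\<dots> = fact d * g" by (intro limI tendsto_mult tendsto_const lim)
  finally show ?thesis .
qed

end

lemma monom_val_scale: "monom_val \<kappa> (\<lambda>i. c * v i) = c ^ tdeg \<kappa> * monom_val \<kappa> v"
  by (simp add: monom_val_def power_mult_distrib prod.distrib power_sum)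

text \<open>The multiplicity of a product is assumed to be an exact form of degree \<open>d\<close>,
  so the defining sequence is constant for positive \<open>m\<close>. Uniqueness, which
  \<open>THE\<close> requires, holds because values at natural vectors determine the
  coefficients.\<close>

lemma mixed_multiplicity_eqI:
  fixes I :: "'s::finite \<Rightarrow> nat \<Rightarrow> 'a set"
  assumes d: "the_enat (krull_dim R) = d" and C: "\<And>\<kappa>. tdeg \<kappa> \<noteq> d \<Longrightarrow> C \<kappa> = 0"
    and hs: "\<And>v. hs_multiplicity R (family_prod R I v)
      = fact d * (\<Sum>\<kappa> | tdeg \<kappa> = d. C \<kappa> * monom_val \<kappa> (\<lambda>i. real (v i)))"
  shows "mixed_multiplicity R I \<kappa> = (\<Prod>i\<in>UNIV. fact (\<kappa> i)) * C \<kappa>"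
proof -
  \<comment> \<open>The factorials cancel the denominators of the multinomial coefficients in the
    definition.\<close>
  define c where "c = (\<lambda>\<kappa> :: 's \<Rightarrow> nat. (\<Prod>i\<in>UNIV. fact (\<kappa> i)) * C \<kappa>)"
  let ?P = "\<lambda>c (n :: 's \<Rightarrow> nat). \<Sum>k | tdeg k = d. fact d / (\<Prod>i\<in>UNIV. fact (k i)) * c k * (\<Prod>i\<in>UNIV. real (n i) ^ k i)"
  have nz: "(\<Prod>i\<in>UNIV. fact (k i)) \<noteq> (0::real)" for k :: "'s \<Rightarrow> nat" by simp
  have lim: "(\<lambda>m. hs_multiplicity R (family_prod R I (\<lambda>i. m * n i)) / real m ^ d) \<longlonglongrightarrow> ?P c n" for n
  proof -
    have "\<forall>\<^sub>F m in sequentially. hs_multiplicity R (family_prod R I (\<lambda>i. m * n i)) / real m ^ d = ?P c n"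
      using eventually_gt_at_top[of 0]
    proof eventually_elim
      case (elim m)
      have "(\<Sum>\<kappa> | tdeg \<kappa> = d. C \<kappa> * monom_val \<kappa> (\<lambda>i. real (m * n i)))
          = real m ^ d * (\<Sum>\<kappa> | tdeg \<kappa> = d. C \<kappa> * monom_val \<kappa> (\<lambda>i. real (n i)))"
        unfolding sum_distrib_left by (intro sum.cong) (auto simp: monom_val_scale)
      hence "hs_multiplicity R (family_prod R I (\<lambda>i. m * n i)) / real m ^ d
          = fact d * (\<Sum>\<kappa> | tdeg \<kappa> = d. C \<kappa> * monom_val \<kappa> (\<lambda>i. real (n i)))"
        using elim by (simp add: hs)
      also have "\<dots> = ?P c n" unfolding sum_distrib_left
        by (intro sum.cong) (auto simp: c_def monom_val_def nz)
      finally show ?case .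
    qed
    thus ?thesis by (rule tendsto_eventually)
  qed
  have mm: "is_mixed_multiplicities R I c"
    unfolding is_mixed_multiplicities_def d Let_def using lim C by (auto simp: c_def)
  have unique: "c' = c" if "is_mixed_multiplicities R I c'" for c'
  proof
    fix \<rho>
    have z: "\<forall>k. tdeg k \<noteq> d \<longrightarrow> c' k = 0"
      and lim': "(\<lambda>m. hs_multiplicity R (family_prod R I (\<lambda>i. m * n i)) / real m ^ d) \<longlonglongrightarrow> ?P c' n" for n
      using that unfolding is_mixed_multiplicities_def d Let_def by blast+
    show "c' \<rho> = c \<rho>"
    proof (cases "tdeg \<rho> = d")
      case True
      have "?P c' n = ?P c n" for n using LIMSEQ_unique[OF lim' lim] .
      moreover have "(\<Sum>k | tdeg k = d. (fact d / (\<Prod>i\<in>UNIV. fact (k i)) * (c' k - c k)) * monom_val k (\<lambda>i. real (n i)))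
          = ?P c' n - ?P c n" for n :: "'s \<Rightarrow> nat"
        unfolding sum_subtractf[symmetric] monom_val_def
        by (intro sum.cong refl) (simp only: right_diff_distrib left_diff_distrib)
      ultimately have "(\<Sum>k | tdeg k = d. (fact d / (\<Prod>i\<in>UNIV. fact (k i)) * (c' k - c k)) * monom_val k (\<lambda>i. real (n i))) = 0"
        for n :: "'s \<Rightarrow> nat" by simp
      hence "fact d / (\<Prod>i\<in>UNIV. fact (\<rho> i)) * (c' \<rho> - c \<rho>) = 0"
        by (rule polyfun_coeffs_zero[OF finite_tdeg]) (use True in simp)
      thus ?thesis using nz[of \<rho>] by simp
    next
      case False
      thus ?thesis using z C by (simp add: c_def)
    qed
  qed
  have "mixed_multiplicity R I = c" unfolding mixed_multiplicity_def by (rule the_equality, rule mm, erule unique)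
  thus ?thesis by (simp add: c_def)
qed

context noetherian_cring
begin

context
  fixes Q :: "'a set" and xs :: "'a list" and d :: nat
  assumes xs: "set xs \<subseteq> carrier R" and Q_def: "Q = Idl (set xs)" and d: "d = length xs" "d \<ge> 1"
    and finQ: "len Q (carrier R) \<noteq> \<infinity>"
begin

text \<open>The \<open>Q\<close>-adic filtration is the case of a single index: its generators in
  degree one reduce it, the \<open>d\<close>-fold difference of the colength gives the symbol, and
  on a leading term of degree \<open>d\<close> this is \<open>d!\<close> times the coefficient,
  hence the multiplicity. The degrees in \<open>zs\<close> are arbitrary by
  \<open>chi_const\<close>.\<close>

lemma hs_multiplicity_eq_chi:
  fixes zs :: "('a \<times> 'g::ordered_ab_group_add) list"
  assumes dim: "the_enat (krull_dim R) = d" and zs: "map fst zs = xs"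
  shows "hs_multiplicity R Q = real_of_int (chi zs (\<lambda>_. {\<zero>}) (\<lambda>_. carrier R) n)"
proof -
  \<comment> \<open>Indexing by \<open>unit\<close> lets the results on tuples of ideals apply to
    the powers of \<open>Q\<close>.\<close>
  define J where "J = (\<lambda>_::unit. Q)"
  note iQ = Q_ideal[OF xs Q_def d(1) finQ]
  have J: "ideal (J i) R" for i by (simp add: J_def iQ)
  have jp: "jadic J n = ipow Q (nat (n ()))" for n
    unfolding ideal_tuple_power_def J_def
    by (rule iprod_single[where f = "\<lambda>i. ipow Q (nat (n i))" and i = "()", OF ipow_ideal[OF iQ]]) simp
  have finJ: "len (jadic J n) (carrier R) \<noteq> \<infinity>" for n
    unfolding jp by (rule len_ipow_finite[OF xs Q_def d(1) finQ])
  have xQ: "x \<in> Q" if "x \<in> set xs" for x using that genideal_self[OF xs] Q_def by blast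
  have nilx: "\<exists>k::nat. x [^] k \<in> J i" if "x \<in> set xs" for i x
    using xQ[OF that] xs that by (intro exI[of _ "Suc 0"]) (auto simp: J_def)
  obtain C where
    "\<forall>v A w c. 0 \<le> c \<longrightarrow> (\<forall>k. ideal (A k) R) \<longrightarrow>
       (\<forall>k. jadic J (\<lambda>i. w i + int k * int (v i)) \<subseteq> A k) \<longrightarrow>
       (\<forall>k. A k \<subseteq> jadic J (\<lambda>i. int k * int (v i) - c i)) \<longrightarrow>
       (\<lambda>k. colen (A k) / real k ^ d) \<longlonglongrightarrow> (\<Sum>\<kappa> | tdeg \<kappa> = d. C \<kappa> * monom_val \<kappa> (\<lambda>i. real (v i)))"
    by (rule exE[OF mixed_limit[OF J finJ xs Q_def d finQ nilx]]) (assumption, elim conjE, rule that)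
  note C = this[THEN spec, THEN spec, THEN spec, THEN spec, THEN mp, THEN mp, THEN mp, THEN mp]
  have lim: "(\<lambda>k. colen (jadic J (\<lambda>i. int k * int (v i))) / real k ^ d)
      \<longlonglongrightarrow> (\<Sum>\<kappa> | tdeg \<kappa> = d. C \<kappa> * monom_val \<kappa> (\<lambda>i. real (v i)))" for v
    using C[of "\<lambda>_. 0" "\<lambda>k. jadic J (\<lambda>i. int k * int (v i))" "\<lambda>_. 0" v] jadic_ideal[where J = J, OF J]
    by (simp add: zero_fun_def[symmetric])
  define ys where "ys = map (\<lambda>x. (x, unit_vec () :: unit \<Rightarrow> int)) xs"
  define ps where "ps = map (\<lambda>_. ((), 1 :: nat)) xs"
  have ys_ps: "map snd ys = map step_vec ps"
    by (simp add: ys_def ps_def step_vec_def scale_def)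
  have fy: "fst ` set ys = set xs" by (force simp: ys_def)
  have "\<exists>n2. \<forall>n\<ge>n2. iter_diff (map snd ys) (\<lambda>n. length_int (jadic J n) (carrier R)) n
     = chi ys (\<lambda>_. {\<zero>}) (\<lambda>_. carrier R) n"
  proof (rule iter_diff_length_eq_chi[OF jadic_noeth_filtration[where J = J, OF J]])
    show "gens ys" using xs unit_vec_nonneg by (auto simp: gens_def ys_def)
    have "jadic J (unit_vec i) = J i" for i by (rule jadic_unit_vec) (rule J)
    thus "\<forall>(x, a)\<in>set ys. x \<in> jadic J a" using xQ by (auto simp: ys_def J_def)
    show "reduced_by ys (jadic J)" unfolding ys_def
      by (rule jadic_reduced_by[where J = J, OF J xs]) (simp add: J_def Q_def)
    show "fin_colength (fst ` set ys)" unfolding fy fin_colength_def using xs finQ Q_def by simp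
    show "len (jadic J n) (carrier R) \<noteq> \<infinity>" for n by (rule finJ)
  qed
  then obtain n2 where n2: "\<And>n. n \<ge> n2 \<Longrightarrow> iter_diff (map snd ys) (\<lambda>n. length_int (jadic J n) (carrier R)) n
     = chi ys (\<lambda>_. {\<zero>}) (\<lambda>_. carrier R) n" by blast
  have "map fst ys = map fst zs" unfolding zs by (simp add: ys_def comp_def)
  hence "iter_diff (map step_vec ps) (\<lambda>n. colen (jadic J n)) m = real_of_int (chi zs (\<lambda>_. {\<zero>}) (\<lambda>_. carrier R) n)"
    if "n2 \<le> m" for m
    using n2[OF that] chi_const[of ys zs "{\<zero>}" "carrier R" m n]
    unfolding colen_eq_length_int of_int_iter_diff ys_ps by simp
  from iter_diff_leading_coeff[OF lim this, of n2] d(1)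
  have "real_of_int (chi zs (\<lambda>_. {\<zero>}) (\<lambda>_. carrier R) n)
     = C (cnt ps) * (\<Prod>j\<in>UNIV. fact (cnt ps j)) * (\<Prod>p\<leftarrow>ps. real (snd p))"
    by (simp add: ps_def)
  moreover have "length ps = d" by (simp add: ps_def d(1))
  moreover have "cnt ps = (\<lambda>_. d)" by (auto simp: ps_def d(1) filter_map comp_def fun_eq_iff)
  moreover have "(\<Prod>p\<leftarrow>ps. real (snd p)) = 1" unfolding ps_def by (induction xs) auto
  ultimately have chi: "real_of_int (chi zs (\<lambda>_. {\<zero>}) (\<lambda>_. carrier R) n) = fact d * C (\<lambda>_. d)"
    by (simp add: UNIV_unit)
  have "{\<kappa> :: unit \<Rightarrow> nat. tdeg \<kappa> = d} = {\<lambda>_. d}" by (auto simp: UNIV_unit fun_eq_iff)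
  hence "(\<lambda>k. colen (ipow Q k) / real k ^ d) \<longlonglongrightarrow> C (\<lambda>_. d)"
    using lim[of "\<lambda>_. 1"] by (simp add: jp monom_val_def)
  from hs_multiplicity_eq[OF dim iQ this] chi show ?thesis by simp
qed

end

theorem multiplicity_joint_reduction:
  fixes \<mm> :: "'a set" and I :: "'s::finite \<Rightarrow> nat \<Rightarrow> 'a set"
  assumes "local_ring R \<mm>" and "krull_dim R = enat d" and "1 \<le> d"
    and "\<And>i. graded_primary_family R \<mm> (I i)" and "multigraded_admissible R \<mm> I"
    and "(\<Sum>i\<in>UNIV. dd i) = d" and "strong_joint_reduction R I dd a x"
    and "Q = Idl {x i j | i j. j \<in> {1..dd i}}"
  shows "primary_to R \<mm> Q \<and> hs_multiplicity R Q =
      real (\<Prod>i\<in>UNIV. \<Prod>j\<in>{1..dd i}. a i j) * mixed_multiplicity R I dd"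
proof -
  note loc = assms(1)
  have dim: "the_enat (krull_dim R) = d" using assms(2) by simp

  \<comment> \<open>The filtration of products and its sandwich between \<open>J\<close>-adic
    powers\<close>
  obtain J where J0: "\<And>i. primary_to R \<mm> (J i)" and adm: "admissible_wrt R I J"
    using assms(5) by (auto simp: multigraded_admissible_def)
  note J = primary_toD(1)[OF loc J0]
  have I0: "I i 0 = carrier R" and Ipos: "n > 0 \<Longrightarrow> primary_to R \<mm> (I i n)" for i n
    using assms(4)[of i] by (auto simp: graded_primary_family_def)
  have iI: "ideal (I i n) R" for i n
    using I0 oneideal primary_toD(1)[OF loc Ipos] by (cases "n = 0") auto
  have nilI: "\<exists>k::nat. y [^] k \<in> I i n" if "y \<in> \<mm>" for y i n
  proof (cases "n = 0")
    case True
    have "y [^] (0::nat) \<in> I i n" using True I0 by simp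
    thus ?thesis by blast
  qed (use primary_toD(2)[OF loc Ipos that] in blast)
  define F where "F = family_prod_int R I"
  have F_eq: "F n = iprod (\<lambda>i. I i (nat (n i))) UNIV" for n
    by (simp add: F_def family_prod_int_def family_prod_def)
  have F_nat: "F (\<lambda>i. int (n i)) = family_prod R I n" for n
    by (simp add: F_def family_prod_int_def)
  have iF: "ideal (F n) R" for n unfolding F_eq by (intro iprod_ideal iI)
  have "F 0 = iprod (\<lambda>_. \<one>\<^bsub>ideals_set R\<^esub>) (UNIV :: 's set)" unfolding F_eq by (simp add: I0)
  also have "\<dots> = carrier R"
    using comm_monoid.finprod_one_eqI[OF ideals_set_comm_monoid, of UNIV "\<lambda>_. \<one>\<^bsub>ideals_set R\<^esub>"] by simp
  finally have F0: "F 0 = carrier R" .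
  have JF: "jadic J n \<subseteq> F n" and FF: "F n \<cdot> F m \<subseteq> F (n + m)" and Fm: "n \<le> m \<Longrightarrow> F m \<subseteq> F n" for n m
    using adm unfolding admissible_wrt_def F_def plus_fun_def le_fun_def by (elim conjE; blast)+
  have fF: "filtration F"
    unfolding filtration_def
  proof (intro conjI allI impI ballI)
    show "f \<otimes> b \<in> F (n + m)" if "f \<in> F m" "b \<in> F n" for m n f b
      using FF[of m n] ideal_prod.prod[OF that] by (auto simp: add.commute)
  qed (fact iF F0 | (erule Fm))+
  obtain c where c: "0 \<le> c" "\<And>n. F n \<subseteq> jadic J (n - c)"
  proof -
    have "finite_module_over (laurent_ring R TYPE('s)) (extended_rees_base R J) (extended_rees R I)"
      using adm unfolding admissible_wrt_def by (elim conjE)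
    from finite_module_sandwich[OF J iF[unfolded F_def] this] show ?thesis
      by (elim exE conjE) (rule that, assumption, unfold F_def, erule spec)
  qed
  have JFu: "J i \<subseteq> F (unit_vec i)" for i
    using JF[of "unit_vec i"] jadic_unit_vec[where J = J, OF J] by simp
  have nF: "noeth_filtration F"
    by (rule noeth_filtration_of_sandwich[where J = J, OF J fF JFu c(2,1)])
  have nilF: "\<exists>k::nat. y [^] k \<in> F n" if "y \<in> \<mm>" for y n
    unfolding F_eq using that max_ideal(4)[OF loc] nilI[OF that] by (intro iprod_pow_mem iI) auto
  have finF: "len (F n) (carrier R) \<noteq> \<infinity>" for n
    by (rule finite_len_of_nilpotent[OF max_ideal(1)[OF loc] iF nilF])
  have nilJ: "\<exists>k::nat. y [^] k \<in> jadic J n" if "y \<in> \<mm>" for y n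
  proof -
    have yc: "y \<in> carrier R" using that max_ideal(4)[OF loc] by blast
    have "\<exists>k::nat. y [^] k \<in> ipow (J i) (nat (n i))" for i
    proof -
      obtain k :: nat where "y [^] k \<in> J i" using primary_toD(2)[OF loc J0 \<open>y \<in> \<mm>\<close>] by blast
      hence "(y [^] k) [^] nat (n i) \<in> ipow (J i) (nat (n i))" by (rule pow_mem_ipow[OF _ J])
      thus ?thesis using yc by (auto simp: nat_pow_pow)
    qed
    thus ?thesis unfolding ideal_tuple_power_def using yc by (intro iprod_pow_mem ipow_ideal J) auto
  qed
  have finJ: "len (jadic J n) (carrier R) \<noteq> \<infinity>" for n
    by (rule finite_len_of_nilpotent[OF max_ideal(1)[OF loc] jadic_ideal[where J = J, OF J] nilJ])

  \<comment> \<open>The joint reduction as a list of homogeneous elements\<close>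
  define SL where "SL = (SIGMA i : UNIV. {1..dd i})"
  have "finite SL" unfolding SL_def by auto
  then obtain L where L: "set L = SL" "distinct L" using finite_distinct_list by blast
  define zs where "zs = map (\<lambda>(i, j). (x i j, step_vec (i, a i j))) L"
  define ps where "ps = map (\<lambda>(i, j). (i, a i j)) L"
  define xs where "xs = map fst zs"
  have zp: "map snd zs = map step_vec ps" by (auto simp: zs_def ps_def)
  have set_xs: "set xs = {x i j | i j. j \<in> {1..dd i}}"
    unfolding xs_def zs_def using L(1) by (force simp: SL_def)
  have len_L: "length L = d"
    using distinct_card[OF L(2)] L(1) assms(6) by (simp add: SL_def)
  have d: "d = length xs" "d \<ge> 1" using len_L assms(3) by (simp_all add: xs_def zs_def)
  have red: "\<And>i j. j \<in> {1..dd i} \<Longrightarrow> 0 < a i j \<and> x i j \<in> I i (a i j)"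
    using assms(7) unfolding strong_joint_reduction_def by blast
  have xc: "x i j \<in> carrier R" if "j \<in> {1..dd i}" for i j using red[OF that] iI ideal.Icarr by metis
  have xsc: "set xs \<subseteq> carrier R" unfolding set_xs using xc by blast
  have Q: "Q = Idl (set xs)" unfolding set_xs by (rule assms(8))
  have iQ: "ideal Q R" unfolding Q by (rule genideal_ideal[OF xsc])
  obtain n0 where n0: "\<And>n. (\<forall>i. n0 i \<le> n i) \<Longrightarrow> family_prod R I n =
      (\<Oplus>\<^bsub>ideals_set R\<^esub>i\<in>UNIV. \<Oplus>\<^bsub>ideals_set R\<^esub>j\<in>{1..dd i}. x i j <# family_prod R I (n(i := n i - a i j)))"
    using assms(7) unfolding strong_joint_reduction_def by blast
  have redF: "reduced_by zs F" unfolding reduced_by_def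
  proof (intro exI allI impI)
    fix m :: "'s \<Rightarrow> int" assume m: "(\<lambda>i. int (n0 i)) \<le> m"
    let ?U = "\<Union>(x, a)\<in>set zs. {x \<otimes> f | f. f \<in> F (m - a)}"
    have Uc: "?U \<subseteq> carrier R"
      using L(1) xc iF ideal.Icarr unfolding zs_def SL_def by fastforce
    have iU: "ideal (Idl ?U) R" by (rule genideal_ideal[OF Uc])
    define n where "n = (\<lambda>i. nat (m i))"
    have n: "n0 i \<le> n i" "int (n i) = m i" for i using le_funD[OF m, of i] by (simp_all add: n_def)
    have part: "ideal (x i j <# family_prod R I (n(i := n i - a i j))) R"
      "x i j <# family_prod R I (n(i := n i - a i j)) \<subseteq> Idl ?U" if j: "j \<in> {1..dd i}" for i j
    proof -
      have "family_prod R I (n(i := n i - a i j)) = F (m - step_vec (i, a i j))"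
      proof -
        \<comment> \<open>Truncated subtraction of naturals agrees with the extension of
          \<open>F\<close> to negative degrees through \<open>nat\<close>.\<close>
        have "nat ((m - step_vec (i, a i j)) k) = (n(i := n i - a i j)) k" for k
          using n(2)[of k] by (simp add: minus_apply step_vec_def scale_def unit_vec_def nat_diff_distrib' flip: n(2))
        hence "(\<lambda>k. nat ((m - step_vec (i, a i j)) k)) = n(i := n i - a i j)" by (rule ext)
        thus ?thesis unfolding F_def family_prod_int_def by (rule arg_cong[OF sym])
      qed
      note e = this
      show "ideal (x i j <# family_prod R I (n(i := n i - a i j))) R"
        unfolding e by (rule l_coset_ideal[OF xc[OF j] iF])
      have "(x i j, step_vec (i, a i j)) \<in> set zs" using L(1) j unfolding zs_def SL_def set_map by (intro image_eqI[of _ _ "(i, j)"]) auto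
      hence "x i j <# F (m - step_vec (i, a i j)) \<subseteq> ?U" unfolding l_coset_def by (intro subsetI UN_I) auto
      thus "x i j <# family_prod R I (n(i := n i - a i j)) \<subseteq> Idl ?U"
        unfolding e using genideal_self[OF Uc] by blast
    qed
    have inner: "ideal (\<Oplus>\<^bsub>ideals_set R\<^esub>j\<in>{1..dd i}. x i j <# family_prod R I (n(i := n i - a i j))) R \<and>
        (\<Oplus>\<^bsub>ideals_set R\<^esub>j\<in>{1..dd i}. x i j <# family_prod R I (n(i := n i - a i j))) \<subseteq> Idl ?U" for i
      by (rule isum_least[OF _ part iU]) simp
    have "(\<lambda>i. int (n i)) = m" using n(2) by simp
    hence "F m = family_prod R I n" using F_nat[of n] by simp
    also have "\<dots> \<subseteq> Idl ?U" unfolding n0[of n, rule_format, OF n(1)]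
      using isum_least[OF _ _ _ iU, of UNIV "\<lambda>i. \<Oplus>\<^bsub>ideals_set R\<^esub>j\<in>{1..dd i}. x i j <# family_prod R I (n(i := n i - a i j))"]
        inner by simp
    finally show "F m \<subseteq> Idl ?U" .
  qed

  \<comment> \<open>\<open>Q\<close> is primary to the maximal ideal\<close>
  have nilQ: "\<exists>k::nat. y [^] k \<in> Q" if "y \<in> \<mm>" for y
  proof -
    \<comment> \<open>A single degree suffices: the reduction places \<open>F n1\<close> inside
      \<open>Q\<close>, and \<open>\<mm>\<close> is nil modulo \<open>F n1\<close>.\<close>
    obtain n1 where n1: "F n1 \<subseteq> Idl (\<Union>(x, a)\<in>set zs. {x \<otimes> f | f. f \<in> F (n1 - a)})"
      using redF unfolding reduced_by_def by blast
    have "(\<Union>(x, a)\<in>set zs. {x \<otimes> f | f. f \<in> F (n1 - a)}) \<subseteq> Q"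
    proof safe
      fix u b f assume "(u, b) \<in> set zs" and f: "f \<in> F (n1 - b)"
      hence u: "u \<in> set xs" by (force simp: xs_def)
      have "f \<in> carrier R" using f iF ideal.Icarr by metis
      hence "f \<otimes> u \<in> Q" using u genideal_self[OF xsc] Q by (intro ideal_mult[OF iQ]) auto
      thus "u \<otimes> f \<in> Q" using \<open>f \<in> carrier R\<close> u xsc by (auto simp: m_comm)
    qed
    hence "F n1 \<subseteq> Q" using n1 genideal_minimal[OF iQ] by blast
    thus ?thesis using nilF[OF that, of n1] by blast
  qed
  have "set xs \<subseteq> \<mm>" 
  proof
    fix y assume "y \<in> set xs"
    then obtain i j where "j \<in> {1..dd i}" "y = x i j" unfolding set_xs by blast
    thus "y \<in> \<mm>" using red[of j i] primary_toD(3)[OF loc Ipos, of "a i j" i] by blast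
  qed
  hence "Q \<subseteq> \<mm>" unfolding Q by (rule genideal_minimal[OF max_ideal(2)[OF loc]])
  hence prim: "primary_to R \<mm> Q" using nilQ by (intro primary_toI[OF loc iQ])
  have finQ: "len Q (carrier R) \<noteq> \<infinity>"
    by (rule finite_len_of_nilpotent[OF max_ideal(1)[OF loc] iQ nilQ])
  have nilx: "\<exists>k::nat. y [^] k \<in> J i" if "y \<in> set xs" for i y
    using that \<open>set xs \<subseteq> \<mm>\<close> primary_toD(2)[OF loc J0] by blast

  \<comment> \<open>The leading form of the colengths and of the multiplicities\<close>
  obtain C where
    C0: "\<forall>\<kappa>. tdeg \<kappa> \<noteq> d \<longrightarrow> C \<kappa> = 0" and
    C': "\<forall>v A w c. 0 \<le> c \<longrightarrow> (\<forall>k. ideal (A k) R) \<longrightarrow>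
       (\<forall>k. jadic J (\<lambda>i. w i + int k * int (v i)) \<subseteq> A k) \<longrightarrow>
       (\<forall>k. A k \<subseteq> jadic J (\<lambda>i. int k * int (v i) - c i)) \<longrightarrow>
       (\<lambda>k. colen (A k) / real k ^ d) \<longlonglongrightarrow> (\<Sum>\<kappa> | tdeg \<kappa> = d. C \<kappa> * monom_val \<kappa> (\<lambda>i. real (v i)))"
    by (rule exE[OF mixed_limit[where J = J, OF J finJ xsc Q d finQ nilx]]) (assumption, elim conjE, rule that)
  note C = C'[THEN spec, THEN spec, THEN spec, THEN spec, THEN mp, THEN mp, THEN mp, THEN mp]
  have Fc: "F (\<lambda>i. int k * int (v i)) \<subseteq> jadic J (\<lambda>i. int k * int (v i) - c i)" for k v
    using c(2)[of "\<lambda>i. int k * int (v i)"] by (simp add: fun_diff_def)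
  have limF: "(\<lambda>k. colen (F (\<lambda>i. int k * int (v i))) / real k ^ d)
      \<longlonglongrightarrow> (\<Sum>\<kappa> | tdeg \<kappa> = d. C \<kappa> * monom_val \<kappa> (\<lambda>i. real (v i)))" for v
    by (rule C[of c _ "\<lambda>_. 0"]) (use c(1) iF JF Fc in auto)
  \<comment> \<open>The powers of \<open>F(v)\<close> satisfy \<open>J^(kv) \<subseteq> F(v)^k
    \<subseteq> F(kv) \<subseteq> J^(kv-c)\<close>, so the same \<open>C\<close> that describes the
    colengths of \<open>F(kv)\<close> describes the multiplicity of \<open>F(v)\<close>.\<close>
  have hsF: "hs_multiplicity R (family_prod R I v)
      = fact d * (\<Sum>\<kappa> | tdeg \<kappa> = d. C \<kappa> * monom_val \<kappa> (\<lambda>i. real (v i)))" for v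
  proof (rule hs_multiplicity_eq[OF dim])
    show iv: "ideal (family_prod R I v) R" using iF F_nat by metis
    show "(\<lambda>k. colen (ipow (family_prod R I v) k) / real k ^ d)
      \<longlonglongrightarrow> (\<Sum>\<kappa> | tdeg \<kappa> = d. C \<kappa> * monom_val \<kappa> (\<lambda>i. real (v i)))"
    proof (rule C[of c _ "\<lambda>_. 0"], goal_cases)
      case 1
      show ?case by (rule c(1))
    next
      case 2
      show ?case using ipow_ideal[OF iv] by blast
    next
      case 3
      show ?case
      proof
        fix k
        have "jadic J (\<lambda>i. int k * int (v i)) = ipow (jadic J (\<lambda>i. int (v i))) k"
          by (rule jadic_ipow[where J = J, OF J, symmetric]) (simp add: le_fun_def)
        also have "\<dots> \<subseteq> ipow (family_prod R I v) k"
          using JF[of "\<lambda>i. int (v i)"] F_nat[of v] by (intro ipow_mono) simp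
        finally show "jadic J (\<lambda>i. 0 + int k * int (v i)) \<subseteq> ipow (family_prod R I v) k" by simp
      qed
    next
      case 4
      show ?case
      proof
        fix k
        have "ipow (F (\<lambda>i. int (v i))) k \<subseteq> F (\<lambda>i. int k * int (v i))"
          by (rule ipow_graded_subset[where P = F, OF iF F0 _ subset_refl])
            (use filtrationD(4)[OF fF] in \<open>metis add.commute\<close>)
        thus "ipow (family_prod R I v) k \<subseteq> jadic J (\<lambda>i. int k * int (v i) - c i)"
          using Fc[of k v] F_nat[of v] by simp
      qed
    qed
  qed

  \<comment> \<open>Comparison of the two evaluations of the symbol\<close>
  have gz: "gens zs" "\<forall>(x, a)\<in>set zs. x \<in> F a"
  proof -
    show "gens zs" using L(1) xc by (auto simp: gens_def zs_def SL_def step_vec_def intro!: scale_nonneg unit_vec_nonneg)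
    have "F (step_vec (i, a i j)) = I i (a i j)" for i j
    proof -
      have "F (step_vec (i, a i j)) = I i (nat (step_vec (i, a i j) i))" unfolding F_eq
        by (rule iprod_single[where f = "\<lambda>k. I k (nat (step_vec (i, a i j) k))", OF iI])
          (simp add: step_vec_def scale_def unit_vec_def I0)
      thus ?thesis by (simp add: step_vec_def scale_def unit_vec_def)
    qed
    thus "\<forall>(x, a)\<in>set zs. x \<in> F a" using L(1) red by (auto simp: zs_def SL_def)
  qed
  have "fst ` set zs = set xs" by (simp add: xs_def)
  hence fc: "fin_colength (fst ` set zs)" using xsc finQ Q by (simp add: fin_colength_def)
  obtain n2 where n2: "\<And>n. n2 \<le> n \<Longrightarrow> iter_diff (map snd zs) (\<lambda>n. length_int (F n) (carrier R)) n
     = chi zs (\<lambda>_. {\<zero>}) (\<lambda>_. carrier R) n"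
    using iter_diff_length_eq_chi[OF nF gz redF fc finF] by blast
  \<comment> \<open>The elements of \<open>zs\<close> generate \<open>Q\<close>, and the symbol of
    the constant family ignores their multidegrees; so the number computed from \<open>F\<close> is
    the multiplicity of \<open>Q\<close>.\<close>
  have "hs_multiplicity R Q = real_of_int (chi zs (\<lambda>_. {\<zero>}) (\<lambda>_. carrier R) n)" for n
    by (rule hs_multiplicity_eq_chi[OF xsc Q d finQ dim]) (simp add: xs_def)
  hence "iter_diff (map step_vec ps) (\<lambda>n. colen (F n)) n = hs_multiplicity R Q" if "n2 \<le> n" for n
    using n2[OF that] unfolding colen_eq_length_int of_int_iter_diff zp by simp
  from iter_diff_leading_coeff[OF limF this, of n2] len_L
  have hsQ: "hs_multiplicity R Q = C (cnt ps) * (\<Prod>j\<in>UNIV. fact (cnt ps j)) * (\<Prod>p\<leftarrow>ps. real (snd p))"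
    by (simp add: ps_def)
  have cnt_ps: "cnt ps i = dd i" for i
  proof -
    have "cnt ps i = length (filter (\<lambda>q. fst q = i) L)"
      by (simp add: ps_def filter_map comp_def case_prod_unfold)
    also have "\<dots> = card ({q. fst q = i} \<inter> SL)" using distinct_length_filter[OF L(2)] L(1) by simp
    also have "{q. fst q = i} \<inter> SL = {i} \<times> {1..dd i}" by (auto simp: SL_def)
    finally show ?thesis by (simp add: card_cartesian_product)
  qed
  note hsQ[unfolded cnt_ps]
  moreover have "(\<Prod>p\<leftarrow>ps. real (snd p)) = real (\<Prod>i\<in>UNIV. \<Prod>j\<in>{1..dd i}. a i j)"
  proof -
    have "(\<Prod>p\<leftarrow>ps. real (snd p)) = (\<Prod>q\<leftarrow>L. real (case q of (i, j) \<Rightarrow> a i j))"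
      by (simp add: ps_def comp_def case_prod_unfold)
    also have "\<dots> = (\<Prod>q\<in>SL. real (case q of (i, j) \<Rightarrow> a i j))"
      using prod.distinct_set_conv_list[OF L(2)] L(1) by metis
    also have "\<dots> = (\<Prod>i\<in>UNIV. \<Prod>j\<in>{1..dd i}. real (a i j))"
      unfolding SL_def by (subst prod.Sigma) (auto simp: case_prod_unfold)
    finally show ?thesis by simp
  qed
  \<comment> \<open>The factorials produced by differencing the leading form are exactly those that
    turn its coefficient into the mixed multiplicity.\<close>
  moreover have "mixed_multiplicity R I dd = (\<Prod>i\<in>UNIV. fact (dd i)) * C dd"
    by (rule mixed_multiplicity_eqI[OF dim C0[rule_format] hsF])
  ultimately show ?thesis using prim by simp
qed

end

theorem theorem4p10:
  fixes R :: "('a, 'b) ring_scheme" and \<mm> :: "'a set"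
    and I :: "'s::finite \<Rightarrow> nat \<Rightarrow> 'a set"
    and dd :: "'s \<Rightarrow> nat" and d :: nat
    and a :: "'s \<Rightarrow> nat \<Rightarrow> nat" and x :: "'s \<Rightarrow> nat \<Rightarrow> 'a"
    and Q :: "'a set"
  assumes "noetherian_ring R" and "local_ring R \<mm>"
    and "krull_dim R = enat d" and "1 \<le> d"
    and "\<And>i. graded_primary_family R \<mm> (I i)"
    and "multigraded_admissible R \<mm> I"
    and "(\<Sum>i\<in>UNIV. dd i) = d"
    and "strong_joint_reduction R I dd a x"
    and "Q = Idl\<^bsub>R\<^esub> {x i j | i j. j \<in> {1..dd i}}"
  shows "primary_to R \<mm> Q \<and>
    hs_multiplicity R Q =
      real (\<Prod>i\<in>UNIV. \<Prod>j\<in>{1..dd i}. a i j) * mixed_multiplicity R I dd"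
proof -
  have "cring R" using assms(2) unfolding local_ring_def by (elim conjE)
  then interpret noetherian_cring R using assms(1) by (rule noetherian_cring.intro)
  show ?thesis by (rule multiplicity_joint_reduction[OF assms(2-9)])
qed

end
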